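(* Let $N\ge 3$ be an integer and let $p>1+\frac{4}{N-2}$; if $N\ge 4$, assume moreover $p\le 1+\frac{4}{N-3}$. Consider the equation $$(1-\rho^{2})u''+\left(\frac{N-1}{\rho}-2(\alpha+1)\rho\right)u'-\alpha(\alpha+1)u+|u|^{p-1}u=0.\qquad (E)$$ There exists $C=C(N,p)>0$ with the following property. Let $\sigma>1$ and let $u\in C^2([0,\sigma))$ be a solution of $(E)$ on $(0,\sigma)$ such that $u(0)\ge C$. Then $u$ is positive and can be extended to a positive analytic solution of $(E)$ on $(0,+\infty)$. Furthermore there exists $L>0$ such that $$\lim_{\rho\to+\infty}\rho^{\alpha}u(\rho)=L\quad\text{and}\quad \lim_{\rho\to+\infty}\rho^{\alpha+1}u'(\rho)=-\alpha L.\qquad (A)$$ In particular: (i) if $N=3$, or $N\ge4$ and $p<1+\frac4{N-3}$, and $(u_n)_{n\ge0}$ is a sequence such that each $u_n$ is a positive analytic function on $[0,\rho_n)$, $\rho_n>1$, solving $(E)$ on $(0,\rho_n)$, with $u_n-u_\infty$ having exactly $n+1$ zeros on $(0,1)$ and $\lim_{n\to\infty}u_n(0)=+\infty$, then for all large $n$, $u_n$ extends to a global solution on $(0,+\infty)$ satisfying $(A)$ for some $L>0$; (ii) if $N\ge 4$ and $p=1+\frac{4}{N-3}$, then for $C_0$ large and $n_0\ge1$, any positive analytic function $u$ on $[0,\rho_0)$, $\rho_0>1$, solving $(E)$ on $(0,\rho_0)$ with $u(0)>C_0$, $u(1)=b_0$ and $u-u_\infty$ having at least $n_0$ zeros on $(0,1)$,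 extends to a global solution on $(0,+\infty)$ satisfying $(A)$ for some $L>0$.
   Context: Notation: $\alpha=\frac{2}{p-1}$, $b_0=\left[\frac{2(p+1)}{(p-1)^2}\right]^{\frac1{p-1}}$, $b_\infty=\left(\alpha(N-2-\alpha)\right)^{\alpha/2}$, and $u_\infty(\rho)=b_\infty\rho^{-\alpha}$ for $\rho>0$. The prime denotes $d/d\rho$. *)

theory Defs
  imports "HOL-Analysis.Analysis"
begin

definition alpha :: "real \<Rightarrow> real" where
  "alpha p = 2 / (p - 1)"

definition b_zero :: "real \<Rightarrow> real" where
  "b_zero p = (2 * (p + 1) / (p - 1)\<^sup>2) powr (1 / (p - 1))"

definition b_infty :: "nat \<Rightarrow> real \<Rightarrow> real" where
  "b_infty N p = (alpha p * (real N - 2 - alpha p)) powr (alpha p / 2)"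

definition u_infty :: "nat \<Rightarrow> real \<Rightarrow> real \<Rightarrow> real" where
  "u_infty N p \<rho> = b_infty N p * \<rho> powr (- alpha p)"

(* Derivatives are taken within S, hence are one-sided at an endpoint belonging to the
   interval S; on an open S they are the usual ones. *)
definition C2_on :: "real set \<Rightarrow> (real \<Rightarrow> real) \<Rightarrow> bool" where
  "C2_on S u \<longleftrightarrow>
     (\<exists>u1 u2. (\<forall>x\<in>S. (u has_real_derivative u1 x) (at x within S)) \<and>
              (\<forall>x\<in>S. (u1 has_real_derivative u2 x) (at x within S)) \<and>
              continuous_on S u2)"

(* The library's analytic_on is restricted to complex functions. At an endpoint belonging
   to the interval S the expansion is only required on the side lying in S. *)
definition real_analytic_on :: "real set \<Rightarrow> (real \<Rightarrow> real) \<Rightarrow> bool" where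
  "real_analytic_on S u \<longleftrightarrow>
     (\<forall>x\<in>S. \<exists>r>0. \<exists>a :: nat \<Rightarrow> real.
        \<forall>y\<in>S. \<bar>y - x\<bar> < r \<longrightarrow> (\<lambda>n. a n * (y - x) ^ n) sums u y)"

(* Classical solutions of
     (1 - \<rho>^2) u'' + ((N-1)/\<rho> - 2(\<alpha>+1)\<rho>) u' - \<alpha>(\<alpha>+1) u + |u|^(p-1) u = 0
   on an open set S of positive reals. *)
definition solves_E :: "nat \<Rightarrow> real \<Rightarrow> real set \<Rightarrow> (real \<Rightarrow> real) \<Rightarrow> bool" where
  "solves_E N p S u \<longleftrightarrow> C2_on S u \<and>
     (\<forall>\<rho>\<in>S.
        (1 - \<rho>\<^sup>2) * deriv (deriv u) \<rho>
        + ((real N - 1) / \<rho> - 2 * (alpha p + 1) * \<rho>) * deriv u \<rho>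
        - alpha p * (alpha p + 1) * u \<rho>
        + \<bar>u \<rho>\<bar> powr (p - 1) * u \<rho> = 0)"

definition asymptotics_A :: "real \<Rightarrow> real \<Rightarrow> (real \<Rightarrow> real) \<Rightarrow> bool" where
  "asymptotics_A p L u \<longleftrightarrow>
     ((\<lambda>\<rho>. \<rho> powr alpha p * u \<rho>) \<longlongrightarrow> L) at_top \<and>
     ((\<lambda>\<rho>. \<rho> powr (alpha p + 1) * deriv u \<rho>) \<longlongrightarrow> - alpha p * L) at_top"

definition zeros_diff :: "nat \<Rightarrow> real \<Rightarrow> (real \<Rightarrow> real) \<Rightarrow> real set" where
  "zeros_diff N p u = {\<rho>. 0 < \<rho> \<and> \<rho> < 1 \<and> u \<rho> - u_infty N p \<rho> = 0}"

definition extends_globally :: "nat \<Rightarrow> real \<Rightarrow> real \<Rightarrow> (real \<Rightarrow> real) \<Rightarrow> (real \<Rightarrow> real) \<Rightarrow> bool" where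
  "extends_globally N p \<sigma> u v \<longleftrightarrow>
     (\<forall>\<rho>\<in>{0..<\<sigma>}. v \<rho> = u \<rho>) \<and> solves_E N p {0<..} v"

end

(* With s = ln rho and w = rho^alpha u the equation becomes
     (1 - rho^2) w'' + (be - rho^2) w' + f(w) = 0,  be = N - 2 - 2 alpha in (0,1],
   where f(w) = |w|^(p-1) w - ka w with ka = alpha (N - 2 - alpha),
   and the singular solution becomes the constant b, which minimises the primitive F of f. For rho <= 1 the
   energy E = (1 - rho^2) w'^2 / 2 + F(w) satisfies E' = - be w'^2. It vanishes at rho = 0, so it is negative
   afterwards and w has no zero in (0,1]. If u(0) is large, a fixed amount of energy is already lost at a scale
   rho ~ u(0)^(-1/alpha); the long logarithmic time left before rho = 1 then forces E near F(b), so that w(1) is near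
   b and w'(1) is small. Beyond the light cone rho = 1 the equation is a small perturbation of w'' + w' = 0 with an
   integrable coefficient, so w stays near b, is global, and converges with w' -> 0. Analyticity, including at
   the singular point rho = 1, holds because a C^2 solution is the fixed point of a contraction that
   extends to a complex neighbourhood. *)

theory Submission
  imports Defs "HOL-Complex_Analysis.Complex_Analysis"
begin

section \<open>The nonlinearity and its primitive\<close>

text \<open>The vanishing of the leading coefficient at \<open>s = 0\<close> shapes the proof. The
  kinetic term of the energy carries the same factor, so a small energy at the light cone controls
  \<open>w\<close> but not \<open>v\<close>. For \<open>be < 1\<close> the equation at
  \<open>s = 0\<close> itself, (1 - be) v(0) = f(w(0)), recovers v(0). For \<open>be = 1\<close> it
  degenerates to w(0) = b, and v(0) is bounded instead by the displacement that a nonzero velocity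
  would have caused shortly before. The bound \<open>be \<le> 1\<close> enters twice more: beyond
  the cone (1 - be) v acts as extra damping, and at the regular singular point \<rho> = 1 the
  exponent (1 - be) / 2 must be nonnegative. The threshold depends on \<open>p\<close>,
  \<open>al\<close>, \<open>be\<close> only, because the scale u(0)^(-1/al) is a mere translation in
  s: the energy lost early does not depend on u(0), and a larger u(0) only adds waiting time. Beyond
  the cone \<open>f\<close> is truncated to a globally Lipschitz function; an a priori bound shows
  that the solution never meets the truncation. Positivity of u is what makes the nonlinearity
  holomorphic near the values of u.\<close>

lemma has_real_derivative_abs_powr_mult:
  assumes "q > (0::real)"
  shows "((\<lambda>x. \<bar>x\<bar> powr q * x) has_real_derivative (q + 1) * \<bar>x\<bar> powr q) (at x)"
proof (cases x "0::real" rule: linorder_cases)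
  case greater
  have "((\<lambda>x. x powr q * x) has_real_derivative (q + 1) * \<bar>x\<bar> powr q) (at x)"
    using greater by (auto intro!: derivative_eq_intros has_real_derivative_powr
        simp: powr_diff field_simps)
  then show ?thesis
    by (rule has_field_derivative_transform_within_open[of _ _ _ "{0<..}"]) (use greater in auto)
next
  case less
  have "((\<lambda>x. (-x) powr q * x) has_real_derivative (q + 1) * \<bar>x\<bar> powr q) (at x)"
    using less DERIV_chain2[OF has_real_derivative_powr[of "-x" q] DERIV_minus[OF DERIV_ident]]
    by (auto intro!: derivative_eq_intros simp: powr_diff field_simps)
  then show ?thesis
    by (rule has_field_derivative_transform_within_open[of _ _ _ "{..<0}"]) (use less in auto)
next
  case equal
  have "((\<lambda>h::real. \<bar>h\<bar> powr q) \<longlongrightarrow> \<bar>0\<bar> powr q) (at 0)"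
    using assms by (intro tendsto_powr' tendsto_rabs tendsto_ident_at tendsto_const) auto
  then have "(\<lambda>h::real. \<bar>h\<bar> powr q) \<midarrow>0\<rightarrow> 0" using assms by simp
  then have "(\<lambda>h::real. (\<bar>h\<bar> powr q * h) / h) \<midarrow>0\<rightarrow> 0"
    by (rule Lim_transform_eventually) (auto simp: eventually_at_filter)
  then show ?thesis using assms equal by (simp add: has_field_derivative_iff)
qed

text \<open>Here \<open>al\<close> is the exponent \<open>\<alpha>\<close> and \<open>be = N - 2 - 2 \<alpha>\<close>, so that \<open>N - 1 = 1 + 2 al + be\<close>; the
  condition \<open>be \<le> 1\<close> is \<open>p \<le> 1 + 4 / (N - 3)\<close>, and holds automatically when \<open>N = 3\<close>.\<close>

locale profile_ode =
  fixes p al be :: real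
  assumes p: "p > 1" and al: "al > 0" "al * (p - 1) = 2" and be: "be > 0" "be \<le> 1"
begin

definition ka :: real where "ka = al * (al + be)"
definition f :: "real \<Rightarrow> real" where "f x = \<bar>x\<bar> powr (p - 1) * x - ka * x"
definition F :: "real \<Rightarrow> real" where "F x = \<bar>x\<bar> powr (p - 1) * x * x / (p + 1) - ka * x\<^sup>2 / 2"
text \<open>Since \<open>1 / (p - 1) = al / 2\<close> and \<open>al + be = N - 2 - al\<close>, this
  is \<open>b_infty N p\<close>.\<close>

definition b :: real where "b = ka powr (1 / (p - 1))"

lemma ka: "ka > 0" using al be by (simp add: ka_def)
lemma b: "b > 0" using ka by (simp add: b_def)
lemma b_powr: "b powr (p - 1) = ka" using ka p by (simp add: b_def powr_powr)

lemma f_deriv: "(f has_real_derivative p * \<bar>x\<bar> powr (p - 1) - ka) (at x)"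
  unfolding f_def
  using DERIV_diff[OF has_real_derivative_abs_powr_mult[of "p - 1" x] DERIV_cmult[OF DERIV_ident, of ka]] p
  by simp

lemma F_deriv: "(F has_real_derivative f x) (at x)"
proof -
  have "((\<lambda>x. \<bar>x\<bar> powr (p - 1) * x * x) has_real_derivative
      (p - 1 + 1) * \<bar>x\<bar> powr (p - 1) * x + 1 * (\<bar>x\<bar> powr (p - 1) * x)) (at x)"
    using p by (intro DERIV_mult has_real_derivative_abs_powr_mult DERIV_ident) simp
  from DERIV_diff[OF DERIV_cdivide[OF this, of "p + 1"] DERIV_cmult[OF DERIV_pow[of 2 x UNIV], of "ka / 2"]]
  have "(F has_real_derivative
      ((p - 1 + 1) * \<bar>x\<bar> powr (p - 1) * x + 1 * (\<bar>x\<bar> powr (p - 1) * x)) / (p + 1) - ka / 2 * (2 * x)) (at x)"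
    by (simp add: F_def[abs_def])
  moreover have "((p - 1 + 1) * \<bar>x\<bar> powr (p - 1) * x + 1 * (\<bar>x\<bar> powr (p - 1) * x)) / (p + 1) - ka / 2 * (2 * x) = f x"
    using p by (simp add: f_def field_simps)
  ultimately show ?thesis by simp
qed

lemma f_cont: "continuous_on S f"
  by (intro continuous_at_imp_continuous_on ballI DERIV_isCont[OF f_deriv])

lemma F_cont: "continuous_on S F"
  by (intro continuous_at_imp_continuous_on ballI DERIV_isCont[OF F_deriv])

lemma f_alt: "f x = x * (\<bar>x\<bar> powr (p - 1) - b powr (p - 1))"
  by (simp add: f_def b_powr algebra_simps)

lemma f_zero [simp]: "f 0 = 0" "f b = 0" using b by (simp_all add: f_alt)

lemma F_zero [simp]: "F 0 = 0" by (simp add: F_def)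

lemma F_minus [simp]: "F (- x) = F x" by (simp add: F_def)

lemma F_abs: "F \<bar>x\<bar> = F x" by (simp add: abs_if)

lemma f_neg: "0 < x \<Longrightarrow> x < b \<Longrightarrow> f x < 0"
  unfolding f_alt using p by (intro mult_pos_neg) (auto intro!: powr_less_mono2)

lemma f_pos: "b < x \<Longrightarrow> f x > 0"
  unfolding f_alt using p b by (intro mult_pos_pos) (auto intro!: powr_less_mono2)

lemma f_eq_0_iff: "f x = 0 \<longleftrightarrow> x = 0 \<or> \<bar>x\<bar> = b"
proof -
  have "\<bar>x\<bar> powr (p - 1) = b powr (p - 1) \<longleftrightarrow> \<bar>x\<bar> = b"
    using p b by (metis abs_ge_zero less_imp_le powr_less_mono2 linorder_neqE_linordered_idom less_irrefl diff_gt_0_iff_gt)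
  then show ?thesis unfolding f_alt by auto
qed

lemma F_less: "0 \<le> x \<Longrightarrow> x < y \<Longrightarrow> y \<le> b \<Longrightarrow> F y < F x"
  using DERIV_neg_imp_decreasing_open[of x y F] F_deriv f_neg F_cont by force

lemma F_greater: "b \<le> x \<Longrightarrow> x < y \<Longrightarrow> F x < F y"
  using DERIV_pos_imp_increasing_open[of x y F] F_deriv f_pos F_cont by force

lemma F_b_neg: "F b < 0" using F_less[of 0 b] b by simp

lemma F_min: "F b \<le> F x"
  using F_less[of "\<bar>x\<bar>" b] F_greater[of b "\<bar>x\<bar>"] F_abs[of x] by (cases "\<bar>x\<bar>" b rule: linorder_cases) auto

text \<open>\<open>F\<close> is strictly monotone on either side of \<open>b\<close>, so it exceeds
  its minimum by a margin off any neighbourhood. The sign condition excludes the mirror minimum at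
  \<open>- b\<close>.\<close>

lemma F_near_min:
  assumes "e > 0"
  obtains d where "d > 0" "\<And>x. x \<ge> 0 \<Longrightarrow> F x \<le> F b + d \<Longrightarrow> \<bar>x - b\<bar> < e"
proof -
  \<comment> \<open>The cap \<open>b / 2\<close> keeps \<open>b - e'\<close> in the range where
    \<open>F\<close> is decreasing.\<close>
  define e' where "e' = min e (b / 2)"
  have e': "e' > 0" "e' \<le> e" "e' < b" using assms b by (auto simp: e'_def)
  define d where "d = min (F (b - e') - F b) (F (b + e') - F b) / 2"
  have d: "d > 0" using F_less[of "b - e'" b] F_greater[of b "b + e'"] e' by (simp add: d_def)
  have "\<bar>x - b\<bar> < e" if "x \<ge> 0" "F x \<le> F b + d" for x
  proof (rule ccontr)
    assume "\<not> \<bar>x - b\<bar> < e"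
    then consider "x \<le> b - e'" | "b + e' \<le> x" using e' by linarith
    then have "F b + 2 * d \<le> F x"
    proof cases
      case 1
      then have "F (b - e') \<le> F x" using F_less[of x "b - e'"] e' that by (cases "x = b - e'") auto
      then show ?thesis by (auto simp: d_def)
    next
      case 2
      then have "F (b + e') \<le> F x" using F_greater[of "b + e'" x] e' by (cases "x = b + e'") auto
      then show ?thesis by (auto simp: d_def)
    qed
    then show False using that d by linarith
  qed
  then show ?thesis using that d by blast
qed

text \<open>The positive zero of \<open>F\<close>: the set where \<open>F\<close> is nonpositive is
  the interval from \<open>- R\<close> to \<open>R\<close>.\<close>

definition R :: real where "R = (ka * (p + 1) / 2) powr (1 / (p - 1))"

lemma R: "R > 0" using ka p by (simp add: R_def)

lemma F_nonpos_bound: assumes "F x \<le> 0" shows "\<bar>x\<bar> \<le> R"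
proof (rule ccontr)
  assume "\<not> \<bar>x\<bar> \<le> R"
  then have x: "R < \<bar>x\<bar>" "x \<noteq> 0" using R by auto
  have "R powr (p - 1) = ka * (p + 1) / 2" using ka p by (simp add: R_def powr_powr)
  moreover have "R powr (p - 1) < \<bar>x\<bar> powr (p - 1)" using x R p by (intro powr_less_mono2) auto
  ultimately have "x * x * (ka * (p + 1) / 2) < x * x * \<bar>x\<bar> powr (p - 1)"
    using x by (intro mult_strict_left_mono) (auto simp: zero_less_mult_iff linorder_neq_iff)
  then have "0 < F x" using p by (simp add: F_def field_simps power2_eq_square)
  then show False using assms by simp
qed

text \<open>The upper bound on \<open>F\<close> excludes the equilibrium 0 and the lower one
  excludes \<open>b\<close> and \<open>- b\<close>, so \<open>f\<close> has no zero on a compact set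
  of such points.\<close>

lemma f_gap:
  assumes "e0 > 0" "e > 0"
  obtains c where "c > 0" "\<And>x. F x \<le> - e0 \<Longrightarrow> F b + e \<le> F x \<Longrightarrow> c \<le> (f x)\<^sup>2"
proof -
  define K where "K = {-R..R} \<inter> {x. F x \<le> - e0} \<inter> {x. F b + e \<le> F x}"
  have "closed {x. F x \<le> - e0}" "closed {x. F b + e \<le> F x}"
    using F_cont by (auto intro!: closed_Collect_le continuous_intros)
  then have K: "compact K"
    unfolding K_def by (intro compact_Int_closed) auto
  have in_K: "x \<in> K" if "F x \<le> - e0" "F b + e \<le> F x" for x
    using that F_nonpos_bound[of x] assms by (auto simp: K_def abs_le_iff)
  show ?thesis
  proof (cases "K = {}")
    case True
    then show ?thesis using in_K that[of 1] by auto
  next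
    case False
    have "continuous_on K (\<lambda>x. (f x)\<^sup>2)" by (intro continuous_intros f_cont)
    from continuous_attains_inf[OF K False this]
    obtain x where x: "x \<in> K" "\<And>y. y \<in> K \<Longrightarrow> (f x)\<^sup>2 \<le> (f y)\<^sup>2" by blast
    have "f x \<noteq> 0"
    proof
      assume "f x = 0"
      then have "F x = 0 \<or> F x = F b" using f_eq_0_iff[of x] F_abs[of x] by auto
      then show False using x(1) assms by (auto simp: K_def)
    qed
    then show ?thesis using that[of "(f x)\<^sup>2"] x(2) in_K by auto
  qed
qed

lemma f_deriv_bounded:
  obtains C where "C \<ge> 0" "\<And>x. \<bar>x\<bar> \<le> M \<Longrightarrow> \<bar>p * \<bar>x\<bar> powr (p - 1) - ka\<bar> \<le> C"
proof (rule that[of "p * \<bar>M\<bar> powr (p - 1) + ka"])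
  show "0 \<le> p * \<bar>M\<bar> powr (p - 1) + ka" using p ka by simp
  fix x assume "\<bar>x\<bar> \<le> M"
  then have "p * \<bar>x\<bar> powr (p - 1) \<le> p * \<bar>M\<bar> powr (p - 1)"
    using p by (intro mult_left_mono powr_mono2) auto
  moreover have "0 \<le> p * \<bar>x\<bar> powr (p - 1)" using p by simp
  ultimately show "\<bar>p * \<bar>x\<bar> powr (p - 1) - ka\<bar> \<le> p * \<bar>M\<bar> powr (p - 1) + ka"
    using ka by linarith
qed

lemma f_lipschitz:
  obtains L where "L \<ge> 0" "\<And>x y. \<bar>x\<bar> \<le> M \<Longrightarrow> \<bar>y\<bar> \<le> M \<Longrightarrow> \<bar>f x - f y\<bar> \<le> L * \<bar>x - y\<bar>"
proof -
  obtain C where C: "C \<ge> 0" "\<And>x. \<bar>x\<bar> \<le> M \<Longrightarrow> \<bar>p * \<bar>x\<bar> powr (p - 1) - ka\<bar> \<le> C"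
    using f_deriv_bounded by blast
  have "\<bar>f x - f y\<bar> \<le> C * \<bar>x - y\<bar>" if "\<bar>x\<bar> \<le> M" "\<bar>y\<bar> \<le> M" for x y
    using field_differentiable_bound[of "{-M..M}" f "\<lambda>x. p * \<bar>x\<bar> powr (p - 1) - ka" C x y]
      has_field_derivative_at_within[OF f_deriv] C that by (auto simp: abs_le_iff)
  then show ?thesis using that C(1) by blast
qed

end

section \<open>The interior of the light cone\<close>

text \<open>Continuous induction: the set where \<open>g\<close> fails the bound is compact, and its
  least element contradicts the third premise.\<close>

lemma continuous_barrier:
  fixes g :: "real \<Rightarrow> real"
  assumes "continuous_on {a..b} g" "g a > c"
    and "\<And>t. a < t \<Longrightarrow> t \<le> b \<Longrightarrow> (\<And>s. a \<le> s \<Longrightarrow> s < t \<Longrightarrow> g s > c) \<Longrightarrow> g t > c"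
    and "t \<in> {a..b}"
  shows "g t > c"
proof (rule ccontr)
  assume n: "\<not> g t > c"
  define S where "S = {x \<in> {a..b}. g x \<le> c}"
  have "closed S" unfolding S_def by (intro continuous_on_closed_Collect_le assms(1)) auto
  then have "compact S" using bounded_subset[of "{a..b}" S] unfolding compact_eq_bounded_closed
    by (metis (no_types, lifting) S_def bounded_closed_interval mem_Collect_eq subsetI)
  moreover have "S \<noteq> {}" using n assms(4) by (auto simp: S_def)
  ultimately obtain m where m: "m \<in> S" "\<And>x. x \<in> S \<Longrightarrow> m \<le> x"
    using compact_attains_inf[of S] by blast
  have "m \<noteq> a" using m(1) assms(2) by (auto simp: S_def)
  then have "a < m" "m \<le> b" using m(1) by (auto simp: S_def)
  moreover have "g s > c" if "a \<le> s" "s < m" for s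
    using m(2)[of s] that \<open>m \<le> b\<close> by (force simp: S_def)
  ultimately have "g m > c" by (rule assms(3))
  then show False using m(1) by (auto simp: S_def)
qed

lemma antimono_by_deriv:
  fixes g :: "real \<Rightarrow> real"
  assumes "a \<le> b" "continuous_on {a..b} g"
    and "\<And>x. a < x \<Longrightarrow> x < b \<Longrightarrow> (g has_real_derivative g' x) (at x)"
    and "\<And>x. a < x \<Longrightarrow> x < b \<Longrightarrow> g' x \<le> 0"
  shows "g b \<le> g a"
  by (rule DERIV_nonpos_imp_decreasing_open[OF assms(1) _ assms(2)]) (use assms(3,4) in blast)

lemma mvt_bound:
  fixes g :: "real \<Rightarrow> real"
  assumes "a \<le> b" "continuous_on {a..b} g"
    and "\<And>x. a < x \<Longrightarrow> x < b \<Longrightarrow> (g has_real_derivative g' x) (at x)"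
    and "\<And>x. a < x \<Longrightarrow> x < b \<Longrightarrow> \<bar>g' x\<bar> \<le> C"
  shows "\<bar>g b - g a\<bar> \<le> C * (b - a)"
proof (cases "a = b")
  case False
  then have "a < b" using assms(1) by simp
  obtain l x where x: "a < x" "x < b" "(g has_real_derivative l) (at x)" "g b - g a = (b - a) * l"
    using MVT[OF \<open>a < b\<close> assms(2)] assms(3) by (metis real_differentiable_def)
  have "l = g' x" using DERIV_unique[OF x(3)] assms(3) x by blast
  then show ?thesis using x assms(4)[of x] \<open>a < b\<close>
    by (simp add: abs_mult mult.commute[of "b - a"] mult_right_mono)
qed simp

text \<open>Linear lower bound for the degenerate coefficient just inside the light cone. It follows
  from exp(2s)(1 - 2s) \<le> 1 \<le> (1 + s)(1 - 2s); the second inequality is where s \<ge> -1/2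
  enters.\<close>

lemma one_minus_exp_ge:
  fixes s :: real
  assumes "-1/2 \<le> s" "s \<le> 0"
  shows "- s \<le> 1 - exp (2 * s)"
proof -
  have "1 + 2 * (- s) \<le> exp (2 * (- s))" using exp_ge_add_one_self[of "2 * (-s)"] by simp
  then have "exp (2 * s) * (1 + 2 * (- s)) \<le> exp (2 * s) * exp (2 * (- s))" by (rule mult_left_mono) simp
  also have "\<dots> = 1" by (simp flip: exp_add)
  finally have 1: "exp (2 * s) * (1 - 2 * s) \<le> 1" by simp
  have "(1 + s) * (1 - 2 * s) = 1 + (- s) * (1 + 2 * s)" by (simp add: algebra_simps)
  also have "\<dots> \<ge> 1" using mult_nonneg_nonneg[of "- s" "1 + 2 * s"] assms by simp
  finally have "exp (2 * s) * (1 - 2 * s) \<le> (1 + s) * (1 - 2 * s)" using 1 by linarith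
  then have "exp (2 * s) \<le> 1 + s" using assms by (simp add: mult_le_cancel_right)
  then show ?thesis by linarith
qed

section \<open>Logarithmic variables, the energy identity and the approach to the light cone\<close>

context profile_ode
begin

text \<open>At \<open>s = 0\<close> the coefficient of \<open>z\<close> vanishes, and the equation
  becomes the compatibility condition (be - 1) v(0) + f(w(0)) = 0.\<close>

definition sol :: "real set \<Rightarrow> (real \<Rightarrow> real) \<Rightarrow> (real \<Rightarrow> real) \<Rightarrow> (real \<Rightarrow> real) \<Rightarrow> bool" where
  "sol I w v z \<longleftrightarrow> (\<forall>s\<in>I. (w has_real_derivative v s) (at s) \<and> (v has_real_derivative z s) (at s)
     \<and> (1 - exp (2 * s)) * z s + (be - exp (2 * s)) * v s + f (w s) = 0)"

text \<open>At the centre only continuity of \<open>u\<close> and \<open>u1\<close> is retained: it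
  makes \<open>w\<close> and \<open>v\<close> vanish as s tends to minus infinity, and it makes the
  weighted derivative of the initial phase start from 0.\<close>

definition regular_sol :: "real \<Rightarrow> (real \<Rightarrow> real) \<Rightarrow> (real \<Rightarrow> real) \<Rightarrow> (real \<Rightarrow> real) \<Rightarrow> bool" where
  "regular_sol \<sigma> u u1 u2 \<longleftrightarrow> continuous_on {0..<\<sigma>} u \<and> continuous_on {0..<\<sigma>} u1 \<and>
    (\<forall>\<rho>\<in>{0<..<\<sigma>}. (u has_real_derivative u1 \<rho>) (at \<rho>) \<and> (u1 has_real_derivative u2 \<rho>) (at \<rho>)
      \<and> (1 - \<rho>\<^sup>2) * u2 \<rho> + ((1 + 2 * al + be) / \<rho> - 2 * (al + 1) * \<rho>) * u1 \<rho>
          - al * (al + 1) * u \<rho> + \<bar>u \<rho>\<bar> powr (p - 1) * u \<rho> = 0)"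

definition lw :: "(real \<Rightarrow> real) \<Rightarrow> real \<Rightarrow> real" where
  "lw u s = exp (al * s) * u (exp s)"

definition lv :: "(real \<Rightarrow> real) \<Rightarrow> (real \<Rightarrow> real) \<Rightarrow> real \<Rightarrow> real" where
  "lv u u1 s = exp (al * s) * (al * u (exp s) + exp s * u1 (exp s))"

definition lz :: "(real \<Rightarrow> real) \<Rightarrow> (real \<Rightarrow> real) \<Rightarrow> (real \<Rightarrow> real) \<Rightarrow> real \<Rightarrow> real" where
  "lz u u1 u2 s = exp (al * s) * (al\<^sup>2 * u (exp s) + (2 * al + 1) * exp s * u1 (exp s) + (exp s)\<^sup>2 * u2 (exp s))"

text \<open>The left side is \<rho>^2 exp(al s) times that of the equation for \<open>u\<close>;
  \<open>al * (p - 1) = 2\<close> is what gives the nonlinear term the same factor.\<close>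

lemma emden_fowler:
  assumes "regular_sol \<sigma> u u1 u2"
  shows "sol {s. exp s < \<sigma>} (lw u) (lv u u1) (lz u u1 u2)"
  unfolding sol_def
proof safe
  fix s assume s: "exp s < \<sigma>"
  define r where "r = exp s"
  have r: "r > 0" "r < \<sigma>" using s by (auto simp: r_def)
  have du: "(u has_real_derivative u1 r) (at r)" "(u1 has_real_derivative u2 r) (at r)"
    and ode: "(1 - r\<^sup>2) * u2 r + ((1 + 2 * al + be) / r - 2 * (al + 1) * r) * u1 r
          - al * (al + 1) * u r + \<bar>u r\<bar> powr (p - 1) * u r = 0"
    using assms r by (auto simp: regular_sol_def)
  have cu: "((\<lambda>s. u (exp s)) has_real_derivative u1 r * r) (at s)"
    unfolding r_def by (rule DERIV_chain2[where f = u]) (use du(1) in \<open>auto simp: r_def\<close>)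
  have cu1: "((\<lambda>s. u1 (exp s)) has_real_derivative u2 r * r) (at s)"
    unfolding r_def by (rule DERIV_chain2[where f = u1]) (use du(2) in \<open>auto simp: r_def\<close>)
  show "(lw u has_real_derivative lv u u1 s) (at s)"
    unfolding lw_def[abs_def] lv_def
    by (rule derivative_eq_intros cu refl | simp)+ (simp add: r_def algebra_simps)
  show "(lv u u1 has_real_derivative lz u u1 u2 s) (at s)"
    unfolding lv_def[abs_def] lz_def
    by (rule derivative_eq_intros cu cu1 refl | simp)+ (simp add: r_def algebra_simps power2_eq_square)
  have e2: "exp (2 * s) = r\<^sup>2" by (simp add: r_def flip: exp_double)
  define a where "a = exp (al * s)"
  have a: "a > 0" by (simp add: a_def)
  have "\<bar>lw u s\<bar> powr (p - 1) = a powr (p - 1) * \<bar>u r\<bar> powr (p - 1)"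
    unfolding lw_def r_def[symmetric] a_def[symmetric] using a by (simp add: abs_mult powr_mult)
  also have "a powr (p - 1) = r\<^sup>2"
  proof -
    have "al * s * (p - 1) = 2 * s" using al(2) by (simp add: mult.assoc mult.left_commute[of s] mult.commute)
    then show ?thesis unfolding a_def by (simp add: powr_def e2[symmetric] mult.commute)
  qed
  finally have fw: "f (lw u s) = a * (r\<^sup>2 * (\<bar>u r\<bar> powr (p - 1) * u r) - ka * u r)"
    unfolding f_def lw_def r_def[symmetric] a_def[symmetric] by (simp add: algebra_simps)
  have nl: "\<bar>u r\<bar> powr (p - 1) * u r = - ((1 - r\<^sup>2) * u2 r + ((1 + 2 * al + be) / r - 2 * (al + 1) * r) * u1 r
          - al * (al + 1) * u r)" using ode by linarith
  show "(1 - exp (2 * s)) * lz u u1 u2 s + (be - exp (2 * s)) * lv u u1 s + f (lw u s) = 0"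
    unfolding fw nl e2 lz_def lv_def r_def[symmetric] a_def[symmetric] ka_def
    using r(1) by (simp add: field_simps power2_eq_square)
qed

definition E :: "(real \<Rightarrow> real) \<Rightarrow> (real \<Rightarrow> real) \<Rightarrow> real \<Rightarrow> real" where
  "E w v s = (1 - exp (2 * s)) * (v s)\<^sup>2 / 2 + F (w s)"

text \<open>Differentiating the weight 1 - exp(2s) produces -exp(2s) v^2, which absorbs the part of
  the damping coefficient that has the wrong sign; only \<open>be\<close> remains.\<close>

lemma E_deriv:
  assumes "sol I w v z" "s \<in> I"
  shows "(E w v has_real_derivative - be * (v s)\<^sup>2) (at s)"
proof -
  have d: "(w has_real_derivative v s) (at s)" "(v has_real_derivative z s) (at s)"
    and ode: "(1 - exp (2 * s)) * z s + (be - exp (2 * s)) * v s + f (w s) = 0"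
    using assms by (auto simp: sol_def)
  have "((\<lambda>s. F (w s)) has_real_derivative f (w s) * v s) (at s)"
    by (rule DERIV_chain2[OF F_deriv d(1)])
  then have "(E w v has_real_derivative
      ((- 2 * exp (2 * s)) * (v s)\<^sup>2 + (2 * v s * z s) * (1 - exp (2 * s))) / 2 + f (w s) * v s) (at s)"
    unfolding E_def[abs_def] by (auto intro!: derivative_eq_intros d)
  moreover have "((- 2 * exp (2 * s)) * (v s)\<^sup>2 + (2 * v s * z s) * (1 - exp (2 * s))) / 2 + f (w s) * v s
     = v s * ((1 - exp (2 * s)) * z s + (be - exp (2 * s)) * v s + f (w s)) - be * (v s)\<^sup>2"
    by (simp add: field_simps power2_eq_square)
  ultimately show ?thesis using ode by simp
qed

lemma E_antimono:
  assumes "sol I w v z" "{s..t} \<subseteq> I" "s \<le> t"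
  shows "E w v t \<le> E w v s"
proof (rule DERIV_nonpos_imp_nonincreasing[OF assms(3)])
  fix x assume "s \<le> x" "x \<le> t"
  then have "(E w v has_real_derivative - be * (v x)\<^sup>2) (at x)"
    using assms by (intro E_deriv[OF assms(1)]) auto
  then show "\<exists>y. (E w v has_real_derivative y) (at x) \<and> y \<le> 0"
    using be by (intro exI[of _ "- be * (v x)\<^sup>2"]) simp
qed

lemma F_le_E: "s \<le> 0 \<Longrightarrow> F (w s) \<le> E w v s"
  by (simp add: E_def)

lemma regular_tendsto:
  assumes "regular_sol \<sigma> u u1 u2" "\<sigma> > 0"
  shows "(lw u \<longlongrightarrow> 0) at_bot" "(lv u u1 \<longlongrightarrow> 0) at_bot"
proof -
  have e: "filterlim exp (at 0 within {0..<\<sigma>}) (at_bot :: real filter)"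
    unfolding filterlim_at
  proof
    have "\<forall>\<^sub>F x in at_bot. x < ln \<sigma>" by (rule eventually_gt_at_bot)
    then show "\<forall>\<^sub>F x in at_bot. exp x \<in> {0..<\<sigma>} \<and> exp x \<noteq> 0"
      by eventually_elim (use assms(2) in \<open>metis atLeastLessThan_iff exp_gt_zero exp_ln exp_less_mono less_imp_le less_irrefl\<close>)
  qed (rule exp_at_bot)
  have ea: "((\<lambda>s. exp (al * s)) \<longlongrightarrow> 0) at_bot"
    by (rule filterlim_compose[OF exp_at_bot]) (use al in \<open>auto intro!: filterlim_tendsto_pos_mult_at_bot[OF tendsto_const]  filterlim_ident\<close>)
  have "(u \<longlongrightarrow> u 0) (at 0 within {0..<\<sigma>})" "(u1 \<longlongrightarrow> u1 0) (at 0 within {0..<\<sigma>})"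
    using assms by (auto simp: regular_sol_def continuous_on_def)
  then have uu: "((\<lambda>s. u (exp s)) \<longlongrightarrow> u 0) at_bot" "((\<lambda>s. u1 (exp s)) \<longlongrightarrow> u1 0) at_bot"
    using e by (auto intro: filterlim_compose)
  show "(lw u \<longlongrightarrow> 0) at_bot"
    using tendsto_mult[OF ea uu(1)] by (simp add: lw_def[abs_def])
  show "(lv u u1 \<longlongrightarrow> 0) at_bot"
    using tendsto_mult[OF ea tendsto_add[OF tendsto_mult[OF tendsto_const[of al] uu(1)] tendsto_mult[OF exp_at_bot uu(2)]]]
    by (simp add: lv_def[abs_def])
qed

lemma E_nonpos:
  assumes "regular_sol \<sigma> u u1 u2" "\<sigma> > 0" "exp s < \<sigma>"
  shows "E (lw u) (lv u u1) s \<le> 0"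
proof (rule tendsto_lowerbound)
  have e: "((\<lambda>s::real. exp (2 * s)) \<longlongrightarrow> 0) at_bot"
    by (rule filterlim_compose[OF exp_at_bot]) (auto intro!: filterlim_tendsto_pos_mult_at_bot[OF tendsto_const] filterlim_ident)
  have "((\<lambda>s. F (lw u s)) \<longlongrightarrow> F 0) at_bot"
    by (rule isCont_tendsto_compose[OF DERIV_isCont[OF F_deriv] regular_tendsto(1)[OF assms(1,2)]])
  then show "(E (lw u) (lv u u1) \<longlongrightarrow> 0) at_bot"
    using tendsto_add[OF tendsto_divide[OF tendsto_mult[OF tendsto_diff[OF tendsto_const[of 1] e]
      tendsto_power[OF regular_tendsto(2)[OF assms(1,2)], of 2]] tendsto_const[of 2]]]
    by (fastforce simp: E_def[abs_def])
  have "\<forall>\<^sub>F x in at_bot. x \<le> s" by (rule eventually_le_at_bot)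
  then show "\<forall>\<^sub>F x in at_bot. E (lw u) (lv u u1) s \<le> E (lw u) (lv u u1) x"
  proof eventually_elim
    case (elim x)
    have "{x..s} \<subseteq> {s. exp s < \<sigma>}" using assms(3) by (auto intro: le_less_trans[OF exp_le_cancel_iff[THEN iffD2]])
    then show ?case using E_antimono[OF emden_fowler[OF assms(1)] _ elim] by simp
  qed
qed simp

lemma initial_phase_step:
  assumes reg: "regular_sol \<sigma> u u1 u2"
    and A: "u 0 = A" "A > 0" "al * (al + 1) \<le> (A / 2) powr (p - 1)"
    and t: "0 < t" "t < \<sigma>" "t \<le> 1 / 2" "t\<^sup>2 \<le> A powr (1 - p) / 4"
    and lower: "\<And>r. 0 \<le> r \<Longrightarrow> r < t \<Longrightarrow> u r > A / 2"
  shows "A / 2 < u t" "u t \<le> A"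
proof -
  \<comment> \<open>The integrating factor r^\<nu> (1 - r^2)^\<gamma>: (1 - r^2) m'/m is \<nu>/r -
    (\<nu> + 2 \<gamma>) r, and \<nu> + 2 \<gamma> = 2 (al + 1) makes this the coefficient of
    u'.\<close>
  define \<nu> \<gamma> where "\<nu> = 1 + 2 * al + be" and "\<gamma> = (1 - be) / 2"
  have \<nu>: "\<nu> > 1" and \<gamma>: "0 \<le> \<gamma>" "\<gamma> \<le> 1" using al be by (auto simp: \<nu>_def \<gamma>_def)
  define m where "m r = r powr \<nu> * (1 - r\<^sup>2) powr \<gamma>" for r
  define P where "P r = m r * u1 r" for r
  have r2: "3 / 4 \<le> 1 - r\<^sup>2 \<and> 1 - r\<^sup>2 \<le> 1" if "0 \<le> r" "r \<le> t" for r
  proof -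
    have "r\<^sup>2 \<le> (1 / 2)\<^sup>2" using that t by (intro power_mono) auto
    then show ?thesis by (simp add: power2_eq_square)
  qed
  have du: "(u has_real_derivative u1 r) (at r)" "(u1 has_real_derivative u2 r) (at r)"
    and ode: "(1 - r\<^sup>2) * u2 r + ((1 + 2 * al + be) / r - 2 * (al + 1) * r) * u1 r
          - al * (al + 1) * u r + \<bar>u r\<bar> powr (p - 1) * u r = 0" if "0 < r" "r \<le> t" for r
    using reg that t by (auto simp: regular_sol_def)
  have cu: "continuous_on {0..t} u" and cu1: "continuous_on {0..t} u1"
    using reg t by (auto simp: regular_sol_def intro: continuous_on_subset)
  have cm: "continuous_on {0..t} m"
    unfolding m_def
    by (intro continuous_on_mult continuous_on_powr' continuous_intros) (use \<nu> r2 in force)+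
  have cP: "continuous_on {0..t} P" unfolding P_def by (intro continuous_on_mult cm cu1)
  define g where "g r = al * (al + 1) * u r - \<bar>u r\<bar> powr (p - 1) * u r" for r
  have dP: "(P has_real_derivative m r / (1 - r\<^sup>2) * g r) (at r)" if r: "0 < r" "r \<le> t" for r
  proof -
    have x: "1 - r\<^sup>2 > 0" using r2[of r] r by linarith
    have d1: "((\<lambda>r. r powr \<nu>) has_real_derivative \<nu> * r powr (\<nu> - 1)) (at r)"
      by (rule has_real_derivative_powr) (use r in auto)
    have d2: "((\<lambda>r. (1 - r\<^sup>2) powr \<gamma>) has_real_derivative (\<gamma> * (1 - r\<^sup>2) powr (\<gamma> - 1)) * (- 2 * r)) (at r)"
      by (rule DERIV_chain2[where f = "\<lambda>y. y powr \<gamma>" and g = "\<lambda>r. 1 - r\<^sup>2", OF has_real_derivative_powr[OF x]])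
        (auto intro!: derivative_eq_intros)
    have "(P has_real_derivative (\<nu> * r powr (\<nu> - 1) * (1 - r\<^sup>2) powr \<gamma>
        + (\<gamma> * (1 - r\<^sup>2) powr (\<gamma> - 1)) * (- 2 * r) * r powr \<nu>) * u1 r + u2 r * m r) (at r)"
      unfolding P_def[abs_def] m_def by (intro DERIV_mult d1 d2 du(2) r)
    moreover have "(\<nu> * r powr (\<nu> - 1) * (1 - r\<^sup>2) powr \<gamma>
        + (\<gamma> * (1 - r\<^sup>2) powr (\<gamma> - 1)) * (- 2 * r) * r powr \<nu>) * u1 r + u2 r * m r = m r / (1 - r\<^sup>2) * g r"
    proof -
      have "r powr (\<nu> - 1) = r powr \<nu> / r" "(1 - r\<^sup>2) powr (\<gamma> - 1) = (1 - r\<^sup>2) powr \<gamma> / (1 - r\<^sup>2)"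
        using r x by (auto simp: powr_diff)
      then have "(\<nu> * r powr (\<nu> - 1) * (1 - r\<^sup>2) powr \<gamma>
        + (\<gamma> * (1 - r\<^sup>2) powr (\<gamma> - 1)) * (- 2 * r) * r powr \<nu>) * u1 r + u2 r * m r
        = m r / (1 - r\<^sup>2) * ((\<nu> * (1 - r\<^sup>2) / r - 2 * \<gamma> * r) * u1 r + (1 - r\<^sup>2) * u2 r)"
      proof -
        have "(\<nu> * (X / r) * Y + (\<gamma> * (Y / q)) * (- 2 * r) * X) * y1 + y2 * (X * Y)
            = X * Y / q * ((\<nu> * q / r - 2 * \<gamma> * r) * y1 + q * y2)" if "r \<noteq> 0" "q \<noteq> 0" for X Y q y1 y2 :: real
          using that by (simp add: field_simps)
        then show ?thesis using r x \<open>r powr (\<nu> - 1) = _\<close> \<open>(1 - r\<^sup>2) powr (\<gamma> - 1) = _\<close>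
          unfolding m_def by simp
      qed
      also have "\<nu> * (1 - r\<^sup>2) / r - 2 * \<gamma> * r = (1 + 2 * al + be) / r - 2 * (al + 1) * r"
        using r unfolding \<nu>_def \<gamma>_def by (simp add: field_simps power2_eq_square)
      also have "((1 + 2 * al + be) / r - 2 * (al + 1) * r) * u1 r + (1 - r\<^sup>2) * u2 r = g r"
        using ode[OF r] unfolding g_def by linarith
      finally show ?thesis .
    qed
    ultimately show ?thesis by simp
  qed
  have P0: "P 0 = 0" using \<nu> by (simp add: P_def m_def)
  have mnn: "m r \<ge> 0" for r by (simp add: m_def)
  have gneg: "g r \<le> 0" if "0 \<le> r" "r < t" for r
  proof -
    have ur: "u r > A / 2" "u r > 0" using lower[OF that] A by auto
    then have "(A / 2) powr (p - 1) \<le> \<bar>u r\<bar> powr (p - 1)" using A p by (intro powr_mono2) auto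
    then have "al * (al + 1) * u r \<le> \<bar>u r\<bar> powr (p - 1) * u r"
      using A(3) ur by (intro mult_right_mono) auto
    then show ?thesis by (simp add: g_def)
  qed
  have Pneg: "P r \<le> 0" if r: "0 \<le> r" "r < t" for r
  proof -
    have "P r \<le> P 0"
    proof (rule DERIV_nonpos_imp_decreasing_open[OF r(1)])
      show "continuous_on {0..r} P" using cP by (rule continuous_on_subset) (use r in auto)
      fix x assume x: "0 < x" "x < r"
      have "0 \<le> m x / (1 - x\<^sup>2)" using mnn[of x] r2[of x] x r by (intro divide_nonneg_pos) auto
      then have "m x / (1 - x\<^sup>2) * g x \<le> 0" using gneg[of x] x r by (intro mult_nonneg_nonpos) auto
      then show "\<exists>y. (P has_real_derivative y) (at x) \<and> y \<le> 0"
        using dP[of x] x r by (intro exI[of _ "m x / (1 - x\<^sup>2) * g x"]) auto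
    qed
    then show ?thesis using P0 by simp
  qed
  have mpos: "m r > 0" if "0 < r" "r \<le> t" for r
    using r2[of r] that by (auto simp: m_def)
  have u1neg: "u1 r \<le> 0" if "0 < r" "r < t" for r
    using Pneg[of r] mpos[of r] that by (simp add: P_def mult_le_0_iff)
  have uA: "u r \<le> A" if r: "0 \<le> r" "r \<le> t" for r
  proof -
    have "u r \<le> u 0"
      by (rule antimono_by_deriv[OF r(1) continuous_on_subset[OF cu] du(1) u1neg]) (use r in auto)
    then show ?thesis using A by simp
  qed
  define C where "C = A powr p"
  have C: "C > 0" using A by (simp add: C_def)
  have glow: "g r \<ge> - C" if r: "0 \<le> r" "r < t" for r
  proof -
    have ur: "u r > 0" using lower[OF r] A by auto
    have "\<bar>u r\<bar> powr (p - 1) * u r = u r powr p" using ur by (simp add: powr_mult_base mult.commute)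
    also have "\<dots> \<le> C" unfolding C_def using uA[of r] ur r p by (intro powr_mono2) auto
    finally show ?thesis using ur al unfolding g_def by (smt (verit) mult_nonneg_nonneg)
  qed
  \<comment> \<open>The factor 4/3 bounds 1 / (1 - r^2) for r \<le> 1/2; the subtracted term is the
    primitive of (4/3) C r^\<nu>.\<close>
  have Plow: "P r \<ge> - (4 / 3 * C * r powr (\<nu> + 1) / (\<nu> + 1))" if r: "0 \<le> r" "r < t" for r
  proof -
    let ?Q = "\<lambda>r. P r + 4 / 3 * C * r powr (\<nu> + 1) / (\<nu> + 1)"
    have "?Q 0 \<le> ?Q r"
    proof (rule DERIV_nonneg_imp_increasing_open[OF r(1)])
      show "continuous_on {0..r} ?Q"
        using \<nu> r by (intro continuous_intros continuous_on_powr' continuous_on_subset[OF cP]) auto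
      fix x assume x: "0 < x" "x < r"
      have d: "(?Q has_real_derivative m x / (1 - x\<^sup>2) * g x + 4 / 3 * C * x powr \<nu>) (at x)"
      proof -
        have "(?Q has_real_derivative m x / (1 - x\<^sup>2) * g x
            + 4 / 3 * C * ((\<nu> + 1) * x powr (\<nu> + 1 - 1)) / (\<nu> + 1)) (at x)"
          by (intro DERIV_add DERIV_cdivide DERIV_cmult has_real_derivative_powr dP) (use x r in auto)
        moreover have "4 / 3 * C * ((\<nu> + 1) * x powr (\<nu> + 1 - 1)) / (\<nu> + 1) = 4 / 3 * C * x powr \<nu>"
          using \<nu> by (simp add: divide_simps)
        ultimately show ?thesis by (simp only:)
      qed
      have y: "3 / 4 \<le> 1 - x\<^sup>2" "1 - x\<^sup>2 \<le> 1" using r2[of x] x r by auto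
      have "m x / (1 - x\<^sup>2) \<le> x powr \<nu> * 1 / (3 / 4)"
        unfolding m_def using y \<gamma> by (intro frac_le mult_left_mono powr_le1 mult_nonneg_nonneg) auto
      then have mx: "m x / (1 - x\<^sup>2) \<le> 4 / 3 * x powr \<nu>" by simp
      have "m x / (1 - x\<^sup>2) * (- g x) \<le> 4 / 3 * x powr \<nu> * C"
        using mx glow[of x] gneg[of x] x r C by (intro mult_mono) auto
      then show "\<exists>y. (?Q has_real_derivative y) (at x) \<and> 0 \<le> y"
        using d by (intro exI[of _ "m x / (1 - x\<^sup>2) * g x + 4 / 3 * C * x powr \<nu>"]) (simp add: mult.commute mult.left_commute)
    qed
    then show ?thesis using P0 \<nu> by simp
  qed
  have u1low: "u1 r \<ge> - (C * r)" if r: "0 < r" "r < t" for r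
  proof -
    have y: "3 / 4 \<le> 1 - r\<^sup>2" "1 - r\<^sup>2 \<le> 1" using r2[of r] r by auto
    have "(1 - r\<^sup>2) powr 1 \<le> (1 - r\<^sup>2) powr \<gamma>" using y \<gamma> by (intro powr_mono') auto
    then have x: "3 / 4 \<le> (1 - r\<^sup>2) powr \<gamma>" using y by simp
    \<comment> \<open>Here \<nu> + 1 \<ge> 2 reduces the constant to 2/3, which is below 3/4 \<le>
      (1 - r^2)^\<gamma>, so the bound fits under \<open>m r * (C * r)\<close>.\<close>
    have "4 / 3 * C * r powr (\<nu> + 1) / (\<nu> + 1) \<le> 4 / 3 * C * r powr (\<nu> + 1) / 2"
      using \<nu> C by (intro divide_left_mono) auto
    also have "\<dots> = (2 / 3) * (C * r * r powr \<nu>)" using r by (simp add: powr_add)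
    also have "\<dots> \<le> (1 - r\<^sup>2) powr \<gamma> * (C * r * r powr \<nu>)"
      using x C r by (intro mult_right_mono) auto
    also have "\<dots> = m r * (C * r)" by (simp add: m_def)
    finally have "m r * (- (C * r)) \<le> m r * u1 r" using Plow[of r] r by (simp add: P_def)
    then show ?thesis by (rule mult_left_le_imp_le) (use mpos[of r] r in auto)
  qed
  \<comment> \<open>Because A^p A^(1-p) = A, the total drop C t^2 / 2 is at most A / 8.\<close>
  have "u 0 + C * 0\<^sup>2 / 2 \<le> u t + C * t\<^sup>2 / 2"
  proof (rule DERIV_nonneg_imp_increasing_open[of 0 t "\<lambda>r. u r + C * r\<^sup>2 / 2"])
    show "continuous_on {0..t} (\<lambda>r. u r + C * r\<^sup>2 / 2)" by (intro continuous_intros cu) auto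
    fix x assume x: "0 < x" "x < t"
    have "((\<lambda>r. u r + C * r\<^sup>2 / 2) has_real_derivative u1 x + C * x) (at x)"
      using du(1)[of x] x by (auto intro!: derivative_eq_intros)
    then show "\<exists>y. ((\<lambda>r. u r + C * r\<^sup>2 / 2) has_real_derivative y) (at x) \<and> 0 \<le> y"
      using u1low[OF x] by (intro exI[of _ "u1 x + C * x"]) auto
  qed (use t in auto)
  moreover have "C * t\<^sup>2 \<le> C * (A powr (1 - p) / 4)" using t C by (intro mult_left_mono) auto
  moreover have "C * (A powr (1 - p) / 4) = A / 4"
    unfolding C_def using A by (simp flip: powr_add)
  ultimately show "A / 2 < u t" using A by simp
  show "u t \<le> A" using uA t by simp
qed

text \<open>The step lemma asks for the lower bound only strictly before \<open>t\<close>, which is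
  the induction hypothesis that \<open>continuous_barrier\<close> supplies.\<close>

lemma initial_phase:
  assumes reg: "regular_sol \<sigma> u u1 u2"
    and A: "u 0 = A" "A > 0" "al * (al + 1) \<le> (A / 2) powr (p - 1)"
    and T: "0 \<le> T" "T < \<sigma>" "T \<le> 1 / 2" "T\<^sup>2 \<le> A powr (1 - p) / 4"
    and t: "0 \<le> t" "t \<le> T"
  shows "A / 2 < u t" "u t \<le> A"
proof -
  have T2: "s\<^sup>2 \<le> A powr (1 - p) / 4" if "0 \<le> s" "s \<le> T" for s
    using power_mono[OF that(2,1), of 2] T(4) by linarith
  have lower: "A / 2 < u r" if "0 \<le> r" "r \<le> T" for r
  proof (rule continuous_barrier[of 0 T u])
    show "continuous_on {0..T} u"
      using reg T by (auto simp: regular_sol_def intro: continuous_on_subset)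
    show "A / 2 < u 0" using A by simp
    fix s assume s: "0 < s" "s \<le> T" "\<And>x. 0 \<le> x \<Longrightarrow> x < s \<Longrightarrow> A / 2 < u x"
    show "A / 2 < u s"
      by (rule initial_phase_step(1)[OF reg A s(1) _ _ _ s(3)]) (use s T T2[of s] in auto)
  qed (use that in auto)
  then show "A / 2 < u t" using t by simp
  show "u t \<le> A"
  proof (cases "t = 0")
    case False
    then show ?thesis
      by (intro initial_phase_step(2)[OF reg A _ _ _ _ lower]) (use t T T2[of t] in auto)
  qed (use A in simp)
qed

text \<open>The bound that \<open>energy_loss\<close> below gives for \<open>w\<close> passing from \<open>2^(-al) / 4\<close> to \<open>2^(-al) / 2\<close>
  within time \<open>ln 4 / al\<close>.\<close>

definition e0 :: real where
  "e0 = be * (2 powr (- al) / 4)\<^sup>2 / (ln 4 / al)"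

lemma e0_pos: "e0 > 0" using be al by (simp add: e0_def)

text \<open>By the inequality \<open>v\<^sup>2 \<ge> 2 m v - m\<^sup>2\<close>, the energy lost while \<open>w\<close> grows by \<open>d\<close> within time
  \<open>D\<close> is at least \<open>be d\<^sup>2 / D\<close>.\<close>

lemma energy_loss:
  assumes "sol I w v z" "{s..t} \<subseteq> I" "s < t" "d \<ge> 0" "w t - w s \<ge> d"
  shows "E w v t \<le> E w v s - be * d\<^sup>2 / (t - s)"
proof -
  define m where "m = d / (t - s)"
  have m: "m \<ge> 0" "m * (t - s) = d" using assms by (auto simp: m_def)
  define G where "G r = E w v r + be * (2 * m * w r - m\<^sup>2 * r)" for r
  have "G t \<le> G s"
  proof (rule DERIV_nonpos_imp_nonincreasing[of s t G])
    fix x assume "s \<le> x" "x \<le> t"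
    then have x: "x \<in> I" using assms by auto
    then have "(w has_real_derivative v x) (at x)" using assms(1) by (auto simp: sol_def)
    then have "(G has_real_derivative - be * (v x)\<^sup>2 + be * (2 * m * v x - m\<^sup>2)) (at x)"
      unfolding G_def[abs_def] by (auto intro!: derivative_eq_intros E_deriv[OF assms(1) x])
    moreover have "- be * (v x)\<^sup>2 + be * (2 * m * v x - m\<^sup>2) = - be * (v x - m)\<^sup>2"
      by (simp add: power2_eq_square algebra_simps)
    moreover have "- be * (v x - m)\<^sup>2 \<le> 0" using be by simp
    ultimately show "\<exists>y. (G has_real_derivative y) (at x) \<and> y \<le> 0" by metis
  qed (use assms in simp)
  then have "E w v t \<le> E w v s - be * (2 * m * (w t - w s) - m * (m * (t - s)))"
    by (simp add: G_def algebra_simps power2_eq_square)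
  also have "\<dots> \<le> E w v s - be * (2 * m * d - m * d)"
  proof -
    have "2 * m * d - m * d \<le> 2 * m * (w t - w s) - m * (m * (t - s))"
      using mult_left_mono[OF assms(5), of "2 * m"] m by (simp add: mult.commute[of m d])
    then have "be * (2 * m * d - m * d) \<le> be * (2 * m * (w t - w s) - m * (m * (t - s)))"
      using be by (intro mult_left_mono) auto
    then show ?thesis by linarith
  qed
  also have "\<dots> = E w v s - be * d\<^sup>2 / (t - s)"
    by (simp add: m_def power2_eq_square field_simps)
  finally show ?thesis .
qed

text \<open>\<open>exp sb\<close> is half of A^(-1/al), the largest radius that the initial phase
  admits. Up to there \<open>u\<close> stays within a factor 2 of \<open>A\<close>, so the growth of
  exp(al s) must show in \<open>w\<close>, by an amount from which \<open>A\<close> cancels.\<close>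

lemma early_energy_loss:
  assumes reg: "regular_sol \<sigma> u u1 u2" and \<sigma>: "\<sigma> > 1"
    and A: "u 0 = A" "A > 1" "al * (al + 1) \<le> (A / 2) powr (p - 1)"
  defines "sb \<equiv> - ln 2 - ln A / al"
  shows "E (lw u) (lv u u1) sb \<le> - e0" "\<And>\<rho>. 0 \<le> \<rho> \<Longrightarrow> \<rho> \<le> exp sb \<Longrightarrow> u \<rho> > 0" "sb < 0"
proof -
  have lA: "ln A > 0" using A by simp
  have "ln A / al > 0" using lA al by simp
  moreover have "ln (2::real) > 0" by simp
  ultimately have sb: "sb \<le> - ln 2" "sb < 0" unfolding sb_def by linarith+
  show "sb < 0" by fact
  have e1: "exp sb \<le> exp (- ln 2)" using sb by (intro exp_le_cancel_iff[THEN iffD2]) auto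
  then have eb: "exp sb \<le> 1 / 2" by (simp add: exp_minus)
  have "exp (al * sb) = exp (- al * ln 2) * exp (- ln A)"
    using al by (simp add: sb_def exp_add[symmetric] algebra_simps)
  also have "\<dots> = 2 powr (- al) / A" using A by (simp add: powr_def exp_minus field_simps)
  finally have ab: "exp (al * sb) = 2 powr (- al) / A" .
  have "(exp sb)\<^sup>2 = exp (- 2 * ln 2) * exp (- (p - 1) * ln A)"
  proof -
    have "2 * (ln A / al) = (p - 1) * ln A" 
    proof -
      have "p - 1 = 2 / al" using al by (simp add: field_simps)
      then show ?thesis by simp
    qed
    then have "2 * sb = - 2 * ln 2 + (- (p - 1) * ln A)" by (simp add: sb_def algebra_simps)
    then show ?thesis by (metis exp_add exp_double)
  qed
  also have "exp (- 2 * ln (2::real)) = 1 / 4"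
    using exp_double[of "- ln (2::real)"] by (simp add: exp_minus power2_eq_square)
  also have "exp (- (p - 1) * ln A) = A powr (1 - p)" using A by (simp add: powr_def)
  finally have T: "(exp sb)\<^sup>2 \<le> A powr (1 - p) / 4" by simp
  have u: "A / 2 < u r" "u r \<le> A" if "0 \<le> r" "r \<le> exp sb" for r
    using initial_phase[OF reg A(1) _ A(3) _ _ eb T that] A(2) eb \<sigma> by auto
  show "u \<rho> > 0" if "0 \<le> \<rho>" "\<rho> \<le> exp sb" for \<rho>
    using u(1)[OF that] A by linarith
  \<comment> \<open>Over this span exp(al s) grows by a factor 4; as \<open>u\<close> loses at most
    a factor 2, \<open>w\<close> rises from at most \<open>d\<close> to at least
    \<open>2 * d\<close>.\<close>
  define sa where "sa = sb - ln 4 / al"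
  define d where "d = 2 powr (- al) / (4::real)"
  have sab: "sa < sb" using al by (simp add: sa_def)
  have "exp (al * sa) = exp (al * sb) * exp (- ln 4)"
    using al by (simp add: sa_def exp_add[symmetric] algebra_simps)
  then have aa: "exp (al * sa) = 2 powr (- al) / (4 * A)" by (simp add: ab exp_minus)
  have "lw u sa \<le> exp (al * sa) * A"
    unfolding lw_def using u(2)[of "exp sa"] sab by (intro mult_left_mono) auto
  then have wa: "lw u sa \<le> d" using A by (simp add: aa d_def)
  have "exp (al * sb) * (A / 2) \<le> lw u sb"
    unfolding lw_def using u(1)[of "exp sb"] by (intro mult_left_mono) auto
  then have wb: "2 * d \<le> lw u sb" using A by (simp add: ab d_def)
  have sub: "{sa..sb} \<subseteq> {s. exp s < \<sigma>}" using eb \<sigma> by (auto intro: le_less_trans[OF exp_le_cancel_iff[THEN iffD2]])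
  have "E (lw u) (lv u u1) sb \<le> E (lw u) (lv u u1) sa - be * d\<^sup>2 / (sb - sa)"
    by (rule energy_loss[OF emden_fowler[OF reg] sub sab]) (use wa wb in \<open>auto simp: d_def\<close>)
  moreover have "E (lw u) (lv u u1) sa \<le> 0"
    by (rule E_nonpos[OF reg]) (use subsetD[OF sub, of sa] sab \<sigma> in auto)
  moreover have "be * d\<^sup>2 / (sb - sa) = e0" by (simp add: e0_def d_def sa_def)
  ultimately show "E (lw u) (lv u u1) sb \<le> - e0" by linarith
qed

text \<open>A strict Lyapunov function for the damped oscillation: adding a small multiple of
  \<open>(1 - \<rho>\<^sup>2) v f(w)\<close> to the energy makes it decrease at a definite rate away from equilibria.\<close>

lemma energy_settles:
  assumes "e1 > 0" "e > 0"
  obtains T where "T > 0" "\<And>w v z s t. sol {s..t} w v z \<Longrightarrow> E w v s \<le> - e1 \<Longrightarrow> s + T \<le> t \<Longrightarrow> t \<le> 0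
     \<Longrightarrow> E w v t \<le> F b + e"
proof -
  obtain c where c: "c > 0" "\<And>x. F x \<le> - e1 \<Longrightarrow> F b + e / 2 \<le> F x \<Longrightarrow> c \<le> (f x)\<^sup>2"
    using f_gap[of e1 "e / 2"] assms by auto
  obtain C1 where C1: "C1 \<ge> 0" "\<And>x. \<bar>x\<bar> \<le> R \<Longrightarrow> \<bar>p * \<bar>x\<bar> powr (p - 1) - ka\<bar> \<le> C1"
    using f_deriv_bounded by blast
  obtain L where L: "L \<ge> 0" "\<And>x y. \<bar>x\<bar> \<le> R \<Longrightarrow> \<bar>y\<bar> \<le> R \<Longrightarrow> \<bar>f x - f y\<bar> \<le> L * \<bar>x - y\<bar>"
    using f_lipschitz by blast
  \<comment> \<open>The correction creates terms of size (2 + C1) v^2; with this weight they use up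
    half of the dissipation be v^2.\<close>
  define \<delta> where "\<delta> = be / (2 * (2 + C1))"
  have \<delta>: "\<delta> > 0" "\<delta> * (2 + C1) = be / 2" using be C1 by (auto simp: \<delta>_def field_simps)
  \<comment> \<open>The two ways of being away from equilibrium: if the potential part exceeds its
    minimum by \<open>e / 2\<close>, then f^2 \<ge> c; otherwise the kinetic part is at least
    \<open>e / 2\<close>, so v^2 \<ge> e.\<close>
  define c' where "c' = min (be / 2 * e) (\<delta> / 2 * c)"
  have c': "c' > 0" using be assms \<delta> c by (simp add: c'_def)
  define J0 where "J0 = - F b + \<delta> * ((1 - 2 * F b) * (L * R))"
  have "0 \<le> \<delta> * ((1 - 2 * F b) * (L * R))"
    using F_b_neg \<delta>(1) L(1) R by (intro mult_nonneg_nonneg) auto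
  then have J0: "J0 > 0" using F_b_neg unfolding J0_def by linarith
  \<comment> \<open>\<open>J\<close> stays between \<open>- J0\<close> and \<open>J0\<close> but
    would decrease at rate \<open>c'\<close>; this span is more than that allows.\<close>
  define T where "T = 2 * J0 / c' + 1"
  have T: "T > 0" using J0 c' by (simp add: T_def add_pos_pos)
  have "E w v t \<le> F b + e"
    if S: "sol {s..t} w v z" and Es: "E w v s \<le> - e1" and st: "s + T \<le> t" "t \<le> 0" for w v z s t
  proof (rule ccontr)
    assume n: "\<not> E w v t \<le> F b + e"
    have s_t: "s \<le> t" using T st by linarith
    have El: "F b + e \<le> E w v x" and Eu: "E w v x \<le> - e1" if x: "s \<le> x" "x \<le> t" for x
      using E_antimono[OF S, of x t] E_antimono[OF S, of s x] x n Es by auto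
    \<comment> \<open>With this weight the equation eliminates \<open>z\<close> from the derivative
      of \<open>y\<close> without any division, so the estimates are uniform up to the light
      cone.\<close>
    define y where "y x = (1 - exp (2 * x)) * v x" for x
    define J where "J x = E w v x + \<delta> * (y x * f (w x))" for x
    have q: "0 \<le> 1 - exp (2 * x) \<and> 1 - exp (2 * x) \<le> 1" if "x \<le> t" for x :: real
      using that st by simp
    have Fw: "F (w x) \<le> - e1" if x: "s \<le> x" "x \<le> t" for x
      using F_le_E[of x w v] Eu[OF x] x st by linarith
    have wR: "\<bar>w x\<bar> \<le> R" if x: "s \<le> x" "x \<le> t" for x
      using F_nonpos_bound[of "w x"] Fw[OF x] assms by linarith
    have JB: "\<bar>J x\<bar> \<le> J0" if x: "s \<le> x" "x \<le> t" for x
    proof -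
      have "(y x)\<^sup>2 = (1 - exp (2 * x)) * ((1 - exp (2 * x)) * (v x)\<^sup>2)"
        by (simp add: y_def power2_eq_square)
      also have "\<dots> \<le> 1 * ((1 - exp (2 * x)) * (v x)\<^sup>2)"
        using q[OF x(2)] by (intro mult_right_mono) auto
      also have "\<dots> = 2 * (E w v x - F (w x))" by (simp add: E_def)
      also have "\<dots> \<le> - 2 * F b"
      proof -
        have "E w v x - F (w x) \<le> - F b" using Eu[OF x] F_min[of "w x"] assms by linarith
        then show ?thesis by simp
      qed
      finally have "(y x)\<^sup>2 \<le> - 2 * F b" .
      moreover have "\<bar>y x\<bar> \<le> 1 + (y x)\<^sup>2"
      proof -
        have "0 \<le> (\<bar>y x\<bar> - 1 / 2)\<^sup>2" by simp
        also have "\<dots> = (y x)\<^sup>2 - \<bar>y x\<bar> + 1 / 4" by (simp add: power2_diff power_one_over)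
        finally show ?thesis by simp
      qed
      ultimately have yb: "\<bar>y x\<bar> \<le> 1 - 2 * F b" by linarith
      have "\<bar>f (w x) - f 0\<bar> \<le> L * \<bar>w x - 0\<bar>" using wR[OF x] R by (intro L(2)) auto
      also have "\<dots> \<le> L * R" using wR[OF x] L by (intro mult_left_mono) auto
      finally have "\<bar>f (w x)\<bar> \<le> L * R" by simp
      then have "\<bar>y x\<bar> * \<bar>f (w x)\<bar> \<le> (1 - 2 * F b) * (L * R)"
        using yb F_b_neg by (intro mult_mono) auto
      then have "\<bar>\<delta> * (y x * f (w x))\<bar> \<le> \<delta> * ((1 - 2 * F b) * (L * R))"
        using \<delta> by (simp add: abs_mult)
      moreover have "\<bar>E w v x\<bar> \<le> - F b" using El[OF x] Eu[OF x] assms by linarith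
      ultimately show ?thesis unfolding J_def J0_def using abs_triangle_ineq by linarith
    qed
    have "J t + c' * t \<le> J s + c' * s"
    proof (rule DERIV_nonpos_imp_nonincreasing[OF s_t, of "\<lambda>x. J x + c' * x"])
      fix x assume x: "s \<le> x" "x \<le> t"
      then have xs: "x \<in> {s..t}" by simp
      have d: "(w has_real_derivative v x) (at x)" "(v has_real_derivative z x) (at x)"
        and ode: "(1 - exp (2 * x)) * z x + (be - exp (2 * x)) * v x + f (w x) = 0"
        using S xs by (auto simp: sol_def)
      define r f' where "r = exp (2 * x)" and "f' = p * \<bar>w x\<bar> powr (p - 1) - ka"
      have r: "0 \<le> r" "r \<le> 1" using q[OF x(2)] by (auto simp: r_def)
      have df: "((\<lambda>x. f (w x)) has_real_derivative f' * v x) (at x)"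
        unfolding f'_def by (rule DERIV_chain2[OF f_deriv d(1)])
      have dy: "(y has_real_derivative (- 2 * r) * v x + z x * (1 - r)) (at x)"
        unfolding y_def[abs_def] r_def by (auto intro!: derivative_eq_intros d)
      have "(- 2 * r) * v x + z x * (1 - r) = - (be + r) * v x - f (w x)"
        using ode unfolding r_def[symmetric] by (simp add: algebra_simps)
      then have dy': "(y has_real_derivative - (be + r) * v x - f (w x)) (at x)" using dy by simp
      have dJ: "((\<lambda>x. J x + c' * x) has_real_derivative - be * (v x)\<^sup>2
          + \<delta> * ((- (be + r) * v x - f (w x)) * f (w x) + f' * v x * y x) + c') (at x)"
        unfolding J_def[abs_def]
        by (intro DERIV_add DERIV_cmult DERIV_mult E_deriv[OF S xs] dy' df DERIV_cmult_Id)
      have "f' * v x * y x \<le> C1 * (v x)\<^sup>2"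
      proof -
        have "f' * v x * y x = (f' * (1 - r)) * (v x)\<^sup>2" by (simp add: y_def r_def power2_eq_square)
        also have "\<dots> \<le> (C1 * 1) * (v x)\<^sup>2"
        proof (rule mult_right_mono)
          have "f' \<le> C1" using C1(2)[OF wR[OF x]] by (simp add: f'_def)
          then show "f' * (1 - r) \<le> C1 * 1" using r C1(1) by (intro mult_mono) auto
        qed simp
        finally show ?thesis by simp
      qed
      moreover have "- (be + r) * v x * f (w x) \<le> 2 * (v x)\<^sup>2 + (f (w x))\<^sup>2 / 2"
      proof -
        \<comment> \<open>Completing the square; be + r \<le> 2 turns the last term into f^2 / 2,
          which leaves half of the good term -f^2.\<close>
        have "0 \<le> 2 * (v x + (be + r) / 4 * f (w x) * 1)\<^sup>2" by simp
        also have "\<dots> = 2 * (v x)\<^sup>2 + (be + r) * v x * f (w x) + (be + r)\<^sup>2 * (f (w x))\<^sup>2 / 8"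
          by (simp add: power2_eq_square field_simps)
        also have "(be + r)\<^sup>2 * (f (w x))\<^sup>2 \<le> 2\<^sup>2 * (f (w x))\<^sup>2"
          using be r by (intro mult_right_mono power_mono) auto
        finally have "0 \<le> 2 * (v x)\<^sup>2 + (be + r) * v x * f (w x) + (f (w x))\<^sup>2 / 2" by simp
        moreover have "- (be + r) * v x * f (w x) = - ((be + r) * v x * f (w x))"
          by (simp only: mult_minus_left)
        ultimately show ?thesis by linarith
      qed
      ultimately have "(- (be + r) * v x - f (w x)) * f (w x) + f' * v x * y x
          \<le> (2 + C1) * (v x)\<^sup>2 - (f (w x))\<^sup>2 / 2"
        by (simp add: algebra_simps power2_eq_square)
      then have "\<delta> * ((- (be + r) * v x - f (w x)) * f (w x) + f' * v x * y x)
          \<le> \<delta> * ((2 + C1) * (v x)\<^sup>2 - (f (w x))\<^sup>2 / 2)"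
        using \<delta> by (intro mult_left_mono) auto
      also have "\<dots> = (\<delta> * (2 + C1)) * (v x)\<^sup>2 - \<delta> / 2 * (f (w x))\<^sup>2" by (simp add: algebra_simps)
      also have "\<dots> = be / 2 * (v x)\<^sup>2 - \<delta> / 2 * (f (w x))\<^sup>2" by (simp add: \<delta>)
      finally have up: "- be * (v x)\<^sup>2
          + \<delta> * ((- (be + r) * v x - f (w x)) * f (w x) + f' * v x * y x) + c'
          \<le> c' - (be / 2 * (v x)\<^sup>2 + \<delta> / 2 * (f (w x))\<^sup>2)" by simp
      have "c' \<le> be / 2 * (v x)\<^sup>2 + \<delta> / 2 * (f (w x))\<^sup>2"
      proof (cases "F b + e / 2 \<le> F (w x)")
        case True
        then have "\<delta> / 2 * c \<le> \<delta> / 2 * (f (w x))\<^sup>2"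
          using c(2)[OF Fw[OF x]] \<delta> by (intro mult_left_mono) auto
        moreover have "0 \<le> be / 2 * (v x)\<^sup>2" using be by simp
        ultimately show ?thesis unfolding c'_def by linarith
      next
        case False
        then have "e / 2 \<le> (1 - r) * (v x)\<^sup>2 / 2" using El[OF x] by (simp add: E_def r_def)
        also have "\<dots> \<le> 1 * (v x)\<^sup>2 / 2" using r by (intro divide_right_mono mult_right_mono) auto
        finally have "be / 2 * e \<le> be / 2 * (v x)\<^sup>2" using be by (intro mult_left_mono) auto
        moreover have "0 \<le> \<delta> / 2 * (f (w x))\<^sup>2" using \<delta> by simp
        ultimately show ?thesis unfolding c'_def by linarith
      qed
      then have "- be * (v x)\<^sup>2
          + \<delta> * ((- (be + r) * v x - f (w x)) * f (w x) + f' * v x * y x) + c' \<le> 0"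
        using up by linarith
      with dJ show "\<exists>y. ((\<lambda>x. J x + c' * x) has_real_derivative y) (at x) \<and> y \<le> 0"
        by blast
    qed
    then have "c' * (t - s) \<le> J s - J t" by (simp add: algebra_simps)
    also have "\<dots> \<le> 2 * J0" using JB[of s] JB[of t] s_t by simp
    finally have "c' * (t - s) \<le> 2 * J0" .
    moreover have "c' * T \<le> c' * (t - s)" using st c' by (intro mult_left_mono) auto
    moreover have "c' * T = 2 * J0 + c'" using c' by (simp add: T_def field_simps)
    ultimately show False using c' by linarith
  qed
  then show ?thesis using that T by blast
qed

text \<open>In this case the compatibility condition places w(0) at \<open>b\<close> but is silent
  on v(0). A velocity at the cone persists over a fixed time \<delta>, because \<open>z\<close> is
  bounded by the supremum of |v|, so \<open>w\<close> was off \<open>b\<close> by at least \<delta>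
  |v(0)| / 2 at the time -\<delta>.\<close>

lemma velocity_at_light_cone_critical:
  assumes "be = 1"
  obtains \<delta> where "\<delta> > 0" "\<delta> \<le> 1" "\<And>w v z. sol {-\<delta>..0} w v z \<Longrightarrow> (\<And>s. - \<delta> \<le> s \<Longrightarrow> s \<le> 0 \<Longrightarrow> \<bar>w s - b\<bar> < b)
     \<Longrightarrow> \<delta> * \<bar>v 0\<bar> \<le> 2 * \<bar>w (- \<delta>) - b\<bar>"
proof -
  obtain K where K: "K \<ge> 0" "\<And>x y. \<bar>x\<bar> \<le> 2 * b \<Longrightarrow> \<bar>y\<bar> \<le> 2 * b \<Longrightarrow> \<bar>f x - f y\<bar> \<le> K * \<bar>x - y\<bar>"
    using f_lipschitz by blast
  \<comment> \<open>The first bound is the range of \<open>one_minus_exp_ge\<close>; the second lets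
    \<open>v\<close> vary by at most a quarter of its supremum.\<close>
  define \<delta> where "\<delta> = min (1 / 2) (1 / (4 * (1 + K)))"
  have \<delta>: "\<delta> > 0" "\<delta> \<le> 1 / 2" "(1 + K) * \<delta> \<le> 1 / 4"
  proof -
    show "\<delta> > 0" "\<delta> \<le> 1 / 2" using K by (auto simp: \<delta>_def)
    have "\<delta> \<le> 1 / (4 * (1 + K))" by (simp add: \<delta>_def)
    then have "\<delta> * (4 * (1 + K)) \<le> 1" using K by (simp add: pos_le_divide_eq)
    then show "(1 + K) * \<delta> \<le> 1 / 4" by (simp add: algebra_simps)
  qed
  have "\<delta> * \<bar>v 0\<bar> \<le> 2 * \<bar>w (- \<delta>) - b\<bar>"
    if S: "sol {-\<delta>..0} w v z" and near: "\<And>s. - \<delta> \<le> s \<Longrightarrow> s \<le> 0 \<Longrightarrow> \<bar>w s - b\<bar> < b" for w v z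
  proof -
    have dw: "(w has_real_derivative v s) (at s)" and dv: "(v has_real_derivative z s) (at s)"
      and ode': "(1 - exp (2 * s)) * z s + (be - exp (2 * s)) * v s + f (w s) = 0" if "- \<delta> \<le> s" "s \<le> 0" for s
      using S that by (auto simp: sol_def)
    have "be - x = 1 - x" for x using assms by simp
    note ode = ode'[unfolded this]
    have cw: "continuous_on {-\<delta>..0} w" and cv: "continuous_on {-\<delta>..0} v"
      by (intro continuous_at_imp_continuous_on ballI DERIV_isCont[OF dw] DERIV_isCont[OF dv]; simp)+
    have w0: "w 0 = b"
    proof -
      have "f (w 0) = 0" using ode[of 0] \<delta> by simp
      then show ?thesis using f_eq_0_iff[of "w 0"] near[of 0] \<delta> by auto
    qed
    have "continuous_on {-\<delta>..0} (\<lambda>s. \<bar>v s\<bar>)" by (intro continuous_intros cv)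
    then obtain x0 where x0: "x0 \<in> {-\<delta>..0}" "\<And>s. s \<in> {-\<delta>..0} \<Longrightarrow> \<bar>v s\<bar> \<le> \<bar>v x0\<bar>"
      using continuous_attains_sup[of "{-\<delta>..0}" "\<lambda>s. \<bar>v s\<bar>"] \<delta> by fastforce
    define M where "M = \<bar>v x0\<bar>"
    have M: "\<bar>v s\<bar> \<le> M" if "- \<delta> \<le> s" "s \<le> 0" for s using x0(2)[of s] that by (simp add: M_def)
    have M0: "M \<ge> 0" by (simp add: M_def)
    have ws: "\<bar>w s - b\<bar> \<le> M * (- s)" if s: "- \<delta> \<le> s" "s \<le> 0" for s
    proof -
      have "\<bar>w 0 - w s\<bar> \<le> M * (0 - s)"
        by (rule mvt_bound[OF s(2) continuous_on_subset[OF cw] dw M]) (use s in auto)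
      then show ?thesis by (simp add: w0 abs_minus_commute)
    qed
    have zs: "\<bar>z s\<bar> \<le> (1 + K) * M" if s: "- \<delta> \<le> s" "s < 0" for s
    proof -
      have q: "- s \<le> 1 - exp (2 * s)" using s \<delta> by (intro one_minus_exp_ge) auto
      then have q0: "1 - exp (2 * s) > 0" using s by linarith
      have "\<bar>f (w s) - f b\<bar> \<le> K * \<bar>w s - b\<bar>"
        using near[of s] s b by (intro K(2)) auto
      also have "\<dots> \<le> K * (M * (- s))" using ws[of s] s K by (intro mult_left_mono) auto
      also have "\<dots> \<le> K * (M * (1 - exp (2 * s)))" using q M0 K by (intro mult_left_mono) auto
      finally have fw: "\<bar>f (w s)\<bar> \<le> K * M * (1 - exp (2 * s))" by simp
      \<comment> \<open>For \<open>be = 1\<close> the degenerate factor multiplies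
        \<open>z + v\<close> as a whole, and \<open>f (w s)\<close> carries it as well because w - b
        vanishes linearly at 0. Dividing it out bounds \<open>z\<close>.\<close>
      have "(1 - exp (2 * s)) * (z s + v s) = - f (w s)" using ode[of s] s by (simp add: algebra_simps)
      then have "(1 - exp (2 * s)) * \<bar>z s + v s\<bar> = \<bar>f (w s)\<bar>"
        using q0 by (metis abs_minus_cancel abs_mult abs_of_pos)
      then have "(1 - exp (2 * s)) * \<bar>z s + v s\<bar> \<le> (1 - exp (2 * s)) * (K * M)"
        using fw by (simp add: mult.commute)
      then have "\<bar>z s + v s\<bar> \<le> K * M" using q0 by (simp only: mult_le_cancel_left_pos)
      moreover have "\<bar>v s\<bar> \<le> M" using M[of s] s by simp
      ultimately show ?thesis by (simp add: algebra_simps)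
    qed
    have vs: "\<bar>v s - v 0\<bar> \<le> (1 + K) * M * \<delta>" if s: "- \<delta> \<le> s" "s \<le> 0" for s
    proof -
      have "\<bar>v 0 - v s\<bar> \<le> (1 + K) * M * (0 - s)"
        by (rule mvt_bound[OF s(2) continuous_on_subset[OF cv] dv zs]) (use s in auto)
      also have "\<dots> \<le> (1 + K) * M * \<delta>" using s M0 K by (intro mult_left_mono) auto
      finally show ?thesis by (simp add: abs_minus_commute)
    qed
    have dM: "(1 + K) * M * \<delta> \<le> M / 4"
      using mult_right_mono[OF \<delta>(3) M0] by (simp add: mult_ac)
    have "M \<le> \<bar>v 0\<bar> + M / 4" using vs[of x0] x0(1) dM by (auto simp: M_def)
    then have "M / 4 \<le> \<bar>v 0\<bar> / 2" by simp
    then have v3: "\<bar>v s - v 0\<bar> \<le> \<bar>v 0\<bar> / 2" if "- \<delta> \<le> s" "s \<le> 0" for s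
      using vs[OF that] dM by linarith
    \<comment> \<open>The difference of \<open>w\<close> and its tangent at 0 moves with speed at
      most |v(0)| / 2, so half of the displacement \<delta> |v(0)| survives.\<close>
    have "\<bar>(w 0 - v 0 * 0) - (w (- \<delta>) - v 0 * (- \<delta>))\<bar> \<le> \<bar>v 0\<bar> / 2 * (0 - (- \<delta>))"
    proof (rule mvt_bound[of "-\<delta>" 0 "\<lambda>s. w s - v 0 * s" "\<lambda>s. v s - v 0"])
      show "continuous_on {-\<delta>..0} (\<lambda>s. w s - v 0 * s)" by (intro continuous_intros cw)
      show "((\<lambda>s. w s - v 0 * s) has_real_derivative v x - v 0) (at x)" if "- \<delta> < x" "x < 0" for x
        using dw[of x] that by (auto intro!: derivative_eq_intros)
    qed (use \<delta> v3 in auto)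
    then have "\<bar>b - (w (- \<delta>) + v 0 * \<delta>)\<bar> \<le> \<bar>v 0\<bar> / 2 * \<delta>" by (simp add: w0)
    moreover have "\<bar>v 0 * \<delta>\<bar> = \<bar>v 0\<bar> * \<delta>" using \<delta> by (simp add: abs_mult)
    ultimately have "\<bar>v 0\<bar> * \<delta> \<le> \<bar>w (- \<delta>) - b\<bar> + \<bar>v 0\<bar> / 2 * \<delta>" by linarith
    then show ?thesis by (simp add: mult.commute)
  qed
  then show ?thesis using that[of \<delta>] \<delta> by fastforce
qed

text \<open>The constants are fixed backwards: the closeness \<eta>' to \<open>b\<close>, the energy
  margin \<open>d\<close> that enforces it, the logarithmic time \<open>T\<close> needed to reach
  that margin, and the height \<open>C\<close> that leaves so much time before the cone.\<close>

lemma close_to_singular_at_light_cone: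
  assumes "\<eta> > 0"
  obtains C where "C > 0" "\<And>\<sigma> u u1 u2. \<sigma> > 1 \<Longrightarrow> regular_sol \<sigma> u u1 u2 \<Longrightarrow> u 0 \<ge> C \<Longrightarrow>
     (\<forall>\<rho>\<in>{0..1}. u \<rho> > 0) \<and> \<bar>lw u 0 - b\<bar> < \<eta> \<and> \<bar>lv u u1 0\<bar> < \<eta>"
proof -
  obtain L where L: "L \<ge> 0" "\<And>x y. \<bar>x\<bar> \<le> 2 * b \<Longrightarrow> \<bar>y\<bar> \<le> 2 * b \<Longrightarrow> \<bar>f x - f y\<bar> \<le> L * \<bar>x - y\<bar>"
    using f_lipschitz by blast
  \<comment> \<open>The case hypothesis stays inside the property so that a single \<delta> serves
    the definition of \<eta>' in both cases.\<close>
  obtain \<delta> where \<delta>: "be = 1 \<Longrightarrow> 0 < \<delta> \<and> \<delta> \<le> 1 \<and> (\<forall>w v z. sol {-\<delta>..0} w v z \<longrightarrow>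
      (\<forall>s. - \<delta> \<le> s \<longrightarrow> s \<le> 0 \<longrightarrow> \<bar>w s - b\<bar> < b) \<longrightarrow> \<delta> * \<bar>v 0\<bar> \<le> 2 * \<bar>w (- \<delta>) - b\<bar>)"
    using velocity_at_light_cone_critical by metis
  \<comment> \<open>Prepared for the two bounds of v(0): \<delta> |v(0)| < 2 \<eta>' in the critical
    case, and (1 - be) |v(0)| \<le> L \<eta>' otherwise. The cap \<open>b\<close> keeps
    \<open>w\<close> in the range of the Lipschitz constant.\<close>
  define \<eta>' where "\<eta>' = (if be = 1 then min (min \<eta> b) (\<eta> * \<delta> / 2) else min (min \<eta> b) (\<eta> * (1 - be) / (L + 1)))"
  have \<eta>': "\<eta>' > 0" "\<eta>' \<le> \<eta>" "\<eta>' \<le> b" "be = 1 \<Longrightarrow> 2 * \<eta>' \<le> \<eta> * \<delta>" "be \<noteq> 1 \<Longrightarrow> \<eta>' * (L + 1) \<le> \<eta> * (1 - be)"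
  proof -
    have "0 < min (min \<eta> b) (\<eta> * \<delta> / 2)" if "be = 1" using assms b \<delta>[OF that] by simp
    moreover have "0 < min (min \<eta> b) (\<eta> * (1 - be) / (L + 1))" if "be \<noteq> 1"
      using assms b L(1) be that by simp
    ultimately show "\<eta>' > 0" unfolding \<eta>'_def by presburger
    show "\<eta>' \<le> \<eta>" "\<eta>' \<le> b" unfolding \<eta>'_def by (cases "be = 1"; simp add: min_le_iff_disj)+
    show "2 * \<eta>' \<le> \<eta> * \<delta>" if "be = 1"
    proof -
      have "\<eta>' \<le> \<eta> * \<delta> / 2" unfolding \<eta>'_def if_P[OF that] by simp
      then show ?thesis by simp
    qed
    show "\<eta>' * (L + 1) \<le> \<eta> * (1 - be)" if "be \<noteq> 1"
    proof -
      have "\<eta>' \<le> \<eta> * (1 - be) / (L + 1)" unfolding \<eta>'_def if_not_P[OF that] by simp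
      then show ?thesis using L(1) by (simp add: pos_le_divide_eq)
    qed
  qed
  obtain d where d: "d > 0" "\<And>x. x \<ge> 0 \<Longrightarrow> F x \<le> F b + d \<Longrightarrow> \<bar>x - b\<bar> < \<eta>'"
    using F_near_min[OF \<eta>'(1)] by blast
  obtain T where T: "T > 0" "\<And>w v z s t. sol {s..t} w v z \<Longrightarrow> E w v s \<le> - e0 \<Longrightarrow> s + T \<le> t \<Longrightarrow> t \<le> 0
     \<Longrightarrow> E w v t \<le> F b + d"
    using energy_settles[OF e0_pos d(1)] by blast
  define A0 where "A0 = (al * (al + 1)) powr (1 / (p - 1))"
  \<comment> \<open>\<open>A0\<close> makes the source nonpositive in the initial phase. The
    exponential puts the end of that phase at least T + 1 before the cone, so that the energy has
    settled on all of -1 \<le> s \<le> 0 and not only at the cone.\<close>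
  define C where "C = 2 + 2 * A0 + exp (al * (T + 1))"
  have C: "C > 1" by (simp add: C_def A0_def add_pos_nonneg)
  have "(\<forall>\<rho>\<in>{0..1}. u \<rho> > 0) \<and> \<bar>lw u 0 - b\<bar> < \<eta> \<and> \<bar>lv u u1 0\<bar> < \<eta>"
    if \<sigma>: "\<sigma> > 1" and reg: "regular_sol \<sigma> u u1 u2" and u0: "u 0 \<ge> C" for \<sigma> u u1 u2
  proof -
    define A where "A = u 0"
    have A: "A > 1" using u0 C by (simp add: A_def)
    have A0: "A0 \<le> A / 2" using u0 exp_gt_zero[of "al * (T + 1)"] unfolding A_def C_def by linarith
    have "A0 powr (p - 1) = al * (al + 1)" using al p by (simp add: A0_def powr_powr)
    moreover have "A0 powr (p - 1) \<le> (A / 2) powr (p - 1)"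
      using A0 p by (intro powr_mono2) (auto simp: A0_def)
    ultimately have A2: "al * (al + 1) \<le> (A / 2) powr (p - 1)" by simp
    define sb where "sb = - ln 2 - ln A / al"
    have early: "E (lw u) (lv u u1) sb \<le> - e0" "\<And>\<rho>. 0 \<le> \<rho> \<Longrightarrow> \<rho> \<le> exp sb \<Longrightarrow> u \<rho> > 0" "sb < 0"
      using early_energy_loss[OF reg \<sigma> A_def[symmetric] A A2] unfolding sb_def by auto
    have "A0 \<ge> 0" by (simp add: A0_def)
    then have "exp (al * (T + 1)) \<le> A" using u0 unfolding A_def C_def by linarith
    then have "al * (T + 1) \<le> ln A" using A by (simp add: ln_ge_iff)
    then have "T + 1 \<le> ln A / al" using al by (simp add: field_simps)
    moreover have "ln (2::real) > 0" by simp
    ultimately have sbT: "sb + T \<le> -1" unfolding sb_def by linarith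
    have S: "sol {s. exp s < \<sigma>} (lw u) (lv u u1) (lz u u1 u2)" by (rule emden_fowler[OF reg])
    have dom: "{s..0} \<subseteq> {s. exp s < \<sigma>}" for s
    proof
      fix x assume "x \<in> {s..0}"
      then have "exp x \<le> exp 0" unfolding exp_le_cancel_iff by simp
      then have "exp x < \<sigma>" using \<sigma> unfolding exp_zero by linarith
      then show "x \<in> {s. exp s < \<sigma>}" by simp
    qed
    have S0: "sol {s..0} (lw u) (lv u u1) (lz u u1 u2)" for s
      using S dom[of s] unfolding sol_def by blast
    have Es: "E (lw u) (lv u u1) s \<le> F b + d" if "-1 \<le> s" "s \<le> 0" for s
    proof -
      have "sol {sb..s} (lw u) (lv u u1) (lz u u1 u2)"
        using S0[of sb] that unfolding sol_def by simp
      then show ?thesis by (rule T(2)[OF _ early(1)]) (use sbT that in auto)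
    qed
    have wne: "lw u s \<noteq> 0" if s: "sb \<le> s" "s \<le> 0" for s
    proof
      assume "lw u s = 0"
      then have "0 \<le> E (lw u) (lv u u1) s" using F_le_E[OF s(2), of "lw u"] by (metis F_zero)
      moreover have "E (lw u) (lv u u1) s \<le> E (lw u) (lv u u1) sb"
        by (rule E_antimono[OF S0[of sb]]) (use s in auto)
      ultimately show False using early(1) e0_pos by linarith
    qed
    have wpos: "lw u s > 0" if s: "sb \<le> s" "s \<le> 0" for s
    proof (rule ccontr)
      assume "\<not> lw u s > 0"
      moreover have "lw u sb > 0" using early(2)[of "exp sb"] by (simp add: lw_def)
      moreover have "isCont (lw u) x" if "sb \<le> x" "x \<le> s" for x
        using S0[of sb] s that unfolding sol_def by (intro DERIV_isCont[of _ "lv u u1 x"]) auto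
      ultimately obtain x where "sb \<le> x" "x \<le> s" "lw u x = 0"
        using IVT2[of "lw u" s 0 sb] s by auto
      then show False using wne[of x] s by auto
    qed
    have pos: "u \<rho> > 0" if \<rho>: "\<rho> \<in> {0..1}" for \<rho>
    proof (cases "\<rho> \<le> exp sb")
      case True then show ?thesis using early(2) \<rho> by auto
    next
      case False
      then have r: "\<rho> > 0" using exp_gt_zero[of sb] by linarith
      have "sb \<le> ln \<rho>" using False r by (simp add: ln_ge_iff)
      moreover have "ln \<rho> \<le> 0" using \<rho> r by simp
      ultimately have "lw u (ln \<rho>) > 0" by (rule wpos)
      then show ?thesis using r by (simp add: lw_def zero_less_mult_iff)
    qed
    have near: "\<bar>lw u s - b\<bar> < \<eta>'" if s: "-1 \<le> s" "s \<le> 0" for s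
    proof (rule d(2))
      show "0 \<le> lw u s" using wpos[of s] s sbT T(1) by simp
      show "F (lw u s) \<le> F b + d" using F_le_E[OF s(2), of "lw u" "lv u u1"] Es[OF s] by linarith
    qed
    have "\<bar>lv u u1 0\<bar> < \<eta>"
    proof (cases "be = 1")
      case True
      have dl: "0 < \<delta>" "\<delta> \<le> 1" using \<delta>[OF True] by auto
      note S0[of "-\<delta>"]
      moreover have "\<forall>s. - \<delta> \<le> s \<longrightarrow> s \<le> 0 \<longrightarrow> \<bar>lw u s - b\<bar> < b"
      proof (intro allI impI)
        fix s assume "- \<delta> \<le> s" "s \<le> 0"
        then have "\<bar>lw u s - b\<bar> < \<eta>'" using dl by (intro near) auto
        then show "\<bar>lw u s - b\<bar> < b" using \<eta>'(3) by linarith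
      qed
      ultimately have "\<delta> * \<bar>lv u u1 0\<bar> \<le> 2 * \<bar>lw u (- \<delta>) - b\<bar>" using \<delta>[OF True] by blast
      also have "\<dots> < 2 * \<eta>'" using near[of "-\<delta>"] dl by simp
      also have "\<dots> \<le> \<delta> * \<eta>" using \<eta>'(4)[OF True] by (simp add: mult.commute)
      finally show ?thesis using dl by simp
    next
      case False
      have "(be - 1) * lv u u1 0 + f (lw u 0) = 0" using S0[of 0] by (simp add: sol_def)
      then have "(1 - be) * lv u u1 0 = f (lw u 0)" by (simp add: algebra_simps)
      then have "(1 - be) * \<bar>lv u u1 0\<bar> = \<bar>f (lw u 0)\<bar>"
        using be by (metis abs_mult abs_of_nonneg diff_ge_0_iff_ge)
      also have "\<dots> = \<bar>f (lw u 0) - f b\<bar>" by simp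
      also have "\<dots> \<le> L * \<bar>lw u 0 - b\<bar>" using near[of 0] \<eta>'(3) b by (intro L(2)) auto
      also have "\<dots> \<le> L * \<eta>'" using near[of 0] L(1) by (intro mult_left_mono) auto
      also have "\<dots> < \<eta>' * (L + 1)" using \<eta>'(1) by (simp add: algebra_simps)
      also have "\<dots> \<le> (1 - be) * \<eta>" using \<eta>'(5)[OF False] by (simp add: mult.commute)
      finally show ?thesis using be False by simp
    qed
    then show ?thesis using pos near[of 0] \<eta>'(2) by auto
  qed
  then show ?thesis using that[of C] C by fastforce
qed

end

section \<open>Global solutions of Lipschitz equations\<close>

text \<open>Integrating the weight gains the factor \<open>1 / l\<close>, which is the source of the
  contraction below.\<close>

lemma integral_norm_le_exp:
  fixes f :: "real \<Rightarrow> 'a::banach"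
  assumes "t \<ge> 0" "l > 0" "C \<ge> 0" "continuous_on {0..t} f"
    and "\<And>\<tau>. \<tau> \<in> {0..t} \<Longrightarrow> norm (f \<tau>) \<le> C * exp (l * \<tau>)"
  shows "norm (integral {0..t} f) \<le> C / l * exp (l * t)"
proof -
  have I: "((\<lambda>\<tau>. C * exp (l * \<tau>)) has_integral (C / l * exp (l * t) - C / l * exp (l * 0))) {0..t}"
    by (rule fundamental_theorem_of_calculus)
      (use assms in \<open>auto intro!: derivative_eq_intros
        simp: has_real_derivative_iff_has_vector_derivative[symmetric]\<close>)
  have "norm (integral {0..t} f) \<le> integral {0..t} (\<lambda>\<tau>. C * exp (l * \<tau>))"
    by (rule integral_norm_bound_integral) (use assms I in \<open>auto intro: integrable_continuous_interval\<close>)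
  also have "\<dots> = C / l * exp (l * t) - C / l"
    using integral_unique[OF I] by simp
  also have "\<dots> \<le> C / l * exp (l * t)"
    using assms by simp
  finally show ?thesis .
qed

text \<open>The fixed point is found in the exponentially weighted sup norm (Bielecki), in which the
  Picard operator is a contraction on the whole half-line.\<close>

lemma lipschitz_ode_global:
  fixes F :: "real \<Rightarrow> 'a \<Rightarrow> 'a::banach"
  assumes cont: "continuous_on ({0..} \<times> UNIV) (\<lambda>(t, x). F t x)"
    and lip: "\<And>t x y. t \<ge> 0 \<Longrightarrow> norm (F t x - F t y) \<le> L * norm (x - y)"
    and bd: "\<And>t. t \<ge> 0 \<Longrightarrow> norm (F t 0) \<le> M"
  shows "\<exists>Y. Y 0 = y0 \<and> (\<forall>t\<ge>0. (Y has_vector_derivative F t (Y t)) (at t within {0..}))"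
proof -
  \<comment> \<open>Makes the contraction factor |L| / l at most 1/2.\<close>
  define l where "l = 2 * \<bar>L\<bar> + 1"
  have l: "l > 0" by (simp add: l_def)
  have M0: "M \<ge> 0" using bd[of 0] norm_ge_zero[of "F 0 0"] by linarith
  \<comment> \<open>The unknown \<open>z\<close> is the solution divided by the weight exp(l t),
    hence a bounded function.\<close>
  define I where "I z t = integral {0..t} (\<lambda>\<tau>. F \<tau> (exp (l * \<tau>) *\<^sub>R apply_bcontfun z \<tau>))"
    for z :: "real \<Rightarrow>\<^sub>C 'a" and t :: real
  have cF: "continuous_on {0..t} (\<lambda>\<tau>. F \<tau> (exp (l * \<tau>) *\<^sub>R apply_bcontfun z \<tau>))" for z t
    using continuous_on_compose2[OF cont, of "{0..t}" "\<lambda>\<tau>. (\<tau>, exp (l * \<tau>) *\<^sub>R apply_bcontfun z \<tau>)"]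
    by (force intro!: continuous_intros)
  have dI: "((\<lambda>t. I z t) has_vector_derivative F t (exp (l * t) *\<^sub>R apply_bcontfun z t)) (at t within {0..T})"
    if "t \<in> {0..T}" for z t T
    unfolding I_def by (rule integral_has_vector_derivative[OF cF that])
  have dI': "((\<lambda>t. I z t) has_vector_derivative F t (exp (l * t) *\<^sub>R apply_bcontfun z t)) (at t within {0..})"
    if "t \<ge> 0" for z t
  proof -
    have "at t within {0..} = at t within ({0..} \<inter> {..<t+1})"
      by (rule at_within_nhd[of _ "{..<t+1}"]) auto
    moreover have "at t within {0..t+1} = at t within ({0..} \<inter> {..<t+1})"
      by (rule at_within_nhd[of _ "{..<t+1}"]) auto
    ultimately show ?thesis using dI[of t "t+1" z] that by simp
  qed
  have cI: "continuous_on {0..} (I z)" for z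
    unfolding continuous_on_eq_continuous_within
    using dI' has_vector_derivative_continuous by fastforce
  \<comment> \<open>Elements of the function space live on the whole line; \<open>max 0 t\<close>
    freezes the image at its initial value for negative \<open>t\<close>.\<close>
  define T where "T z t = exp (- l * max 0 t) *\<^sub>R (y0 + I z (max 0 t))" for z t
  have Tcont: "continuous_on UNIV (T z)" for z
    unfolding T_def
    by (intro continuous_intros continuous_on_compose2[OF cI]) auto
  have Tbd: "norm (T z t) \<le> norm y0 + (M + \<bar>L\<bar> * norm z) / l" for z t
  proof -
    define s where "s = max 0 t"
    have s: "s \<ge> 0" by (simp add: s_def)
    have "norm (I z s) \<le> (M + \<bar>L\<bar> * norm z) / l * exp (l * s)"
      unfolding I_def
    proof (rule integral_norm_le_exp[OF s l _ cF])
      show "0 \<le> M + \<bar>L\<bar> * norm z" using M0 by simp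
      fix \<tau> assume \<tau>: "\<tau> \<in> {0..s}"
      let ?x = "exp (l * \<tau>) *\<^sub>R apply_bcontfun z \<tau>"
      have "norm (F \<tau> ?x) \<le> norm (F \<tau> 0) + norm (F \<tau> ?x - F \<tau> 0)"
        by (metis add.commute diff_add_cancel norm_triangle_ineq)
      also have "\<dots> \<le> M + \<bar>L\<bar> * norm ?x"
      proof (rule add_mono)
        show "norm (F \<tau> 0) \<le> M" using bd \<tau> by simp
        have "norm (F \<tau> ?x - F \<tau> 0) \<le> L * norm (?x - 0)" using lip[of \<tau> ?x 0] \<tau> by auto
        also have "\<dots> \<le> \<bar>L\<bar> * norm ?x"
          unfolding diff_zero by (rule mult_right_mono) simp_all
        finally show "norm (F \<tau> ?x - F \<tau> 0) \<le> \<bar>L\<bar> * norm ?x" .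
      qed
      also have "\<dots> \<le> M * exp (l * \<tau>) + \<bar>L\<bar> * (exp (l * \<tau>) * norm z)"
        using M0 \<tau> l norm_bounded[of z \<tau>]
        by (intro add_mono mult_left_mono) (auto intro!: mult_le_cancel_left1[THEN iffD2])
      finally show "norm (F \<tau> ?x) \<le> (M + \<bar>L\<bar> * norm z) * exp (l * \<tau>)"
        by (simp add: algebra_simps)
    qed
    then have "norm (y0 + I z s) \<le> norm y0 + (M + \<bar>L\<bar> * norm z) / l * exp (l * s)"
      using norm_triangle_ineq[of y0 "I z s"] by linarith
    then have "exp (- l * s) * norm (y0 + I z s)
        \<le> exp (- l * s) * (norm y0 + (M + \<bar>L\<bar> * norm z) / l * exp (l * s))"
      by (rule mult_left_mono) simp
    also have "\<dots> = exp (- l * s) * norm y0 + (M + \<bar>L\<bar> * norm z) / l"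
      by (simp add: algebra_simps exp_minus field_simps)
    also have "\<dots> \<le> norm y0 + (M + \<bar>L\<bar> * norm z) / l"
      using s l by (auto intro!: mult_left_le_one_le)
    finally show ?thesis by (simp add: T_def s_def)
  qed
  have Tin: "T z \<in> bcontfun" for z
    by (rule bcontfun_normI[OF Tcont Tbd])
  define \<Phi> where "\<Phi> z = Bcontfun (T z)" for z
  have \<Phi>: "apply_bcontfun (\<Phi> z) t = T z t" for z t
    by (simp add: \<Phi>_def Bcontfun_inverse[OF Tin])
  have contr: "dist (\<Phi> x) (\<Phi> y) \<le> (1 / 2) * dist x y" for x y
  proof (rule dist_bound)
    fix t :: real
    define s where "s = max 0 t"
    have s: "s \<ge> 0" by (simp add: s_def)
    have "I x s - I y s = integral {0..s} (\<lambda>\<tau>. F \<tau> (exp (l * \<tau>) *\<^sub>R apply_bcontfun x \<tau>)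
              - F \<tau> (exp (l * \<tau>) *\<^sub>R apply_bcontfun y \<tau>))"
      unfolding I_def by (rule integral_diff[symmetric]) (intro integrable_continuous_interval cF)+
    also have "norm \<dots> \<le> \<bar>L\<bar> * dist x y / l * exp (l * s)"
    proof (rule integral_norm_le_exp[OF s l])
      fix \<tau> assume \<tau>: "\<tau> \<in> {0..s}"
      let ?x = "exp (l * \<tau>) *\<^sub>R apply_bcontfun x \<tau>" and ?y = "exp (l * \<tau>) *\<^sub>R apply_bcontfun y \<tau>"
      have "norm (?x - ?y) = exp (l * \<tau>) * dist (apply_bcontfun x \<tau>) (apply_bcontfun y \<tau>)"
        by (simp add: dist_norm scaleR_diff_right[symmetric])
      also have "\<dots> \<le> exp (l * \<tau>) * dist x y"
        by (intro mult_left_mono dist_bounded) auto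
      finally have "\<bar>L\<bar> * norm (?x - ?y) \<le> \<bar>L\<bar> * (exp (l * \<tau>) * dist x y)"
        by (rule mult_left_mono) simp
      then show "norm (F \<tau> ?x - F \<tau> ?y) \<le> \<bar>L\<bar> * dist x y * exp (l * \<tau>)"
        using lip[of \<tau> ?x ?y] \<tau> mult_right_mono[OF abs_ge_self[of L] norm_ge_zero[of "?x - ?y"]]
        by (auto simp: algebra_simps)
    qed (auto intro!: continuous_intros cF)
    finally have *: "norm (I x s - I y s) \<le> \<bar>L\<bar> * dist x y / l * exp (l * s)" .
    have "dist (\<Phi> x t) (\<Phi> y t) = exp (- l * s) * norm (I x s - I y s)"
      by (simp add: \<Phi> T_def s_def dist_norm scaleR_diff_right[symmetric])
    also have "\<dots> \<le> exp (- l * s) * (\<bar>L\<bar> * dist x y / l * exp (l * s))"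
      using * by (rule mult_left_mono) simp
    also have "\<dots> = \<bar>L\<bar> / l * dist x y"
      by (simp add: exp_minus field_simps)
    also have "\<dots> \<le> 1 / 2 * dist x y"
      by (intro mult_right_mono) (auto simp: l_def field_simps)
    finally show "dist (\<Phi> x t) (\<Phi> y t) \<le> (1 / 2) * dist x y" .
  qed
  have "\<exists>!z. z \<in> (UNIV :: (real \<Rightarrow>\<^sub>C 'a) set) \<and> \<Phi> z = z"
    using Banach_fix[of "UNIV :: (real \<Rightarrow>\<^sub>C 'a) set" "1 / 2" \<Phi>] contr by (auto simp: complete_UNIV)
  then obtain z where z: "\<Phi> z = z" by auto
  define Y where "Y t = y0 + I z t" for t
  have Yz: "Y t = exp (l * t) *\<^sub>R apply_bcontfun z t" if "t \<ge> 0" for t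
  proof -
    have "apply_bcontfun z t = exp (- l * t) *\<^sub>R Y t"
      using \<Phi>[of z t] that by (simp add: z T_def Y_def max_def)
    then show ?thesis by (simp add: exp_minus)
  qed
  have "(Y has_vector_derivative F t (Y t)) (at t within {0..})" if "t \<ge> 0" for t
  proof -
    have "(Y has_vector_derivative 0 + F t (exp (l * t) *\<^sub>R apply_bcontfun z t)) (at t within {0..})"
      unfolding Y_def[abs_def]
      by (intro has_vector_derivative_add has_vector_derivative_const dI'[OF that])
    then show ?thesis using Yz[OF that] by simp
  qed
  moreover have "Y 0 = y0" by (simp add: Y_def I_def)
  ultimately show ?thesis by blast
qed

section \<open>The exterior of the light cone\<close>

text \<open>Beyond the last point where \<open>h\<close> lies below the line of slope
  \<open>c\<close>, \<open>h\<close> is positive, so its slope is at most \<open>c\<close> and it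
  cannot leave the line. Restricting the bound to \<open>h > 0\<close> lets terms of damping sign be
  discarded.\<close>

lemma one_sided_growth:
  fixes h :: "real \<Rightarrow> real"
  assumes "continuous_on {0..t} h" "h 0 = 0" "c \<ge> 0" "t \<ge> 0"
    and d: "\<And>s. 0 < s \<Longrightarrow> s < t \<Longrightarrow> (h has_real_derivative h' s) (at s)"
    and "\<And>s. 0 < s \<Longrightarrow> s < t \<Longrightarrow> h s > 0 \<Longrightarrow> h' s \<le> c"
  shows "h t \<le> c * t"
proof (rule ccontr)
  assume n: "\<not> h t \<le> c * t"
  define S where "S = {x \<in> {0..t}. h x \<le> c * x}"
  have "closed S" unfolding S_def
    by (intro continuous_on_closed_Collect_le assms(1) continuous_intros)
  moreover have "bounded S" by (rule bounded_subset[of "{0..t}"]) (auto simp: S_def)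
  moreover have "S \<noteq> {}" using assms by (auto simp: S_def)
  ultimately obtain a where a: "a \<in> S" "\<And>x. x \<in> S \<Longrightarrow> x \<le> a"
    using compact_attains_sup[of S] by (auto simp: compact_eq_bounded_closed)
  have at: "0 \<le> a" "a \<le> t" "h a \<le> c * a" using a(1) by (auto simp: S_def)
  have "h t - c * t \<le> h a - c * a"
  proof (rule antimono_by_deriv[OF at(2), of "\<lambda>s. h s - c * s" "\<lambda>s. h' s - c"])
    show "continuous_on {a..t} (\<lambda>s. h s - c * s)"
      using at by (intro continuous_intros continuous_on_subset[OF assms(1)]) auto
    fix x assume x: "a < x" "x < t"
    show "((\<lambda>s. h s - c * s) has_real_derivative h' x - c) (at x)"
      using d[of x] x at by (auto intro!: derivative_eq_intros)
    have "x \<notin> S" using a(2)[of x] x by auto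
    then have "h x > c * x" using x at by (auto simp: S_def)
    moreover have "c * x \<ge> 0" using assms(3) x at by simp
    ultimately show "h' x - c \<le> 0" using assms(6)[of x] x at by auto
  qed
  then show False using n at by linarith
qed

lemma tendsto_mono_bounded_at_top:
  fixes g :: "real \<Rightarrow> real"
  assumes mono: "\<And>s t. a \<le> s \<Longrightarrow> s \<le> t \<Longrightarrow> g s \<le> g t" and bd: "\<And>s. a \<le> s \<Longrightarrow> g s \<le> M"
  obtains L where "(g \<longlongrightarrow> L) at_top"
proof
  define L where "L = (SUP s\<in>{a..}. g s)"
  have bdd: "bdd_above (g ` {a..})" using bd by (auto simp: bdd_above_def)
  have le: "g s \<le> L" if "a \<le> s" for s
    unfolding L_def using that bdd by (intro cSUP_upper) auto
  show "(g \<longlongrightarrow> L) at_top"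
  proof (rule order_tendstoI)
    fix l assume "l < L"
    then obtain s where s: "s \<ge> a" "l < g s"
      unfolding L_def using less_cSUP_iff[OF _ bdd] by auto
    have "\<forall>\<^sub>F x in at_top. x \<ge> s" by (rule eventually_ge_at_top)
    then show "\<forall>\<^sub>F x in at_top. l < g x"
      by eventually_elim (use mono[OF s(1)] s(2) in \<open>auto intro: less_le_trans\<close>)
  next
    fix u assume u: "L < u"
    have "\<forall>\<^sub>F x in at_top. x \<ge> a" by (rule eventually_ge_at_top)
    then show "\<forall>\<^sub>F x in at_top. g x < u"
      by eventually_elim (use le u in \<open>auto intro: le_less_trans\<close>)
  qed
qed

text \<open>Excludes a first touching: a function that vanishes at \<open>t\<close> with positive
  slope would have been negative just before.\<close>

lemma pos_of_pos_deriv: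
  fixes h :: "real \<Rightarrow> real"
  assumes "(h has_real_derivative d) (at t)" "d > 0" "a < t" "\<And>s. a \<le> s \<Longrightarrow> s < t \<Longrightarrow> h s > 0"
  shows "h t > 0"
proof -
  obtain e where e: "e > 0" "\<And>x. 0 < x \<Longrightarrow> x < e \<Longrightarrow> h (t - x) < h t"
    using DERIV_pos_inc_left[OF assms(1,2)] by blast
  define x where "x = min (e / 2) (t - a)"
  have x: "0 < x" "x < e" "a \<le> t - x" using e(1) assms(3) by (auto simp: x_def)
  then show ?thesis using e(2)[of x] assms(4)[of "t - x"] by linarith
qed

lemma nonneg_limit:
  fixes h :: "real \<Rightarrow> real"
  assumes "continuous_on {a..t} h" "a < t" "\<And>s. a \<le> s \<Longrightarrow> s < t \<Longrightarrow> h s > 0"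
  shows "h t \<ge> 0"
proof (rule continuous_ge_on_closure[of "{a..<t}" h t 0])
  show "continuous_on (closure {a..<t}) h" "t \<in> closure {a..<t}" using assms by auto
qed (use assms(3) less_imp_le in auto)

lemma exp_double_minus_one_ge: "s \<ge> 0 \<Longrightarrow> 2 * s \<le> exp (2 * s) - (1 :: real)"
  using exp_ge_add_one_self[of "2 * s"] by linarith

section \<open>The exterior equation: uniqueness and an a priori bound\<close>

context profile_ode
begin

text \<open>The nonlinearity is a parameter so that a globally Lipschitz truncation of
  \<open>f\<close> can take its place.\<close>

definition ext_sol :: "(real \<Rightarrow> real) \<Rightarrow> real set \<Rightarrow> (real \<Rightarrow> real) \<Rightarrow> (real \<Rightarrow> real) \<Rightarrow> (real \<Rightarrow> real) \<Rightarrow> bool" where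
  "ext_sol h I w v z \<longleftrightarrow> (\<forall>s\<in>I. (w has_real_derivative v s) (at s) \<and> (v has_real_derivative z s) (at s)
     \<and> (1 - exp (2 * s)) * z s + (be - exp (2 * s)) * v s + h (w s) = 0)"

lemma ext_sol_f: "ext_sol f I w v z = sol I w v z"
  by (simp add: ext_sol_def sol_def)

lemma ext_sol_z:
  assumes "ext_sol h I w v z" "s \<in> I" "s > 0"
  shows "z s = - v s + (h (w s) - (1 - be) * v s) / (exp (2 * s) - 1)"
proof -
  have "exp (2 * s) - 1 > 0" using assms(3) by simp
  moreover have "(1 - exp (2 * s)) * z s + (be - exp (2 * s)) * v s + h (w s) = 0"
    using assms by (auto simp: ext_sol_def)
  ultimately show ?thesis by (simp add: field_simps)
qed

text \<open>Gronwall for the squared distance in phase space. Starting at \<open>a > 0\<close> keeps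
  1 / (exp(2s) - 1) below \<open>k\<close>, and the damping terms have a good sign. The Lipschitz
  bound is asked only along the two curves, so the lemma also covers \<open>f\<close> on bounded
  ranges.\<close>

lemma ext_sol_unique:
  assumes a: "0 < a" "a \<le> c"
    and S: "ext_sol h {a<..<c} w1 v1 z1" "ext_sol h {a<..<c} w2 v2 z2"
    and cont: "continuous_on {a..c} w1" "continuous_on {a..c} v1" "continuous_on {a..c} w2" "continuous_on {a..c} v2"
    and lip: "\<And>s. s \<in> {a<..<c} \<Longrightarrow> \<bar>h (w1 s) - h (w2 s)\<bar> \<le> K * \<bar>w1 s - w2 s\<bar>" and K: "K \<ge> 0"
    and init: "w1 a = w2 a" "v1 a = v2 a"
  shows "w1 c = w2 c" "v1 c = v2 c"
proof -
  define k where "k = 1 / (exp (2 * a) - 1)"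
  have k: "k > 0" using a by (simp add: k_def)
  define C where "C = 1 + k * K"
  define D where "D s = (w1 s - w2 s)\<^sup>2 + (v1 s - v2 s)\<^sup>2" for s
  have "exp (- C * c) * D c \<le> exp (- C * a) * D a"
  proof (rule antimono_by_deriv[OF a(2), of "\<lambda>s. exp (- C * s) * D s"
      "\<lambda>s. exp (- C * s) * (2 * (w1 s - w2 s) * (v1 s - v2 s) + 2 * (v1 s - v2 s) * (z1 s - z2 s) - C * D s)"])
    show "continuous_on {a..c} (\<lambda>s. exp (- C * s) * D s)"
      unfolding D_def by (intro continuous_intros cont)
    fix s assume s: "a < s" "s < c"
    then have d: "(w1 has_real_derivative v1 s) (at s)" "(v1 has_real_derivative z1 s) (at s)"
      "(w2 has_real_derivative v2 s) (at s)" "(v2 has_real_derivative z2 s) (at s)"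
      using S by (auto simp: ext_sol_def)
    have dD: "(D has_real_derivative 2 * (w1 s - w2 s) * (v1 s - v2 s) + 2 * (v1 s - v2 s) * (z1 s - z2 s)) (at s)"
      unfolding D_def[abs_def] by (auto intro!: derivative_eq_intros d simp: algebra_simps)
    show "((\<lambda>s. exp (- C * s) * D s) has_real_derivative
       exp (- C * s) * (2 * (w1 s - w2 s) * (v1 s - v2 s) + 2 * (v1 s - v2 s) * (z1 s - z2 s) - C * D s)) (at s)"
      by (rule derivative_eq_intros dD refl | simp)+ (simp add: algebra_simps)
    let ?W = "w1 s - w2 s" and ?V = "v1 s - v2 s" and ?H = "h (w1 s) - h (w2 s)"
    define q where "q = 1 / (exp (2 * s) - 1)"
    have q: "0 < q" "q \<le> k" unfolding k_def q_def using s a by (auto intro!: divide_left_mono mult_pos_pos)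
    have z: "z1 s = - v1 s + q * (h (w1 s) - (1 - be) * v1 s)" "z2 s = - v2 s + q * (h (w2 s) - (1 - be) * v2 s)"
      unfolding q_def using ext_sol_z[OF S(1), of s] ext_sol_z[OF S(2), of s] s a by auto
    have "2 * ?V * (z1 s - z2 s) = - (2 + 2 * q * (1 - be)) * ?V\<^sup>2 + q * (2 * ?V * ?H)"
      unfolding z by (simp add: algebra_simps power2_eq_square)
    also have "\<dots> \<le> 0 + k * (K * (?W\<^sup>2 + ?V\<^sup>2))"
    proof (rule add_mono)
      show "- (2 + 2 * q * (1 - be)) * ?V\<^sup>2 \<le> 0" 
      proof (rule mult_nonpos_nonneg)
        have "0 \<le> q * (1 - be)" using q be by (intro mult_nonneg_nonneg) auto
        then show "- (2 + 2 * q * (1 - be)) \<le> 0" by simp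
      qed simp
      have "2 * ?V * ?H \<le> 2 * (\<bar>?V\<bar> * \<bar>?H\<bar>)" by (metis abs_ge_self abs_mult mult.assoc mult_left_mono zero_le_numeral)
      also have "\<dots> \<le> 2 * (\<bar>?V\<bar> * (K * \<bar>?W\<bar>))" using lip[of s] s by (intro mult_left_mono) auto
      also have "\<dots> = K * (2 * \<bar>?V\<bar> * \<bar>?W\<bar>)" by simp
      also have "\<dots> \<le> K * (?W\<^sup>2 + ?V\<^sup>2)"
        using sum_squares_bound[of "\<bar>?V\<bar>" "\<bar>?W\<bar>"] K by (intro mult_left_mono) auto
      finally have 1: "2 * ?V * ?H \<le> K * (?W\<^sup>2 + ?V\<^sup>2)" .
      then have "q * (2 * ?V * ?H) \<le> q * (K * (?W\<^sup>2 + ?V\<^sup>2))" using q by (intro mult_left_mono) auto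
      also have "\<dots> \<le> k * (K * (?W\<^sup>2 + ?V\<^sup>2))" using q K by (intro mult_right_mono) auto
      finally show "q * (2 * ?V * ?H) \<le> k * (K * (?W\<^sup>2 + ?V\<^sup>2))" .
    qed
    finally have "2 * ?V * (z1 s - z2 s) \<le> k * K * D s" by (simp add: D_def)
    moreover have "2 * ?W * ?V \<le> D s"
      using sum_squares_bound[of ?W ?V] by (simp add: D_def)
    ultimately have "2 * ?W * ?V + 2 * ?V * (z1 s - z2 s) - C * D s \<le> 0"
      by (simp add: C_def algebra_simps)
    then show "exp (- C * s) * (2 * ?W * ?V + 2 * ?V * (z1 s - z2 s) - C * D s) \<le> 0"
      by (simp add: mult_nonneg_nonpos)
  qed
  also have "\<dots> = 0" using init by (simp add: D_def)
  finally have "D c \<le> 0" by (simp add: mult_le_0_iff)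
  then have "D c = 0" unfolding D_def by (smt (verit) zero_le_power2)
  then have "(w1 c - w2 c)\<^sup>2 = 0 \<and> (v1 c - v2 c)\<^sup>2 = 0"
    unfolding D_def by (subst (asm) add_nonneg_eq_0_iff) auto
  then show "w1 c = w2 c" "v1 c = v2 c" by auto
qed

text \<open>Near \<open>s = 0\<close> the damping \<open>(\<rho>\<^sup>2 - be) / (\<rho>\<^sup>2 - 1)\<close> is singular but has the good sign once \<open>v(0)\<close>
  is subtracted, the compatibility condition at \<open>s = 0\<close> cancelling the singular source. Away from
  \<open>0\<close>, both \<open>w - b\<close> and \<open>w - b + v\<close> stay below a common barrier growing at the integrable
  rate \<open>1 / (\<rho>\<^sup>2 - 1)\<close>.\<close>

lemma exterior_bound:
  assumes K: "K \<ge> 0"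
  obtains C where "C > 0" "\<And>h w v z \<eta> s. \<lbrakk>\<And>x y. \<bar>h x - h y\<bar> \<le> K * \<bar>x - y\<bar>; h b = 0; ext_sol h {0<..} w v z;
      continuous_on {0..} w; continuous_on {0..} v; h (w 0) = (1 - be) * v 0;
      \<bar>w 0 - b\<bar> < \<eta>; \<bar>v 0\<bar> < \<eta>; s \<ge> 0\<rbrakk> \<Longrightarrow> \<bar>w s - b\<bar> < C * \<eta> \<and> \<bar>v s\<bar> < C * \<eta>"
proof -
  \<comment> \<open>Length of the layer next to the cone; both \<delta> \<le> 1 and \<delta> K \<le>
    1 are needed to absorb the supremum of |v| there.\<close>
  define \<delta> where "\<delta> = 1 / (2 + K)"
  have \<delta>: "0 < \<delta>" "\<delta> \<le> 1" "\<delta> * K \<le> 1" using K by (auto simp: \<delta>_def field_simps)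
  \<comment> \<open>The primitive of the integrable rate 1 / (exp(2s) - 1) that tends to 0 at
    infinity, hence nonpositive.\<close>
  define \<theta> where "\<theta> s = ln (1 - exp (- 2 * s)) / 2" for s :: real
  have \<theta>0: "\<theta> s \<le> 0" if "s > 0" for s using that by (simp add: \<theta>_def)
  have d\<theta>: "(\<theta> has_real_derivative 1 / (exp (2 * s) - 1)) (at s)" if "s > 0" for s
  proof -
    have q: "1 - exp (- 2 * s) > 0" using that by simp
    have d: "((\<lambda>s. 1 - exp (- 2 * s)) has_real_derivative exp (- 2 * s) * 2) (at s)"
      by (auto intro!: derivative_eq_intros)
    have "((\<lambda>s. ln (1 - exp (- 2 * s))) has_real_derivative 1 / (1 - exp (- 2 * s)) * (exp (- 2 * s) * 2)) (at s)"
      by (rule DERIV_chain2[where f = ln and g = "\<lambda>s. 1 - exp (- 2 * s)", OF DERIV_ln_divide[OF q] d])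
    from DERIV_cdivide[OF this, of 2]
    have "(\<theta> has_real_derivative (exp (- 2 * s) * 2 / (1 - exp (- 2 * s))) / 2) (at s)"
      unfolding \<theta>_def[abs_def] by simp
    moreover have "(exp (- 2 * s) * 2 / (1 - exp (- 2 * s))) / 2 = 1 / (exp (2 * s) - 1)"
      using that by (simp add: exp_minus field_simps)
    ultimately show ?thesis by simp
  qed
  \<comment> \<open>The barrier's total growth factor from \<delta> to infinity.\<close>
  define C1 where "C1 = exp (- (K + 3) * \<theta> \<delta>)"
  have C1: "C1 \<ge> 1" unfolding C1_def one_le_exp_iff using \<theta>0[OF \<delta>(1)] K by (intro mult_nonpos_nonpos) auto
  define C where "C = 20 * C1"
  have "\<bar>w s - b\<bar> < C * \<eta> \<and> \<bar>v s\<bar> < C * \<eta>"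
    if lip: "\<And>x y. \<bar>h x - h y\<bar> \<le> K * \<bar>x - y\<bar>" and hb: "h b = 0" and S: "ext_sol h {0<..} w v z"
      and cw: "continuous_on {0..} w" and cv: "continuous_on {0..} v" and compat: "h (w 0) = (1 - be) * v 0"
      and \<eta>: "\<bar>w 0 - b\<bar> < \<eta>" "\<bar>v 0\<bar> < \<eta>" and s: "s \<ge> 0" for h w v z \<eta> s
  proof -
    have \<eta>0: "\<eta> > 0" using \<eta>(1) by linarith
    have dw: "(w has_real_derivative v s) (at s)" and dv: "(v has_real_derivative z s) (at s)" if "s > 0" for s
      using S that by (auto simp: ext_sol_def)
    have zeq: "z s = - v s + (h (w s) - (1 - be) * v s) / (exp (2 * s) - 1)" if "s > 0" for s
      using ext_sol_z[OF S] that by simp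
    have e1: "exp (2 * s) - 1 > 0" "2 * s \<le> exp (2 * s) - 1" if "s > 0" for s :: real
      using that exp_double_minus_one_ge[of s] by auto
    have "continuous_on {0..\<delta>} (\<lambda>s. \<bar>v s\<bar>)"
      by (intro continuous_intros continuous_on_subset[OF cv]) auto
    then obtain x0 where x0: "x0 \<in> {0..\<delta>}" "\<And>s. s \<in> {0..\<delta>} \<Longrightarrow> \<bar>v s\<bar> \<le> \<bar>v x0\<bar>"
      using continuous_attains_sup[of "{0..\<delta>}" "\<lambda>s. \<bar>v s\<bar>"] \<delta> by fastforce
    define M where "M = \<bar>v x0\<bar>"
    have M: "\<bar>v s\<bar> \<le> M" if "0 \<le> s" "s \<le> \<delta>" for s using x0(2)[of s] that by (simp add: M_def)
    have M0: "M \<ge> 0" by (simp add: M_def)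
    have ws: "\<bar>w s - w 0\<bar> \<le> M * s" if s: "0 \<le> s" "s \<le> \<delta>" for s
    proof -
      have "\<bar>w s - w 0\<bar> \<le> M * (s - 0)"
        by (rule mvt_bound[OF s(1) continuous_on_subset[OF cw] dw M]) (use s in auto)
      then show ?thesis by simp
    qed
    define c where "c = \<bar>v 0\<bar> + K * M / 2"
    have c: "c \<ge> 0" using K M0 by (simp add: c_def)
    \<comment> \<open>The sign \<open>e\<close> treats upper and lower deviations at once. The
      unbounded coefficient q multiplies v(s) - v(0) with damping sign, while in the source term it
      is compensated by |w(s) - w(0)| \<le> M s.\<close>
    have zb: "e * z s \<le> c" if s: "0 < s" "s < \<delta>" and e: "e = 1 \<or> e = -1" and pos: "e * (v s - v 0) > 0" for s e
    proof -
      define q where "q = 1 / (exp (2 * s) - 1)"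
      have q: "q > 0" "q * (2 * s) \<le> 1" using e1[OF s(1)] by (auto simp: q_def field_simps)
      have zq: "z s = - v s + q * (h (w s) - (1 - be) * v s)" using zeq[OF s(1)] by (simp add: q_def)
      \<comment> \<open>Substituting the compatibility condition replaces the singular source q
        h(w(s)) by q times an increment of h.\<close>
      have zz: "z s = - v 0 - (1 + (1 - be) * q) * (v s - v 0) + q * (h (w s) - h (w 0))"
        unfolding zq compat by (simp add: algebra_simps)
      have "e * z s = - e * v 0 - (1 + (1 - be) * q) * (e * (v s - v 0)) + q * (e * (h (w s) - h (w 0)))"
        unfolding zz by (simp add: algebra_simps)
      moreover have "- e * v 0 \<le> \<bar>v 0\<bar>" using e by auto
      moreover have "0 \<le> (1 + (1 - be) * q) * (e * (v s - v 0))"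
      proof (rule mult_nonneg_nonneg[OF _ less_imp_le[OF pos]])
        have "0 \<le> (1 - be) * q" using q be by (intro mult_nonneg_nonneg) auto
        then show "0 \<le> 1 + (1 - be) * q" by simp
      qed
      moreover have "q * (e * (h (w s) - h (w 0))) \<le> K * M / 2"
      proof -
        have "e * (h (w s) - h (w 0)) \<le> \<bar>h (w s) - h (w 0)\<bar>" using e by auto
        also have "\<dots> \<le> K * (M * s)" using lip[of "w s" "w 0"] ws[of s] s K mult_left_mono by fastforce
        finally have "q * (e * (h (w s) - h (w 0))) \<le> q * (K * (M * s))" using q by (intro mult_left_mono) auto
        also have "\<dots> = (K * M / 2) * (q * (2 * s))" by simp
        also have "\<dots> \<le> (K * M / 2) * 1" using q K M0 by (intro mult_left_mono) auto
        finally show ?thesis by simp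
      qed
      ultimately show ?thesis unfolding c_def by linarith
    qed
    have vd: "e * (v s - v 0) \<le> c * s" if s: "0 \<le> s" "s \<le> \<delta>" and e: "e = 1 \<or> e = -1" for s e
    proof (rule one_sided_growth[of s "\<lambda>s. e * (v s - v 0)" c "\<lambda>s. e * z s"])
      show "continuous_on {0..s} (\<lambda>s. e * (v s - v 0))"
        by (intro continuous_intros continuous_on_subset[OF cv]) auto
      show "((\<lambda>s. e * (v s - v 0)) has_real_derivative e * z x) (at x)" if "0 < x" for x
        using dv[OF that] by (auto intro!: derivative_eq_intros)
    qed (use s zb[OF _ _ e] c in auto)
    have vM: "\<bar>v s\<bar> \<le> \<bar>v 0\<bar> + c * \<delta>" if s: "0 \<le> s" "s \<le> \<delta>" for s
    proof -
      have "c * s \<le> c * \<delta>" using s c by (intro mult_left_mono) auto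
      then show ?thesis using vd[OF s, of 1] vd[OF s, of "-1"] by auto
    qed
    \<comment> \<open>Together these give M \<le> 2 |v(0)| + M / 2.\<close>
    have "\<bar>v 0\<bar> * \<delta> \<le> \<bar>v 0\<bar> * 1" using \<delta> by (intro mult_left_mono) auto
    moreover have "(\<delta> * K) * M \<le> 1 * M" using \<delta> M0 by (intro mult_right_mono) auto
    moreover have "c * \<delta> = \<bar>v 0\<bar> * \<delta> + (\<delta> * K) * M / 2" by (simp add: c_def algebra_simps)
    moreover have "M \<le> \<bar>v 0\<bar> + c * \<delta>" using vM[of x0] x0(1) by (simp add: M_def)
    ultimately have M4: "M \<le> 4 * \<bar>v 0\<bar>" by linarith
    then have M\<eta>: "M < 4 * \<eta>" using \<eta> by linarith
    have wn: "\<bar>w s - b\<bar> < 5 * \<eta>" if s: "0 \<le> s" "s \<le> \<delta>" for s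
    proof -
      have "M * s \<le> M * 1" using s \<delta> M0 by (intro mult_left_mono) auto
      then show ?thesis using ws[OF s] M\<eta> \<eta> by linarith
    qed
    \<comment> \<open>At \<delta> the barrier exceeds 5 \<eta> + 4 \<eta>, the sum of the bounds for
      |w - b| and |v|. The rate K + 3 is one more than the K + 2 at which \<open>y\<close> can grow,
      which makes the crossing argument strict.\<close>
    define B where "B s = 10 * \<eta> * exp ((K + 3) * (\<theta> s - \<theta> \<delta>))" for s
    have B0: "B s > 0" for s using \<eta>0 by (simp add: B_def)
    have dB: "(B has_real_derivative B s * ((K + 3) * (1 / (exp (2 * s) - 1)))) (at s)" if "s > 0" for s
      unfolding B_def[abs_def]
      by (rule derivative_eq_intros d\<theta>[OF that] refl | simp)+
    have BC: "B s \<le> 10 * C1 * \<eta>" if "s \<ge> \<delta>" for s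
    proof -
      have "(K + 3) * (\<theta> s - \<theta> \<delta>) \<le> - (K + 3) * \<theta> \<delta>"
        using \<theta>0[of s] that \<delta> K by (simp add: algebra_simps mult_nonneg_nonpos add_nonpos_nonpos)
      then show ?thesis using \<eta>0 by (simp add: B_def C1_def)
    qed
    \<comment> \<open>For the unperturbed equation w'' + w' = 0 the sum w + v is constant, so
      \<open>y\<close> moves only through the integrable perturbation.\<close>
    define x y where "x s = w s - b" and "y s = w s - b + v s" for s
    define g where "g s = min (B s - \<bar>x s\<bar>) (B s - \<bar>y s\<bar>)" for s
    have cB: "continuous_on {\<delta>..T} B" for T
      by (rule DERIV_continuous_on, rule DERIV_subset[OF _ subset_UNIV], rule dB) (use \<delta> in auto)
    have cx: "continuous_on {\<delta>..T} x" and cy: "continuous_on {\<delta>..T} y" for T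
      unfolding x_def y_def using \<delta>
      by (intro continuous_intros continuous_on_subset[OF cw] continuous_on_subset[OF cv]; auto)+
    have gpos: "g t > 0" if t: "\<delta> \<le> t" for t
    proof (rule continuous_barrier[of \<delta> t g])
      show "continuous_on {\<delta>..t} g" unfolding g_def by (intro continuous_intros cB cx cy)
      have "\<bar>w \<delta> - b\<bar> < 5 * \<eta>" "\<bar>v \<delta>\<bar> < 4 * \<eta>" using wn[of \<delta>] M[of \<delta>] M\<eta> \<delta> by auto
      then have "\<bar>x \<delta>\<bar> < 10 * \<eta>" "\<bar>y \<delta>\<bar> < 10 * \<eta>" unfolding x_def y_def by linarith+
      then show "0 < g \<delta>" by (simp add: g_def B_def)
    next
      fix t assume t: "\<delta> < t" and prev: "\<And>s. \<delta> \<le> s \<Longrightarrow> s < t \<Longrightarrow> 0 < g s"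
      have t0: "t > 0" using t \<delta> by simp
      define q where "q = 1 / (exp (2 * t) - 1)"
      have q: "q > 0" using e1[OF t0] by (simp add: q_def)
      note dBt = dB[OF t0, folded q_def]
      have prev': "e * x s < B s" "e * y s < B s" if "e = 1 \<or> e = -1" "\<delta> \<le> s" "s < t" for e s
        using prev[OF that(2,3)] that(1) unfolding g_def by auto
      have at_t: "e * x t \<le> B t" "e * y t \<le> B t" if e: "e = 1 \<or> e = -1" for e
      proof -
        have "0 \<le> B t - e * x t"
          by (rule nonneg_limit[of \<delta>]) (use t prev'[OF e] in \<open>auto intro!: continuous_intros cB cx\<close>)
        moreover have "0 \<le> B t - e * y t"
          by (rule nonneg_limit[of \<delta>]) (use t prev'[OF e] in \<open>auto intro!: continuous_intros cB cy\<close>)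
        ultimately show "e * x t \<le> B t" "e * y t \<le> B t" by auto
      qed
      have xy: "\<bar>x t\<bar> \<le> B t" "\<bar>y t\<bar> \<le> B t" using at_t[of 1] at_t[of "-1"] by auto
      have strict_x: "e * x t < B t" if e: "e = 1 \<or> e = -1" for e
      proof (rule ccontr)
        assume "\<not> e * x t < B t"
        then have eq: "e * x t = B t" using at_t(1)[OF e] by simp
        \<comment> \<open>When \<open>x\<close> touches the barrier, the bound on \<open>y\<close>
          forces the velocity to point inwards.\<close>
        have "e * v t = e * y t - e * x t" by (simp add: x_def y_def algebra_simps)
        then have "e * v t \<le> 0" using eq at_t(2)[OF e] by simp
        moreover have "0 < B t * ((K + 3) * q)" using B0 q K by (intro mult_pos_pos) auto
        ultimately have "0 < B t * ((K + 3) * q) - e * v t" by linarith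
        moreover have "((\<lambda>s. B s - e * x s) has_real_derivative B t * ((K + 3) * q) - e * v t) (at t)"
          unfolding x_def by (auto intro!: derivative_eq_intros dBt dw[OF t0])
        ultimately have "0 < B t - e * x t"
          using pos_of_pos_deriv[of "\<lambda>s. B s - e * x s" _ t \<delta>] t prev'[OF e] by simp
        then show False using eq by simp
      qed
      have strict_y: "e * y t < B t" if e: "e = 1 \<or> e = -1" for e
      proof -
        have vz: "v t + z t = q * (h (w t) - (1 - be) * v t)" using zeq[OF t0] by (simp add: q_def)
        have "e * (v t + z t) = q * (e * h (w t) - (1 - be) * (e * v t))"
          unfolding vz by (simp add: algebra_simps)
        also have "\<dots> \<le> q * ((K + 2) * B t)"
        proof (rule mult_left_mono)
          have "\<bar>h (w t)\<bar> \<le> K * \<bar>x t\<bar>" using lip[of "w t" b] hb by (simp add: x_def)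
          also have "\<dots> \<le> K * B t" using xy K by (intro mult_left_mono) auto
          finally have "e * h (w t) \<le> K * B t" using e by auto
          moreover have "\<bar>v t\<bar> \<le> 2 * B t" using xy unfolding x_def y_def by linarith
          then have "- (e * v t) \<le> 2 * B t" using e by auto
          then have "(1 - be) * (- (e * v t)) \<le> (1 - be) * (2 * B t)" using be by (intro mult_left_mono) auto
          moreover have "(1 - be) * (2 * B t) \<le> 1 * (2 * B t)"
            using be B0[of t] by (intro mult_right_mono) auto
          ultimately show "e * h (w t) - (1 - be) * (e * v t) \<le> (K + 2) * B t" by (simp add: algebra_simps)
        qed (use q in auto)
        also have "\<dots> < q * ((K + 3) * B t)" using q B0[of t] K by (intro mult_strict_left_mono mult_strict_right_mono) auto
        finally have "0 < B t * ((K + 3) * q) - e * (v t + z t)" by (simp add: mult_ac)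
        moreover have "((\<lambda>s. B s - e * y s) has_real_derivative B t * ((K + 3) * q) - e * (v t + z t)) (at t)"
          unfolding y_def by (auto intro!: derivative_eq_intros dBt dw[OF t0] dv[OF t0])
        ultimately have "0 < B t - e * y t"
          using pos_of_pos_deriv[of "\<lambda>s. B s - e * y s" _ t \<delta>] t prev'[OF e] by simp
        then show ?thesis by simp
      qed
      show "0 < g t"
        using strict_x[of 1] strict_x[of "-1"] strict_y[of 1] strict_y[of "-1"] unfolding g_def by auto
    qed (use t in auto)
    show ?thesis
    proof (cases "s \<le> \<delta>")
      case True
      have "5 * \<eta> \<le> C * \<eta>" using C1 \<eta>0 unfolding C_def by (intro mult_right_mono) auto
      then show ?thesis using wn[OF s True] M[OF s True] M\<eta> \<eta>0 by linarith
    next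
      case False
      then have "g s > 0" "B s \<le> 10 * C1 * \<eta>" using gpos BC by auto
      then have "\<bar>w s - b\<bar> < 10 * C1 * \<eta>" "\<bar>w s - b + v s\<bar> < 10 * C1 * \<eta>"
        unfolding g_def x_def y_def by auto
      then show ?thesis unfolding C_def by linarith
    qed
  qed
  then show ?thesis using that[of C] C1 by (auto simp: C_def)
qed

end

section \<open>Holomorphic extension of solutions at regular singular points\<close>

lemma holomorphic_lipschitz_cball:
  assumes "g holomorphic_on ball z R" "0 < r" "r < R"
  obtains K where "K \<ge> 0" "\<And>x y. x \<in> cball z r \<Longrightarrow> y \<in> cball z r \<Longrightarrow> norm (g x - g y) \<le> K * norm (x - y)"
proof -
  have sub: "cball z r \<subseteq> ball z R" using assms by auto
  have "continuous_on (cball z r) (deriv g)"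
    by (rule holomorphic_on_imp_continuous_on[OF
      holomorphic_on_subset[OF holomorphic_deriv[OF assms(1) open_ball] sub]])
  then have "bounded (deriv g ` cball z r)"
    by (intro compact_imp_bounded compact_continuous_image) auto
  then obtain K where K: "K > 0" "\<And>x. x \<in> cball z r \<Longrightarrow> norm (deriv g x) \<le> K"
    by (auto simp: bounded_pos)
  have "norm (g x - g y) \<le> K * norm (x - y)" if "x \<in> cball z r" "y \<in> cball z r" for x y
  proof (rule field_differentiable_bound[of "cball z r" g "deriv g"])
    fix w assume "w \<in> cball z r"
    then have "w \<in> ball z R" using sub by blast
    then show "(g has_field_derivative deriv g w) (at w within cball z r)"
      by (rule has_field_derivative_at_within[OF holomorphic_derivI[OF assms(1) open_ball]])
  qed (use that K in simp_all)
  then show ?thesis using K(1) by (intro that[of K]) simp_all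
qed

lemma holomorphic_difference_quotient:
  assumes "g holomorphic_on ball a R" "R > 0"
  obtains q where "q holomorphic_on ball a R" "\<And>z. g z = g a + (z - a) * q z"
proof -
  let ?q = "\<lambda>z. if z = a then deriv g a else (g z - g a) / (z - a)"
  have "?q holomorphic_on ball a R"
    using pole_lemma[OF assms(1), of a] assms(2) by simp
  moreover have "g z = g a + (z - a) * ?q z" for z by simp
  ultimately show ?thesis using that by blast
qed

text \<open>With weight t^\<gamma> it inverts the singular operator: the mean V of N solves z V' +
  (1 + \<gamma>) V = N. With weight t it recovers (u - u(0) - u'(0) z) / z^2 from V = (u' - u'(0)) /
  z.\<close>

definition ray_mean :: "(real \<Rightarrow> real) \<Rightarrow> (complex \<Rightarrow> complex) \<Rightarrow> complex \<Rightarrow> complex" where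
  "ray_mean k V z = integral {0..1} (\<lambda>t. of_real (k t) * V (of_real t * z))"

text \<open>Star-shaped about the origin. A disc and its real diameter share this property, so one
  set of estimates serves both.\<close>

definition radial :: "complex set \<Rightarrow> bool" where
  "radial S \<longleftrightarrow> (\<forall>z\<in>S. \<forall>t\<in>{0..1}. of_real t * z \<in> S)"

lemma radial_cont:
  fixes V :: "complex \<Rightarrow> complex"
  assumes "radial S" "z \<in> S" "continuous_on S V" "continuous_on {0..1} k"
  shows "continuous_on {0..1} (\<lambda>t. of_real (k t) * V (of_real t * z))"
proof -
  have "continuous_on {0..1} (\<lambda>t. V (complex_of_real t * z))"
    by (rule continuous_on_compose2[OF assms(3)])
      (use assms(1,2) in \<open>auto simp: radial_def intro!: continuous_intros\<close>)
  then show ?thesis using assms(4)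
    by (intro continuous_on_mult continuous_on_of_real)
qed

lemma ray_mean_bound:
  assumes "radial S" "z \<in> S" "continuous_on S V" "continuous_on {0..1} k"
    and "\<And>t. t \<in> {0..1} \<Longrightarrow> \<bar>k t\<bar> \<le> 1" "\<And>x. x \<in> S \<Longrightarrow> norm (V x) \<le> B"
  shows "norm (ray_mean k V z) \<le> B"
proof -
  have B: "B \<ge> 0" using assms(6)[OF assms(2)] norm_ge_zero[of "V z"] by linarith
  have "norm (ray_mean k V z) \<le> integral {0..1} (\<lambda>t::real. B)"
    unfolding ray_mean_def
  proof (rule integral_norm_bound_integral)
    fix t :: real assume t: "t \<in> {0..1}"
    have "norm (complex_of_real (k t) * V (of_real t * z)) = \<bar>k t\<bar> * norm (V (of_real t * z))"
      by (simp add: norm_mult)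
    also have "\<dots> \<le> 1 * B"
      using assms t B by (intro mult_mono) (auto simp: radial_def)
    finally show "norm (complex_of_real (k t) * V (of_real t * z)) \<le> B" by simp
  qed (rule integrable_continuous_interval[OF radial_cont[OF assms(1-4)]] integrable_const_ivl)+
  then show ?thesis by simp
qed

lemma ray_mean_diff:
  assumes "radial S" "z \<in> S" "continuous_on S V" "continuous_on S V'" "continuous_on {0..1} k"
  shows "ray_mean k V z - ray_mean k V' z = ray_mean k (\<lambda>x. V x - V' x) z"
  unfolding ray_mean_def right_diff_distrib
  by (rule integral_diff[symmetric])
    (rule integrable_continuous_interval[OF radial_cont[OF assms(1,2,3,5)]]
      integrable_continuous_interval[OF radial_cont[OF assms(1,2,4,5)]])+

lemma radial_ball [simp]: "radial (ball 0 r)"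
proof -
  have "t * norm z < r" if "norm z < r" "0 \<le> t" "t \<le> 1" for z :: complex and t
    using mult_left_le_one_le[of "norm z" t] that by simp
  then show ?thesis by (auto simp: radial_def norm_mult)
qed

lemma radial_real: "radial (of_real ` {-r<..<r})"
  unfolding radial_def
proof safe
  fix y t :: real assume y: "y \<in> {-r<..<r}" and t: "t \<in> {0..1}"
  have "\<bar>t * y\<bar> \<le> \<bar>y\<bar>" using t by (simp add: abs_mult mult_left_le_one_le)
  then have "t * y \<in> {-r<..<r}" using y by auto
  then show "complex_of_real t * complex_of_real y \<in> complex_of_real ` {-r<..<r}"
    unfolding of_real_mult[symmetric] by (rule imageI)
qed

lemma ray_mean_holomorphic:
  assumes "V holomorphic_on ball 0 r" "continuous_on {0..1} k"
  shows "ray_mean k V holomorphic_on ball 0 r"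
proof -
  have rad: "complex_of_real t * x \<in> ball 0 r" if "x \<in> ball 0 r" "t \<in> {0..1}" for t x
    using radial_ball[of r] that by (auto simp only: radial_def)
  have "(\<lambda>z. integral (cbox 0 1) (\<lambda>t. of_real (k t) * V (of_real t * z))) holomorphic_on ball 0 r"
  proof (rule leibniz_rule_holomorphic)
    fix x :: complex and t :: real assume "x \<in> ball 0 r" "t \<in> cbox 0 1"
    then have "complex_of_real t * x \<in> ball 0 r" using rad by auto
    then have "(V has_field_derivative deriv V (of_real t * x)) (at (of_real t * x))"
      using assms(1) by (simp add: holomorphic_derivI)
    moreover have "((\<lambda>x. of_real t * x) has_field_derivative of_real t) (at x)"
      by (auto intro!: derivative_eq_intros)
    ultimately have "((\<lambda>x. V (of_real t * x)) has_field_derivative deriv V (of_real t * x) * of_real t) (at x)"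
      by (rule DERIV_chain2)
    then have "((\<lambda>z. of_real (k t) * V (of_real t * z)) has_field_derivative
         of_real (k t) * (deriv V (of_real t * x) * of_real t)) (at x)"
      by (rule DERIV_cmult)
    then show "((\<lambda>z. of_real (k t) * V (of_real t * z)) has_field_derivative
         of_real (k t) * (deriv V (of_real t * x) * of_real t)) (at x within ball 0 r)"
      by (rule has_field_derivative_at_within)
  next
    fix x :: complex assume "x \<in> ball 0 r"
    then show "(\<lambda>t. complex_of_real (k t) * V (complex_of_real t * x)) integrable_on cbox 0 1"
      using integrable_continuous_interval[OF
        radial_cont[OF radial_ball _ holomorphic_on_imp_continuous_on[OF assms(1)] assms(2)]]
      by simp
  next
    have "continuous_on (ball 0 r) (deriv V)"
      by (rule holomorphic_on_imp_continuous_on[OF holomorphic_deriv[OF assms(1) open_ball]])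
    then have 1: "continuous_on (ball 0 r \<times> cbox 0 1) (\<lambda>p. deriv V (complex_of_real (snd p) * fst p))"
    proof (rule continuous_on_compose2)
      show "continuous_on (ball 0 r \<times> cbox 0 1) (\<lambda>p. complex_of_real (snd p) * fst p)"
        by (intro continuous_on_mult continuous_on_of_real continuous_on_snd continuous_on_fst continuous_on_id)
      show "(\<lambda>p. complex_of_real (snd p) * fst p) ` (ball 0 r \<times> cbox 0 1) \<subseteq> ball 0 r"
      proof (rule image_subsetI)
        fix p :: "complex \<times> real" assume "p \<in> ball 0 r \<times> cbox 0 1"
        then show "complex_of_real (snd p) * fst p \<in> ball 0 r"
          using rad[of "fst p" "snd p"] by (simp only: mem_Times_iff box_real)
      qed
    qed
    have 2: "continuous_on (ball 0 r \<times> cbox 0 1) (\<lambda>p::complex \<times> real. k (snd p))"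
      by (rule continuous_on_compose2[OF assms(2) continuous_on_snd[OF continuous_on_id]]) fastforce
    show "continuous_on (ball 0 r \<times> cbox 0 1)
            (\<lambda>(x, t). complex_of_real (k t) * (deriv V (complex_of_real t * x) * complex_of_real t))"
      unfolding case_prod_unfold
      by (intro continuous_on_mult continuous_on_of_real 1 2 continuous_on_snd continuous_on_id)
  qed (rule convex_ball)
  then show ?thesis by (simp only: ray_mean_def[abs_def] box_real)
qed

lemma ray_mean_continuous:
  assumes "radial S" "continuous_on S V" "continuous_on {0..1} k"
  shows "continuous_on S (ray_mean k V)"
proof -
  have 1: "continuous_on (S \<times> cbox 0 1) (\<lambda>p. V (complex_of_real (snd p) * fst p))"
  proof (rule continuous_on_compose2[OF assms(2)])
    show "continuous_on (S \<times> cbox 0 1) (\<lambda>p. complex_of_real (snd p) * fst p)"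
      by (intro continuous_on_mult continuous_on_of_real continuous_on_snd continuous_on_fst continuous_on_id)
    show "(\<lambda>p. complex_of_real (snd p) * fst p) ` (S \<times> cbox 0 1) \<subseteq> S"
      using assms(1) by (force simp: radial_def)
  qed
  have 2: "continuous_on (S \<times> cbox 0 1) (\<lambda>p::complex \<times> real. k (snd p))"
    by (rule continuous_on_compose2[OF assms(3) continuous_on_snd[OF continuous_on_id]]) fastforce
  have "continuous_on S (\<lambda>z. integral (cbox 0 1) (\<lambda>t. of_real (k t) * V (of_real t * z)))"
    by (rule integral_continuous_on_param, unfold case_prod_unfold)
      (intro continuous_on_mult continuous_on_of_real 1 2)
  then show ?thesis by (simp only: ray_mean_def[abs_def] box_real)
qed

text \<open>The Picard iterates of a contraction whose value at a point depends only on the values along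
  the segment from the origin converge simultaneously on a complex disc and on its real diameter.
  Hence a fixed point known only on the diameter is the restriction of a holomorphic function.\<close>

lemma radial_contraction_holomorphic:
  fixes T :: "(complex \<Rightarrow> complex) \<Rightarrow> complex \<Rightarrow> complex"
  assumes "B \<ge> 0"
    and hol: "\<And>V. V holomorphic_on ball 0 r \<Longrightarrow> \<forall>z\<in>ball 0 r. norm (V z) \<le> B
      \<Longrightarrow> T V holomorphic_on ball 0 r"
    and bd: "\<And>V z. V holomorphic_on ball 0 r \<Longrightarrow> \<forall>z\<in>ball 0 r. norm (V z) \<le> B
      \<Longrightarrow> z \<in> ball 0 r \<Longrightarrow> norm (T V z) \<le> B"
    and con: "\<And>S V V' d z. radial S \<Longrightarrow> S \<subseteq> ball 0 r \<Longrightarrow> continuous_on S V \<Longrightarrow> continuous_on S V'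
      \<Longrightarrow> \<forall>z\<in>S. norm (V z) \<le> B \<Longrightarrow> \<forall>z\<in>S. norm (V' z) \<le> B \<Longrightarrow> \<forall>z\<in>S. norm (V z - V' z) \<le> d
      \<Longrightarrow> z \<in> S \<Longrightarrow> norm (T V z - T V' z) \<le> d / 2"
    and W: "continuous_on (of_real ` {-r<..<r}) W" "\<forall>z\<in>of_real ` {-r<..<r}. norm (W z) \<le> B"
      "\<forall>z\<in>of_real ` {-r<..<r}. T W z = W z"
  obtains V where "V holomorphic_on ball 0 r" "\<forall>z\<in>of_real ` {-r<..<r}. V z = W z"
proof -
  define R where "R = complex_of_real ` {-r<..<r}"
  have R: "radial R" "R \<subseteq> ball 0 r"
    unfolding R_def by (rule radial_real, auto)
  define P where "P n = (T ^^ n) (\<lambda>_. 0)" for n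
  have PS: "P (Suc n) = T (P n)" for n by (simp add: P_def)
  have P: "P n holomorphic_on ball 0 r \<and> (\<forall>z\<in>ball 0 r. norm (P n z) \<le> B)" for n
  proof (induction n)
    case 0 then show ?case using assms(1) by (simp add: P_def)
  next
    case (Suc n) then show ?case unfolding PS using hol bd by blast
  qed
  have Pc: "continuous_on S (P n)" if "S \<subseteq> ball 0 r" for n S
    using P[of n] that holomorphic_on_imp_continuous_on continuous_on_subset by blast
  have d1: "\<forall>z\<in>ball 0 r. norm (P (Suc n) z - P n z) \<le> 2 * B * (1/2) ^ n" for n
  proof (induction n)
    case 0
    show ?case
    proof
      fix z :: complex assume z: "z \<in> ball 0 r"
      have "norm (P (Suc 0) z - P 0 z) \<le> norm (P (Suc 0) z) + norm (P 0 z)"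
        by (rule norm_triangle_ineq4)
      also have "\<dots> \<le> B + B" using P z by (intro add_mono) auto
      finally show "norm (P (Suc 0) z - P 0 z) \<le> 2 * B * (1/2) ^ 0" by simp
    qed
  next
    case (Suc n)
    show ?case
    proof
      fix z :: complex assume z: "z \<in> ball 0 r"
      have "norm (T (P (Suc n)) z - T (P n) z) \<le> (2 * B * (1/2) ^ n) / 2"
        by (rule con[OF radial_ball subset_refl Pc[OF subset_refl] Pc[OF subset_refl] _ _ Suc.IH z])
          (use P in blast)+
      then show "norm (P (Suc (Suc n)) z - P (Suc n) z) \<le> 2 * B * (1/2) ^ Suc n"
        by (simp add: PS)
    qed
  qed
  have d2: "\<forall>z\<in>R. norm (P n z - W z) \<le> 2 * B * (1/2) ^ n" for n
  proof (induction n)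
    case 0
    then show ?case using W(2) assms(1) by (auto simp: P_def R_def intro: order_trans)
  next
    case (Suc n)
    show ?case
    proof
      fix z assume z: "z \<in> R"
      have "norm (T (P n) z - T W z) \<le> (2 * B * (1/2) ^ n) / 2"
        by (rule con[OF R Pc[OF R(2)] W(1)[folded R_def] _ _ Suc.IH z])
          (use P R W(2) R_def in blast)+
      then show "norm (P (Suc n) z - W z) \<le> 2 * B * (1/2) ^ Suc n"
      proof -
        have "T W z = W z" using W(3) z unfolding R_def by blast
        then show ?thesis using \<open>norm (T (P n) z - T W z) \<le> _\<close> by (simp add: PS)
      qed
    qed
  qed
  have sm: "summable (\<lambda>n. 2 * B * (1/2::real) ^ n)"
    by (intro summable_mult summable_geometric) simp
  \<comment> \<open>The limit of the iterates is written as a telescoping series for the Weierstrass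
    test.\<close>
  define V where "V z = (\<Sum>n. P (Suc n) z - P n z)" for z
  have tele: "(\<Sum>i<n. P (Suc i) z - P i z) = P n z" for n z
    using sum_lessThan_telescope[of "\<lambda>i. P i z" n] by (simp add: P_def)
  have ul: "uniform_limit (ball 0 r) (\<lambda>n z. P n z) V sequentially"
    using Weierstrass_m_test[of "ball 0 r" "\<lambda>n z. P (Suc n) z - P n z", OF _ sm] d1
    unfolding tele V_def by blast
  have "V holomorphic_on ball 0 r"
  proof (rule holomorphic_uniform_sequence[OF open_ball])
    show "P n holomorphic_on ball 0 r" for n using P by blast
    fix z :: complex assume "z \<in> ball 0 r"
    then obtain d where "d > 0" "cball z d \<subseteq> ball 0 r"
      using open_contains_cball_eq[OF open_ball] by blast
    then show "\<exists>d>0. cball z d \<subseteq> ball 0 r \<and> uniform_limit (cball z d) P V sequentially"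
      using uniform_limit_on_subset[OF ul] by blast
  qed
  moreover have "V z = W z" if z: "z \<in> R" for z
  proof (rule LIMSEQ_unique)
    show "(\<lambda>n. P n z) \<longlonglongrightarrow> V z"
      using tendsto_uniform_limitI[OF ul] R z by blast
    have "(\<lambda>n. 2 * B * (1/2::real) ^ n) \<longlonglongrightarrow> 0"
      using summable_LIMSEQ_zero[OF sm] .
    then have "(\<lambda>n. P n z - W z) \<longlonglongrightarrow> 0"
      by (rule Lim_null_comparison[rotated]) (use d2 z in auto)
    then show "(\<lambda>n. P n z) \<longlonglongrightarrow> W z" by (simp add: Lim_null[symmetric])
  qed
  ultimately show ?thesis using that unfolding R_def by blast
qed

text \<open>Here \<open>a\<close> stands for u' - u'(0) and \<open>b\<close> for (u - u(0)) / z -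
  u'(0). On a small disc both stay in the unit disc, where the bounds are uniform.\<close>

lemma singular_ode_nonlinearity_bounds:
  fixes c1 h1 g g1 :: "complex \<Rightarrow> complex" and h0 p u0 :: complex
    and \<Phi> :: "complex \<Rightarrow> complex \<Rightarrow> complex \<Rightarrow> complex"
  assumes "r0 > 0" "rg > 0"
    and "c1 holomorphic_on ball 0 r0" "h1 holomorphic_on ball 0 r0"
    and "g holomorphic_on ball u0 rg" "g1 holomorphic_on ball u0 rg"
    and \<Phi>_def: "\<And>z a b. \<Phi> z a b = c1 z * (p + a) + h1 z * g (u0 + z * (p + b))
      + h0 * g1 (u0 + z * (p + b)) * (p + b)"
  obtains r1 K B where "0 < r1" "r1 < r0" "K \<ge> 0" "B \<ge> 0"
    "\<And>z b. norm z \<le> r1 \<Longrightarrow> norm b \<le> 1 \<Longrightarrow> u0 + z * (p + b) \<in> ball u0 rg"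
    "\<And>z a b. norm z \<le> r1 \<Longrightarrow> norm a \<le> 1 \<Longrightarrow> norm b \<le> 1 \<Longrightarrow> norm (\<Phi> z a b) \<le> B"
    "\<And>z a b a' b'. norm z \<le> r1 \<Longrightarrow> norm a \<le> 1 \<Longrightarrow> norm b \<le> 1 \<Longrightarrow> norm a' \<le> 1 \<Longrightarrow> norm b' \<le> 1
       \<Longrightarrow> norm (\<Phi> z a b - \<Phi> z a' b') \<le> K * (norm (a - a') + norm (b - b'))"
proof -
  define m where "m = norm p + 1"
  have m: "m > 0" by (simp add: m_def add_nonneg_pos)
  \<comment> \<open>Keeps the values of u within half the radius \<open>rg\<close>, where
    \<open>g\<close> and its difference quotient are bounded and Lipschitz.\<close>
  define r1 where "r1 = min (r0 / 2) (rg / 2 / m)"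
  have r1: "0 < r1" "r1 < r0" "r1 * m \<le> rg / 2"
    using assms(1,2) m by (auto simp: r1_def min_def field_simps)
  have bounded_on: "\<exists>C\<ge>0. \<forall>z\<in>cball a R. norm (f z) \<le> C"
    if "f holomorphic_on ball a R'" "R < R'" for f :: "complex \<Rightarrow> complex" and a R R'
  proof -
    have "continuous_on (cball a R) f"
      using that by (intro holomorphic_on_imp_continuous_on holomorphic_on_subset[OF that(1)]) auto
    then have "bounded (f ` cball a R)" by (intro compact_imp_bounded compact_continuous_image) auto
    then obtain C where "C > 0" "\<forall>z\<in>cball a R. norm (f z) \<le> C" by (auto simp: bounded_pos)
    then show ?thesis by (intro exI[of _ C]) auto
  qed
  obtain C1 where C1: "C1 \<ge> 0" "\<And>z. norm z \<le> r1 \<Longrightarrow> norm (c1 z) \<le> C1"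
    using bounded_on[OF assms(3) r1(2)] by auto
  obtain H1 where H1: "H1 \<ge> 0" "\<And>z. norm z \<le> r1 \<Longrightarrow> norm (h1 z) \<le> H1"
    using bounded_on[OF assms(4) r1(2)] by auto
  have rg: "0 < rg / 2" "rg / 2 < rg" using assms(2) by auto
  obtain G where G: "G \<ge> 0" "\<And>z. z \<in> cball u0 (rg / 2) \<Longrightarrow> norm (g z) \<le> G"
    using bounded_on[OF assms(5) rg(2)] by auto
  obtain G1 where G1: "G1 \<ge> 0" "\<And>z. z \<in> cball u0 (rg / 2) \<Longrightarrow> norm (g1 z) \<le> G1"
    using bounded_on[OF assms(6) rg(2)] by auto
  obtain L where L: "L \<ge> 0" "\<And>x y. x \<in> cball u0 (rg / 2) \<Longrightarrow> y \<in> cball u0 (rg / 2)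
      \<Longrightarrow> norm (g x - g y) \<le> L * norm (x - y)"
    using holomorphic_lipschitz_cball[OF assms(5) rg] by blast
  obtain L1 where L1: "L1 \<ge> 0" "\<And>x y. x \<in> cball u0 (rg / 2) \<Longrightarrow> y \<in> cball u0 (rg / 2)
      \<Longrightarrow> norm (g1 x - g1 y) \<le> L1 * norm (x - y)"
    using holomorphic_lipschitz_cball[OF assms(6) rg] by blast
  have pb: "norm (p + b) \<le> m" if "norm b \<le> 1" for b
    using norm_triangle_ineq[of p b] that by (simp add: m_def)
  have dom: "u0 + z * (p + b) \<in> cball u0 (rg / 2)" if "norm z \<le> r1" "norm b \<le> 1" for z b
  proof -
    have "norm (z * (p + b)) \<le> r1 * m"
      unfolding norm_mult using that pb r1 by (intro mult_mono) auto
    then show ?thesis using r1(3) by (simp add: dist_norm)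
  qed
  define K where "K = C1 + H1 * L * r1 + norm h0 * (L1 * r1 * m + G1)"
  define B where "B = C1 * m + H1 * G + norm h0 * G1 * m"
  show ?thesis
  proof (rule that[of r1 K B])
    show "0 < r1" "r1 < r0" by (fact r1)+
    show "K \<ge> 0" "B \<ge> 0" unfolding K_def B_def using C1 H1 L L1 G G1 m r1 by auto
    show "u0 + z * (p + b) \<in> ball u0 rg" if "norm z \<le> r1" "norm b \<le> 1" for z b
      using dom[OF that] rg by auto
  next
    fix z a b :: complex assume *: "norm z \<le> r1" "norm a \<le> 1" "norm b \<le> 1"
    have "norm (\<Phi> z a b) \<le> norm (c1 z * (p + a)) + norm (h1 z * g (u0 + z * (p + b)))
        + norm (h0 * g1 (u0 + z * (p + b)) * (p + b))"
      unfolding \<Phi>_def by (intro norm_triangle_le add_mono order_refl)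
    also have "\<dots> \<le> B"
      unfolding B_def norm_mult using * C1 H1 G G1 m pb dom
      by (intro add_mono mult_mono order_refl mult_nonneg_nonneg) auto
    finally show "norm (\<Phi> z a b) \<le> B" .
  next
    fix z a b a' b' :: complex
    assume *: "norm z \<le> r1" "norm a \<le> 1" "norm b \<le> 1" "norm a' \<le> 1" "norm b' \<le> 1"
    let ?x = "u0 + z * (p + b)" and ?y = "u0 + z * (p + b')"
    have xy: "norm (?x - ?y) \<le> r1 * norm (b - b')"
    proof -
      have "?x - ?y = z * (b - b')" by (simp add: algebra_simps)
      then show ?thesis using * by (simp add: norm_mult mult_right_mono)
    qed
    have gx: "norm (g ?x - g ?y) \<le> L * (r1 * norm (b - b'))"
      using L(2)[OF dom dom, OF *(1,3) *(1,5)] xy L(1) by (meson mult_left_mono order_trans)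
    have g1x: "norm (g1 ?x - g1 ?y) \<le> L1 * (r1 * norm (b - b'))"
      using L1(2)[OF dom dom, OF *(1,3) *(1,5)] xy L1(1) by (meson mult_left_mono order_trans)
    have "\<Phi> z a b - \<Phi> z a' b' = c1 z * (a - a') + h1 z * (g ?x - g ?y)
        + h0 * ((g1 ?x - g1 ?y) * (p + b) + g1 ?y * (b - b'))"
      unfolding \<Phi>_def by (simp add: algebra_simps)
    also have "norm \<dots> \<le> norm (c1 z * (a - a')) + norm (h1 z * (g ?x - g ?y))
        + norm (h0 * ((g1 ?x - g1 ?y) * (p + b) + g1 ?y * (b - b')))"
      by (intro norm_triangle_le add_mono order_refl)
    also have "norm (h0 * ((g1 ?x - g1 ?y) * (p + b) + g1 ?y * (b - b')))
        \<le> norm h0 * (norm (g1 ?x - g1 ?y) * norm (p + b) + norm (g1 ?y) * norm (b - b'))"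
      unfolding norm_mult
      by (intro mult_left_mono norm_triangle_le) (auto simp: norm_mult)
    also have "norm (c1 z * (a - a')) + norm (h1 z * (g ?x - g ?y))
         + norm h0 * (norm (g1 ?x - g1 ?y) * norm (p + b) + norm (g1 ?y) * norm (b - b'))
       \<le> C1 * norm (a - a') + H1 * (L * (r1 * norm (b - b')))
         + norm h0 * (L1 * (r1 * norm (b - b')) * m + G1 * norm (b - b'))"
      unfolding norm_mult
      using * C1 H1 G1 m pb dom gx g1x L1 r1
      by (intro add_mono mult_mono order_refl mult_nonneg_nonneg) auto
    also have "\<dots> = C1 * norm (a - a') + (K - C1) * norm (b - b')"
      unfolding K_def by (simp add: algebra_simps)
    also have "\<dots> \<le> K * norm (a - a') + K * norm (b - b')"
      unfolding K_def using C1 H1 L L1 G1 m r1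
      by (intro add_mono mult_right_mono) auto
    finally show "norm (\<Phi> z a b - \<Phi> z a' b') \<le> K * (norm (a - a') + norm (b - b'))"
      by (simp add: algebra_simps)
  qed
qed

text \<open>Writing \<open>u' = u'(0) + y V\<close>, the equation \<open>y u'' + c u' + h g(u) = 0\<close> becomes
  \<open>y V' + (1 + c(0)) V = - N(V)\<close>, with a nonlinearity \<open>N(V)\<close> depending on \<open>V\<close> only through
  \<open>y V\<close> and \<open>u\<close>. Integrated against \<open>t^c(0)\<close> along the segment from the origin it is a fixed point
  equation that contracts on small discs. A regular point is the case \<open>c(0) = 0\<close>, after
  multiplication by \<open>y\<close>.\<close>

lemma singular_ode_holomorphic:
  fixes u u1 u2 :: "real \<Rightarrow> real" and c h g :: "complex \<Rightarrow> complex" and \<gamma> r0 rg :: real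
  assumes r0: "r0 > 0" and rg: "rg > 0" and \<gamma>: "\<gamma> \<ge> 0"
    and du: "\<And>y. \<bar>y\<bar> < r0 \<Longrightarrow> (u has_real_derivative u1 y) (at y)"
    and du1: "\<And>y. \<bar>y\<bar> < r0 \<Longrightarrow> (u1 has_real_derivative u2 y) (at y)"
    and c: "c holomorphic_on ball 0 r0" "c 0 = of_real \<gamma>"
    and h: "h holomorphic_on ball 0 r0"
    and g: "g holomorphic_on ball (of_real (u 0)) rg"
    and ode: "\<And>y. \<bar>y\<bar> < r0 \<Longrightarrow> of_real y * of_real (u2 y) + c (of_real y) * of_real (u1 y)
       + h (of_real y) * g (of_real (u y)) = 0"
  obtains r U where "r > 0" "r \<le> r0" "U holomorphic_on ball 0 r"
    "\<And>y. \<bar>y\<bar> < r \<Longrightarrow> U (of_real y) = of_real (u y)"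
proof -
  obtain c1 where c1: "c1 holomorphic_on ball 0 r0" "\<And>z. c z = c 0 + (z - 0) * c1 z"
    using holomorphic_difference_quotient[OF c(1) r0] by blast
  obtain h1 where h1: "h1 holomorphic_on ball 0 r0" "\<And>z. h z = h 0 + (z - 0) * h1 z"
    using holomorphic_difference_quotient[OF h r0] by blast
  define u0 p where "u0 = complex_of_real (u 0)" and "p = complex_of_real (u1 0)"
  obtain g1 where g1: "g1 holomorphic_on ball u0 rg" "\<And>z. g z = g u0 + (z - u0) * g1 z"
    using holomorphic_difference_quotient[OF g rg] unfolding u0_def by blast
  \<comment> \<open>z times this is c u' + h g(u), with u' = p + a and u = u0 + z (p + b), minus
    c(0) u' and h(0) g(u0). Each difference has been divided by z through its difference
    quotient.\<close>
  define \<Phi> where "\<Phi> z a b = c1 z * (p + a) + h1 z * g (u0 + z * (p + b))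
      + h 0 * g1 (u0 + z * (p + b)) * (p + b)" for z a b
  obtain r1 K B0 where r1: "0 < r1" "r1 < r0" and K: "K \<ge> 0" and B0: "B0 \<ge> 0"
    and dom: "\<And>z b. norm z \<le> r1 \<Longrightarrow> norm b \<le> 1 \<Longrightarrow> u0 + z * (p + b) \<in> ball u0 rg"
    and \<Phi>_bd: "\<And>z a b. norm z \<le> r1 \<Longrightarrow> norm a \<le> 1 \<Longrightarrow> norm b \<le> 1 \<Longrightarrow> norm (\<Phi> z a b) \<le> B0"
    and \<Phi>_lip: "\<And>z a b a' b'. norm z \<le> r1 \<Longrightarrow> norm a \<le> 1 \<Longrightarrow> norm b \<le> 1 \<Longrightarrow> norm a' \<le> 1 \<Longrightarrow> norm b' \<le> 1
       \<Longrightarrow> norm (\<Phi> z a b - \<Phi> z a' b') \<le> K * (norm (a - a') + norm (b - b'))"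
    using singular_ode_nonlinearity_bounds[OF r0 rg c1(1) h1(1) g[folded u0_def] g1(1), OF \<Phi>_def]
    by blast
  \<comment> \<open>The real candidate for V, with the value at 0 that makes it continuous.\<close>
  define w where "w y = (if y = 0 then u2 0 else (u1 y - u1 0) / y)" for y :: real
  have cu1: "continuous_on {-r1..r1} u1" and cu: "continuous_on {-r1..r1} u"
    by (rule DERIV_continuous_on, rule DERIV_subset[OF _ subset_UNIV], rule du1 du, use r1 in auto)+
  have cw: "continuous_on {-r1..r1} w"
  proof (rule continuous_at_imp_continuous_on, rule ballI)
    fix y assume y: "y \<in> {-r1..r1}"
    show "isCont w y"
    proof (cases "y = 0")
      case True
      have "(\<lambda>x. (u1 x - u1 0) / (x - 0)) \<midarrow>0\<rightarrow> u2 0"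
        using du1[of 0] r0 by (simp add: has_field_derivative_iff)
      then have "w \<midarrow>0\<rightarrow> u2 0"
        by (rule Lim_transform_eventually) (simp add: w_def eventually_at_filter)
      then show ?thesis by (simp add: True isCont_def w_def)
    next
      case False
      have "isCont (\<lambda>y. (u1 y - u1 0) / y) y"
        using DERIV_isCont[OF du1[of y]] y r1 False by (auto intro!: continuous_intros)
      moreover have "eventually (\<lambda>x. w x = (u1 x - u1 0) / x) (nhds y)"
        using t1_space_nhds[OF False] by (rule eventually_mono) (simp add: w_def)
      ultimately show ?thesis by (metis isCont_cong)
    qed
  qed
  obtain Bw where Bw: "Bw > 0" "\<And>y. y \<in> {-r1..r1} \<Longrightarrow> \<bar>w y\<bar> \<le> Bw"
    using compact_imp_bounded[OF compact_continuous_image[OF cw compact_Icc]]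
    by (auto simp: bounded_pos)
  define B where "B = max B0 Bw"
  have B: "B > 0" "B0 \<le> B" "Bw \<le> B" using Bw by (auto simp: B_def)
  \<comment> \<open>\<open>1 / B\<close> keeps z V and z times its ray mean in the unit disc;
    \<open>4 * K * r \<le> 1\<close> yields the contraction factor 1/2.\<close>
  define r where "r = min r1 (min (1 / B) (1 / (4 * K + 1)))"
  have r: "r > 0" "r \<le> r1" "r * B \<le> 1" "4 * K * r \<le> 1"
  proof -
    show "r > 0" using r1 B K by (simp add: r_def)
    show "r \<le> r1" by (simp add: r_def)
    have "r \<le> 1 / B" by (simp add: r_def)
    then show "r * B \<le> 1" using B by (simp add: field_simps)
    have "r \<le> 1 / (4 * K + 1)" by (simp add: r_def)
    then have "r * (4 * K + 1) \<le> 1" using K by (simp add: pos_le_divide_eq)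
    then show "4 * K * r \<le> 1" using \<open>r > 0\<close> by (simp add: algebra_simps)
  qed
  \<comment> \<open>The case split is needed because \<open>0 powr 0 = 0\<close> would make the
    weight discontinuous at the origin.\<close>
  define k :: "real \<Rightarrow> real" where "k t = (if \<gamma> = 0 then 1 else t powr \<gamma>)" for t
  have kc: "continuous_on {0..1} k"
  proof (cases "\<gamma> = 0")
    case False
    then have "continuous_on {0..1} (\<lambda>t::real. t powr \<gamma>)"
      using \<gamma> by (intro continuous_on_powr') auto
    then show ?thesis using False by (simp add: k_def[abs_def])
  qed (simp add: k_def[abs_def])
  have kb: "\<bar>k t\<bar> \<le> 1" if "t \<in> {0..1}" for t
    using that \<gamma> by (auto simp: k_def powr_le1)
  define I where "I = ray_mean (\<lambda>t. t)"
  define N where "N V z = \<Phi> z (z * V z) (z * I V z)" for V z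
  define T where "T V z = - ray_mean k (N V) z" for V z
  have idb: "\<bar>t\<bar> \<le> 1" if "t \<in> {0..1}" for t :: real using that by auto
  have zV: "norm (z * V z) \<le> 1 \<and> norm (z * I V z) \<le> 1"
    if "radial S" "S \<subseteq> ball 0 r" "continuous_on S V" "\<forall>z\<in>S. norm (V z) \<le> B" "z \<in> S" for S V z
  proof -
    have z: "norm z \<le> r" using that by auto
    have "norm (I V z) \<le> B"
      unfolding I_def using that by (intro ray_mean_bound[OF that(1,5,3) continuous_on_id idb]) auto
    moreover have "norm (V z) \<le> B" using that by auto
    moreover have "norm z * x \<le> 1" if "x \<le> B" "0 \<le> x" for x
      using mult_mono[OF z that(1)] r that by auto
    ultimately show ?thesis by (simp add: norm_mult)
  qed
  have Ic: "continuous_on S (I V)" if "radial S" "continuous_on S V" for S V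
    unfolding I_def by (rule ray_mean_continuous[OF that continuous_on_id])
  have sub1: "norm z \<le> r1" if "z \<in> S" "S \<subseteq> ball 0 r" for z S using that r by auto
  have Nc: "continuous_on S (N V)"
    if S: "radial S" "S \<subseteq> ball 0 r" "continuous_on S V" "\<forall>z\<in>S. norm (V z) \<le> B" for S V
  proof -
    have S0: "S \<subseteq> ball 0 r0" using S r r1 by auto
    have hc: "continuous_on S f" if "f holomorphic_on ball 0 r0" for f
      using that S0 by (meson continuous_on_subset holomorphic_on_imp_continuous_on)
    have dm: "(\<lambda>z. u0 + z * (p + z * I V z)) ` S \<subseteq> ball u0 rg"
      using dom sub1[OF _ S(2)] zV[OF S] by blast
    have ic: "continuous_on S (\<lambda>z. u0 + z * (p + z * I V z))"
      by (intro continuous_intros Ic S)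
    have "continuous_on S (\<lambda>z. g (u0 + z * (p + z * I V z)))"
         "continuous_on S (\<lambda>z. g1 (u0 + z * (p + z * I V z)))"
      using continuous_on_compose2[OF _ ic dm] g1(1) g[folded u0_def]
      by (auto intro: holomorphic_on_imp_continuous_on)
    then show ?thesis unfolding N_def \<Phi>_def
      by (intro continuous_intros hc[OF c1(1)] hc[OF h1(1)] Ic S)
  qed
  have Nh: "N V holomorphic_on ball 0 r"
    if V: "V holomorphic_on ball 0 r" "\<forall>z\<in>ball 0 r. norm (V z) \<le> B" for V
  proof -
    have S0: "ball 0 r \<subseteq> ball 0 r0" using r r1 by auto
    have hc: "f holomorphic_on ball 0 r" if "f holomorphic_on ball 0 r0" for f
      using that S0 by (rule holomorphic_on_subset)
    have Ih: "I V holomorphic_on ball 0 r"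
      unfolding I_def by (rule ray_mean_holomorphic[OF V(1) continuous_on_id])
    have dm: "(\<lambda>z. u0 + z * (p + z * I V z)) ` ball 0 r \<subseteq> ball u0 rg"
      using dom sub1[OF _ subset_refl]
        zV[OF radial_ball subset_refl holomorphic_on_imp_continuous_on[OF V(1)] V(2)] by blast
    have ic: "(\<lambda>z. u0 + z * (p + z * I V z)) holomorphic_on ball 0 r"
      by (intro holomorphic_intros Ih)
    have "(\<lambda>z. g (u0 + z * (p + z * I V z))) holomorphic_on ball 0 r"
         "(\<lambda>z. g1 (u0 + z * (p + z * I V z))) holomorphic_on ball 0 r"
      using holomorphic_on_compose_gen[OF ic _ dm] g1(1) g[folded u0_def] by (auto simp: o_def)
    then show ?thesis unfolding N_def \<Phi>_def
      by (intro holomorphic_intros hc[OF c1(1)] hc[OF h1(1)] Ih V)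
  qed
  define R where "R = complex_of_real ` {-r<..<r}"
  have R: "radial R" "R \<subseteq> ball 0 r"
    unfolding R_def by (rule radial_real, auto)
  define W where "W z = complex_of_real (w (Re z))" for z
  have Wr: "W (of_real y) = of_real (w y)" for y by (simp add: W_def)
  have Wc: "continuous_on R W"
  proof -
    have "continuous_on R (\<lambda>z. w (Re z))"
      by (rule continuous_on_compose2[OF cw]) (use r in \<open>auto simp: R_def intro!: continuous_intros\<close>)
    then show ?thesis unfolding W_def by (rule continuous_on_of_real)
  qed
  have Wb: "\<forall>z\<in>R. norm (W z) \<le> B"
  proof
    fix z assume "z \<in> R"
    then obtain y where y: "z = of_real y" "y \<in> {-r<..<r}" by (auto simp: R_def)
    then have "\<bar>w y\<bar> \<le> Bw" using r by (intro Bw(2)) auto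
    then show "norm (W z) \<le> B" using y B by (simp add: Wr)
  qed
  have IW: "of_real (u y) = u0 + of_real y * (p + of_real y * I W (of_real y))" if y: "\<bar>y\<bar> < r" for y
  proof -
    \<comment> \<open>Taylor's formula with integral remainder along the segment from 0 to
      y.\<close>
    define \<phi> where "\<phi> t = complex_of_real (u (t * y) - u1 0 * (t * y))" for t
    have ty: "\<bar>t * y\<bar> < r0" if "t \<in> {0..1}" for t
      using that y r r1 mult_left_le_one_le[of "\<bar>y\<bar>" t] by (auto simp: abs_mult)
    have "((\<lambda>t. of_real t * W (of_real t * of_real y) * (of_real y)\<^sup>2) has_integral \<phi> 1 - \<phi> 0) {0..1}"
    proof (rule fundamental_theorem_of_calculus)
      fix t :: real assume t: "t \<in> {0..1}"
      have D: "((\<lambda>t. u (t * y) - u1 0 * (t * y)) has_real_derivative (u1 (t * y) * y - u1 0 * y)) (at t)"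
      proof (rule DERIV_diff)
        show "((\<lambda>t. u (t * y)) has_real_derivative u1 (t * y) * y) (at t)"
          by (rule DERIV_chain2[where f = u and g = "\<lambda>t. t * y", OF du[OF ty[OF t]]])
            (auto intro!: derivative_eq_intros)
      qed (auto intro!: derivative_eq_intros)
      have "u1 (t * y) * y - u1 0 * y = t * w (t * y) * y\<^sup>2"
        by (auto simp: w_def power2_eq_square field_simps)
      then have "((\<lambda>t. u (t * y) - u1 0 * (t * y)) has_real_derivative t * w (t * y) * y\<^sup>2) (at t within {0..1})"
        using has_field_derivative_at_within[OF D] by simp
      from has_vector_derivative_of_real[OF this, where ?'a = complex]
      show "(\<phi> has_vector_derivative of_real t * W (of_real t * of_real y) * (of_real y)\<^sup>2) (at t within {0..1})"
        unfolding \<phi>_def[abs_def] of_real_mult[symmetric] Wr by simp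
    qed simp
    then have "integral {0..1} (\<lambda>t. of_real t * W (of_real t * of_real y) * (of_real y)\<^sup>2) = \<phi> 1 - \<phi> 0"
      by (rule integral_unique)
    then have "I W (of_real y) * (of_real y)\<^sup>2 = \<phi> 1 - \<phi> 0"
      unfolding I_def ray_mean_def by simp
    then show ?thesis
      by (simp add: \<phi>_def u0_def p_def power2_eq_square algebra_simps)
  qed
  have NW: "N W (of_real y) = - of_real (u2 y + \<gamma> * w y)" if y: "\<bar>y\<bar> < r" "y \<noteq> 0" for y
  proof -
    let ?z = "complex_of_real y"
    have a: "p + ?z * W ?z = of_real (u1 y)"
      using y by (simp add: Wr w_def p_def)
    have b: "u0 + ?z * (p + ?z * I W ?z) = of_real (u y)" using IW y by simp
    have z: "?z \<noteq> 0" using y by simp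
    have ge: "g (of_real (u y)) = g u0 + ?z * (p + ?z * I W ?z) * g1 (of_real (u y))"
      using g1(2)[of "of_real (u y)"] b by (metis add_diff_cancel_left')
    have o: "?z * of_real (u2 y) + c ?z * of_real (u1 y) + h ?z * g (of_real (u y)) = 0"
      using ode[of y] y r r1 by auto
    \<comment> \<open>The equation at y = 0 cancels the constant terms, so that division by y is
      possible.\<close>
    have o0: "of_real \<gamma> * p + h 0 * g u0 = 0"
      using ode[of 0] r0 c(2) by (simp add: p_def u0_def)
    have "?z * N W ?z = ?z * (c1 ?z * of_real (u1 y) + h1 ?z * g (of_real (u y))
        + h 0 * g1 (of_real (u y)) * (p + ?z * I W ?z))"
      unfolding N_def \<Phi>_def a b ..
    also have "\<dots> = (c ?z - of_real \<gamma>) * of_real (u1 y) + (h ?z - h 0) * g (of_real (u y))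
        + h 0 * (g (of_real (u y)) - g u0)"
      using c1(2)[of ?z] h1(2)[of ?z] c(2) ge by (simp add: algebra_simps)
    also have "\<dots> = - ?z * of_real (u2 y) - of_real \<gamma> * (of_real (u1 y) - p)"
      using o o0 by algebra
    also have "\<dots> = ?z * (- of_real (u2 y + \<gamma> * w y))"
    proof -
      have e: "of_real (u1 y) - p = ?z * of_real (w y)"
        unfolding of_real_mult[symmetric] using y by (simp add: w_def p_def)
      show ?thesis unfolding e by (simp add: algebra_simps)
    qed
    finally show ?thesis using z by simp
  qed
  have TW': "T W (of_real y) = W (of_real y)" if y: "\<bar>y\<bar> < r" "y \<noteq> 0" for y
  proof -
    define \<phi> where "\<phi> t = complex_of_real (t powr (1 + \<gamma>) * w (t * y))" for t
    have ty: "\<bar>t * y\<bar> < r" if "t \<in> {0..1}" for t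
    proof -
      have "\<bar>t * y\<bar> = t * \<bar>y\<bar>" using that by (simp add: abs_mult)
      also have "\<dots> \<le> \<bar>y\<bar>" using that by (intro mult_left_le_one_le) auto
      finally show ?thesis using y(1) by linarith
    qed
    have "((\<lambda>t. - (of_real (k t) * N W (of_real t * of_real y))) has_integral \<phi> 1 - \<phi> 0) {0..1}"
    \<comment> \<open>The derivative of \<open>w\<close> is available only off 0, hence for t > 0;
      at t = 0 continuity of the primitive has to suffice.\<close>
    proof (rule fundamental_theorem_of_calculus_interior)
      have "continuous_on {0..1} (\<lambda>t. t powr (1 + \<gamma>))"
        using \<gamma> by (intro continuous_on_powr') (auto intro!: continuous_intros)
      moreover have "continuous_on {0..1} (\<lambda>t. w (t * y))"
        by (rule continuous_on_compose2[OF cw]) (use ty r in \<open>fastforce intro!: continuous_intros\<close>)+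
      ultimately show "continuous_on {0..1} \<phi>"
        unfolding \<phi>_def by (intro continuous_on_of_real continuous_on_mult)
    next
      fix t :: real assume t: "t \<in> {0<..<1}"
      define x where "x = t * y"
      have x: "x \<noteq> 0" "\<bar>x\<bar> < r" using t y ty[of t] by (auto simp: x_def)
      have "((\<lambda>y. (u1 y - u1 0) / y) has_real_derivative (u2 x - w x) / x) (at x)"
        using du1[of x] x r r1
        by (auto intro!: derivative_eq_intros simp: w_def field_simps)
      moreover have "\<forall>\<^sub>F y in nhds x. (u1 y - u1 0) / y = w y"
        using t1_space_nhds[OF x(1)] by (rule eventually_mono) (simp add: w_def)
      ultimately have dw: "(w has_real_derivative (u2 x - w x) / x) (at x)"
        by (simp add: DERIV_cong_ev[OF refl _ refl])
      have dw': "((\<lambda>t. w (t * y)) has_real_derivative (u2 x - w x) / x * y) (at t)"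
        by (rule DERIV_chain2[where f = w and g = "\<lambda>t. t * y"])
          (use dw in \<open>auto intro!: derivative_eq_intros simp: x_def\<close>)
      have dp: "((\<lambda>t. t powr (1 + \<gamma>)) has_real_derivative (1 + \<gamma>) * t powr \<gamma>) (at t)"
        using has_real_derivative_powr[of t "1 + \<gamma>"] t by simp
      have D: "((\<lambda>t. t powr (1 + \<gamma>) * w (t * y)) has_real_derivative
           (1 + \<gamma>) * t powr \<gamma> * w (t * y) + (u2 x - w x) / x * y * t powr (1 + \<gamma>)) (at t)"
        by (rule DERIV_mult[OF dp dw'])
      have E: "(1 + \<gamma>) * t powr \<gamma> * w (t * y) + (u2 x - w x) / x * y * t powr (1 + \<gamma>)
         = t powr \<gamma> * (u2 x + \<gamma> * w x)"
        using t x y unfolding x_def by (simp add: powr_add field_simps)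
      have kt: "k t = t powr \<gamma>" using t by (simp add: k_def)
      have "- (of_real (k t) * N W (of_real t * of_real y)) = complex_of_real (t powr \<gamma> * (u2 x + \<gamma> * w x))"
      proof -
        have n: "N W (of_real t * of_real y) = - of_real (u2 x + \<gamma> * w x)"
          using NW[OF x(2,1)] unfolding of_real_mult[symmetric] x_def[symmetric] .
        show ?thesis unfolding n kt by (simp del: of_real_add)
      qed
      moreover have "(\<phi> has_vector_derivative complex_of_real (t powr \<gamma> * (u2 x + \<gamma> * w x))) (at t)"
        unfolding \<phi>_def[abs_def]
        by (rule has_vector_derivative_of_real[OF D[unfolded E]])
      ultimately show "(\<phi> has_vector_derivative - (of_real (k t) * N W (of_real t * of_real y))) (at t)"
        by simp
    qed simp
    then have "integral {0..1} (\<lambda>t. - (of_real (k t) * N W (of_real t * of_real y))) = \<phi> 1 - \<phi> 0"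
      by (rule integral_unique)
    then have "T W (of_real y) = \<phi> 1 - \<phi> 0"
      unfolding T_def ray_mean_def by simp
    then show ?thesis by (simp add: \<phi>_def Wr)
  qed
  have TWc: "continuous_on R (T W)"
    unfolding T_def
    by (intro continuous_on_minus ray_mean_continuous[OF R(1) Nc kc] R Wc Wb)
  \<comment> \<open>The fixed point identity was derived by dividing by y; at the origin it follows
    by continuity of both sides.\<close>
  have TW: "\<forall>z\<in>R. T W z = W z"
  proof -
    let ?D = "\<lambda>y. T W (complex_of_real y) - W (of_real y)"
    have "continuous_on {-r<..<r} ?D"
      by (intro continuous_intros continuous_on_compose2[OF TWc] continuous_on_compose2[OF Wc])
        (auto simp: R_def)
    then have "isCont ?D 0"
      using r(1) by (simp add: continuous_on_eq_continuous_at)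
    then have "?D \<midarrow>0\<rightarrow> ?D 0" by (simp add: isCont_def)
    moreover have "?D \<midarrow>0\<rightarrow> 0"
    proof (rule Lim_transform_eventually[OF tendsto_const])
      have "\<forall>\<^sub>F y in at 0. \<bar>y\<bar> < r \<and> y \<noteq> (0::real)"
        unfolding eventually_at using r(1) by (intro exI[of _ r]) auto
      then show "\<forall>\<^sub>F y in at 0. 0 = ?D y" by (rule eventually_mono) (use TW' in auto)
    qed
    ultimately have "?D 0 = 0" by (rule LIM_unique)
    then have "T W (of_real y) = W (of_real y)" if "\<bar>y\<bar> < r" for y
      using TW'[of y] that by (cases "y = 0") auto
    then show ?thesis by (auto simp: R_def)
  qed
  obtain V where V: "V holomorphic_on ball 0 r" "\<forall>z\<in>R. V z = W z"
  proof (rule radial_contraction_holomorphic[of B r T W])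
    show "0 \<le> B" using B by simp
  next
    fix V assume "V holomorphic_on ball 0 r" "\<forall>z\<in>ball 0 r. norm (V z) \<le> B"
    then show "T V holomorphic_on ball 0 r"
      unfolding T_def by (intro holomorphic_on_minus ray_mean_holomorphic[OF Nh kc])
  next
    fix V and z :: complex assume V: "V holomorphic_on ball 0 r" "\<forall>z\<in>ball 0 r. norm (V z) \<le> B" and z: "z \<in> ball 0 r"
    have Vc: "continuous_on (ball 0 r) V" using V(1) by (rule holomorphic_on_imp_continuous_on)
    have "norm (ray_mean k (N V) z) \<le> B0"
    proof (rule ray_mean_bound[OF radial_ball z Nc[OF radial_ball subset_refl Vc V(2)] kc kb])
      fix x :: complex assume x: "x \<in> ball 0 r"
      show "norm (N V x) \<le> B0" unfolding N_def
        using zV[OF radial_ball subset_refl Vc V(2) x] sub1[OF x subset_refl] by (intro \<Phi>_bd) auto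
    qed
    then show "norm (T V z) \<le> B" using B unfolding T_def by simp
  next
    fix S and V V' :: "complex \<Rightarrow> complex" and d z
    assume S: "radial S" "S \<subseteq> ball 0 r" and c: "continuous_on S V" "continuous_on S V'"
      and b: "\<forall>z\<in>S. norm (V z) \<le> B" "\<forall>z\<in>S. norm (V' z) \<le> B"
      and d: "\<forall>z\<in>S. norm (V z - V' z) \<le> d" and z: "z \<in> S"
    have d0: "d \<ge> 0" using d z norm_ge_zero order_trans by blast
    note Nc1 = Nc[OF S c(1) b(1)] and Nc2 = Nc[OF S c(2) b(2)]
    have "norm (ray_mean k (\<lambda>x. N V x - N V' x) z) \<le> d / 2"
    proof (rule ray_mean_bound[OF S(1) z continuous_on_diff[OF Nc1 Nc2] kc kb])
      fix x assume x: "x \<in> S"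
      have nx: "norm x \<le> r" using S(2) x by auto
      have "I V x - I V' x = ray_mean (\<lambda>t. t) (\<lambda>x. V x - V' x) x"
        unfolding I_def by (rule ray_mean_diff[OF S(1) x c continuous_on_id])
      also have "norm \<dots> \<le> d"
        using d by (intro ray_mean_bound[OF S(1) x continuous_on_diff[OF c] continuous_on_id idb]) auto
      finally have i: "norm (x * I V x - x * I V' x) \<le> r * d"
        unfolding right_diff_distrib[symmetric] norm_mult using nx r by (intro mult_mono) auto
      have j: "norm (x * V x - x * V' x) \<le> r * d"
        unfolding right_diff_distrib[symmetric] norm_mult using nx r d x by (intro mult_mono) auto
      have "norm (N V x - N V' x) \<le> K * (norm (x * V x - x * V' x) + norm (x * I V x - x * I V' x))"
        unfolding N_def
        using zV[OF S c(1) b(1) x] zV[OF S c(2) b(2) x] sub1[OF x S(2)] by (intro \<Phi>_lip) auto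
      also have "\<dots> \<le> K * (r * d + r * d)"
        using i j K by (intro mult_left_mono add_mono) auto
      also have "\<dots> = (4 * K * r) * d / 2" by simp
      also have "\<dots> \<le> 1 * d / 2"
        using r(4) d0 by (intro divide_right_mono mult_right_mono) auto
      finally show "norm (N V x - N V' x) \<le> d / 2" by simp
    qed
    then show "norm (T V z - T V' z) \<le> d / 2"
      unfolding T_def ray_mean_diff[OF S(1) z Nc1 Nc2 kc, symmetric]
      by (simp add: norm_minus_commute)
  qed (use Wc Wb TW in \<open>auto simp only: R_def\<close>)
  define U where "U z = u0 + z * (p + z * I V z)" for z
  show ?thesis
  proof (rule that[of r U])
    show "r > 0" "r \<le> r0" using r r1 by auto
    have "I V holomorphic_on ball 0 r"
      unfolding I_def by (rule ray_mean_holomorphic[OF V(1) continuous_on_id])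
    then show "U holomorphic_on ball 0 r"
      unfolding U_def by (intro holomorphic_intros)
    fix y :: real assume y: "\<bar>y\<bar> < r"
    then have yR: "of_real y \<in> R" unfolding R_def by (intro imageI) auto
    have "I V (of_real y) = I W (of_real y)"
      unfolding I_def ray_mean_def
      using R(1) yR V(2) unfolding radial_def by (intro integral_cong) auto
    then show "U (of_real y) = of_real (u y)" using IW[OF y] by (simp add: U_def)
  qed
qed

text \<open>The real parts of the Taylor coefficients serve directly, which avoids proving that the
  coefficients are real.\<close>

lemma holomorphic_real_power_series:
  assumes "U holomorphic_on ball 0 r" "\<And>y. \<bar>y\<bar> < r \<Longrightarrow> U (of_real y) = of_real (u y)"
  obtains a :: "nat \<Rightarrow> real" where "\<And>y. \<bar>y\<bar> < r \<Longrightarrow> (\<lambda>n. a n * y ^ n) sums u y"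
proof
  fix y :: real assume y: "\<bar>y\<bar> < r"
  then have "(\<lambda>n. (deriv ^^ n) U 0 / fact n * (of_real y - 0) ^ n) sums U (of_real y)"
    by (intro holomorphic_power_series[OF assms(1)]) auto
  then have "(\<lambda>n. Re ((deriv ^^ n) U 0 / fact n * of_real y ^ n)) sums Re (U (of_real y))"
    by (intro sums_Re) simp
  moreover have "Re (z * of_real y ^ n) = Re z * y ^ n" for z n
    unfolding of_real_power[symmetric]
    by (simp only: times_complex.sel Re_complex_of_real Im_complex_of_real mult_zero_right diff_zero)
  ultimately have "(\<lambda>n. Re ((deriv ^^ n) U 0 / fact n) * y ^ n) sums Re (U (of_real y))"
    by (simp only:)
  then show "(\<lambda>n. Re ((deriv ^^ n) U 0 / fact n) * y ^ n) sums u y"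
    using assms(2)[OF y] by simp
qed

section \<open>Continuation beyond the light cone and behaviour at infinity\<close>

context profile_ode
begin

text \<open>From a start strictly beyond the cone, exp(2s) - 1 is bounded below, so the first-order
  system is globally Lipschitz and solvable on the half-line.\<close>

lemma exterior_exists:
  assumes s0: "s0 > 0" and lip: "\<And>x y. \<bar>h x - h y\<bar> \<le> K * \<bar>x - y\<bar>" and K: "K \<ge> 0"
  obtains w v z where "w s0 = w0" "v s0 = v0" "continuous_on {s0..} w" "continuous_on {s0..} v"
    "ext_sol h {s0<..} w v z"
proof -
  define e where "e t = exp (2 * (s0 + t)) - 1" for t
  define m where "m = exp (2 * s0) - 1"
  have m: "m > 0" using s0 by (simp add: m_def)
  have e: "e t \<ge> m" if "t \<ge> 0" for t using that by (simp add: e_def m_def)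
  define F where "F t p = (snd p, (- snd p + (h (fst p) - (1 - be) * snd p) / e t))" for t :: real and p :: "real \<times> real"
  have hc: "continuous_on UNIV h"
    unfolding continuous_on_iff
  proof (intro ballI allI impI)
    fix x \<epsilon> :: real assume \<epsilon>: "\<epsilon> > 0"
    have "dist (h y) (h x) < \<epsilon>" if "dist y x < \<epsilon> / (K + 1)" for y
    proof -
      have "\<bar>h y - h x\<bar> \<le> (K + 1) * \<bar>y - x\<bar>" using lip[of y x] by (simp add: algebra_simps)
      also have "\<dots> < \<epsilon>" using that K by (simp add: dist_real_def field_simps)
      finally show ?thesis by (simp add: dist_real_def)
    qed
    then show "\<exists>d>0. \<forall>y\<in>UNIV. dist y x < d \<longrightarrow> dist (h y) (h x) < \<epsilon>"
      using \<epsilon> K by (intro exI[of _ "\<epsilon> / (K + 1)"]) auto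
  qed
  have "\<exists>Y. Y 0 = (w0, v0) \<and> (\<forall>t\<ge>0. (Y has_vector_derivative F t (Y t)) (at t within {0..}))"
  proof (rule lipschitz_ode_global[where L = "2 + (K + 1) / m" and M = "\<bar>h 0\<bar> / m"])
    have "continuous_on ({0..} \<times> UNIV) (\<lambda>q::real \<times> real \<times> real. h (fst (snd q)))"
      by (rule continuous_on_compose2[OF hc]) (auto intro!: continuous_intros)
    then show "continuous_on ({0..} \<times> UNIV) (\<lambda>(t, x). F t x)"
      unfolding F_def case_prod_unfold e_def
      by (intro continuous_intros) (use s0 in auto)
  next
    fix t :: real and q r :: "real \<times> real" assume t: "t \<ge> 0"
    define k where "k = 1 / e t"
    have k: "0 < k" "k \<le> 1 / m" using e[OF t] m unfolding k_def by (auto intro!: divide_left_mono)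
    let ?x = "fst q - fst r" and ?y = "snd q - snd r"
    have xy: "\<bar>?x\<bar> \<le> norm (q - r)" "\<bar>?y\<bar> \<le> norm (q - r)"
    proof -
      have "q - r = (?x, ?y)" by (simp add: prod_eq_iff)
      then show "\<bar>?x\<bar> \<le> norm (q - r)" "\<bar>?y\<bar> \<le> norm (q - r)"
        using norm_fst_le[of ?x ?y] norm_snd_le[of ?y ?x] by simp_all
    qed
    have Fk: "F t p = (snd p, - snd p + k * (h (fst p) - (1 - be) * snd p))" for p
      by (simp add: F_def k_def)
    have "F t q - F t r = (?y, - ?y + k * ((h (fst q) - h (fst r)) - (1 - be) * ?y))"
      unfolding Fk by (simp add: algebra_simps)
    also have "norm \<dots> \<le> \<bar>?y\<bar> + \<bar>- ?y + k * ((h (fst q) - h (fst r)) - (1 - be) * ?y)\<bar>"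
      using norm_Pair_le[of ?y "- ?y + k * ((h (fst q) - h (fst r)) - (1 - be) * ?y)"]
      by (simp only: real_norm_def)
    also have "\<dots> \<le> \<bar>?y\<bar> + (\<bar>?y\<bar> + k * \<bar>(h (fst q) - h (fst r)) - (1 - be) * ?y\<bar>)"
      using abs_triangle_ineq[of "- ?y" "k * ((h (fst q) - h (fst r)) - (1 - be) * ?y)"] k
      by (simp add: abs_mult)
    also have "\<bar>(h (fst q) - h (fst r)) - (1 - be) * ?y\<bar> \<le> K * norm (q - r) + 1 * norm (q - r)"
    proof (rule order_trans[OF abs_triangle_ineq4 add_mono])
      show "\<bar>h (fst q) - h (fst r)\<bar> \<le> K * norm (q - r)"
        by (rule order_trans[OF lip mult_left_mono[OF xy(1) K]])
      show "\<bar>(1 - be) * ?y\<bar> \<le> 1 * norm (q - r)"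
        unfolding abs_mult using be xy by (intro mult_mono) auto
    qed
    then have "k * \<bar>(h (fst q) - h (fst r)) - (1 - be) * ?y\<bar> \<le> (1 / m) * ((K + 1) * norm (q - r))"
      using k K m by (intro mult_mono) (auto simp: algebra_simps)
    finally show "norm (F t q - F t r) \<le> (2 + (K + 1) / m) * norm (q - r)"
      using xy by (simp add: algebra_simps add_divide_distrib)
  next
    fix t :: real assume t: "t \<ge> 0"
    have "norm (F t 0) = \<bar>h 0\<bar> / e t" using e[OF t] m by (simp add: F_def norm_Pair)
    also have "\<dots> \<le> \<bar>h 0\<bar> / m" using e[OF t] m by (intro divide_left_mono mult_pos_pos) auto
    finally show "norm (F t 0) \<le> \<bar>h 0\<bar> / m" .
  qed
  then obtain Y where Y: "Y 0 = (w0, v0)" "\<And>t. t \<ge> 0 \<Longrightarrow> (Y has_vector_derivative F t (Y t)) (at t within {0..})"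
    by blast
  define w v where "w s = fst (Y (s - s0))" and "v s = snd (Y (s - s0))" for s
  define z where "z s = - v s + (h (w s) - (1 - be) * v s) / e (s - s0)" for s
  have Yc: "continuous_on {0..} Y"
    unfolding continuous_on_eq_continuous_within using Y(2) has_vector_derivative_continuous by fastforce
  have Yc': "continuous_on {s0..} (\<lambda>s. Y (s - s0))"
    by (rule continuous_on_compose2[OF Yc]) (auto intro!: continuous_intros)
  show ?thesis
  proof (rule that[of w v z])
    show "w s0 = w0" "v s0 = v0" by (simp_all add: w_def v_def Y)
    show "continuous_on {s0..} w" "continuous_on {s0..} v"
      unfolding w_def v_def by (intro continuous_intros Yc')+
    show "ext_sol h {s0<..} w v z"
      unfolding ext_sol_def
    proof safe
      fix s assume "s0 < s"
      then have s: "s - s0 > 0" by simp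
      have "(Y has_vector_derivative F (s - s0) (Y (s - s0))) (at (s - s0))"
        using Y(2)[of "s - s0"] s by (simp add: at_within_interior[of "s - s0" "{0..}"] interior_Ici[where b = "s - s0 - 1"])
      then have D: "((\<lambda>t. fst (Y t)) has_vector_derivative fst (F (s - s0) (Y (s - s0)))) (at (s - s0))"
          "((\<lambda>t. snd (Y t)) has_vector_derivative snd (F (s - s0) (Y (s - s0)))) (at (s - s0))"
        by (auto intro: bounded_linear.has_vector_derivative[OF bounded_linear_fst]
            bounded_linear.has_vector_derivative[OF bounded_linear_snd])
      have g: "((\<lambda>s. s - s0) has_real_derivative 1) (at s)" by (auto intro!: derivative_eq_intros)
      show "(w has_real_derivative v s) (at s)"
        using DERIV_chain2[where f = "\<lambda>t. fst (Y t)" and g = "\<lambda>s. s - s0",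
            OF D(1)[folded has_real_derivative_iff_has_vector_derivative] g]
        by (simp add: w_def[abs_def] v_def F_def)
      show "(v has_real_derivative z s) (at s)"
        using DERIV_chain2[where f = "\<lambda>t. snd (Y t)" and g = "\<lambda>s. s - s0",
            OF D(2)[folded has_real_derivative_iff_has_vector_derivative] g]
        by (simp add: w_def v_def[abs_def] F_def z_def)
      have "e (s - s0) = exp (2 * s) - 1" by (simp add: e_def)
      moreover have "exp (2 * s) - 1 > 0" using s s0 by simp
      ultimately show "(1 - exp (2 * s)) * z s + (be - exp (2 * s)) * v s + h (w s) = 0"
      proof -
        assume e: "e (s - s0) = exp (2 * s) - 1" and pos: "exp (2 * s) - 1 > 0"
        define X A where "X = exp (2 * s)" and "A = h (w s) - (1 - be) * v s"
        have "X - 1 \<noteq> 0" using pos unfolding X_def by linarith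
        define t where "t = A / (X - 1)"
        have "t * (X - 1) = A" using \<open>X - 1 \<noteq> 0\<close> by (simp add: t_def)
        then have "(1 - X) * (- v s + t) = - (1 - X) * v s - A" by (simp add: algebra_simps)
        then have "(1 - X) * (- v s + A / (X - 1)) = - (1 - X) * v s - A" by (simp only: t_def)
        then show ?thesis unfolding z_def e A_def[symmetric] X_def[symmetric]
          by (simp add: A_def algebra_simps)
      qed
    qed
  qed
qed

text \<open>The equation is not an initial value problem at \<open>s = 0\<close>, so the
  continuation starts from the given solution slightly later. The a priori bound, applied from
  \<open>s = 0\<close> to the glued curve, then keeps \<open>w\<close> where truncated and true
  nonlinearity coincide.\<close>

lemma global_extension:
  obtains \<eta> where "\<eta> > 0" "\<And>\<tau> w v z. \<tau> > 0 \<Longrightarrow> sol {..<\<tau>} w v z \<Longrightarrow> \<bar>w 0 - b\<bar> < \<eta> \<Longrightarrow> \<bar>v 0\<bar> < \<eta> \<Longrightarrow>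
    \<exists>W V Z. sol UNIV W V Z \<and> (\<forall>s<\<tau>. W s = w s) \<and> (\<forall>s\<ge>0. \<bar>W s - b\<bar> < b / 2 \<and> \<bar>V s\<bar> < b / 2)"
proof -
  obtain K where K: "K \<ge> 0" "\<And>x y. \<bar>x\<bar> \<le> 2 * b \<Longrightarrow> \<bar>y\<bar> \<le> 2 * b \<Longrightarrow> \<bar>f x - f y\<bar> \<le> K * \<bar>x - y\<bar>"
    using f_lipschitz by blast
  \<comment> \<open>Clamping is nonexpansive, so the composition with \<open>f\<close> keeps the
    local Lipschitz constant \<open>K\<close> on the whole line.\<close>
  define cl where "cl x = max (b / 2) (min (3 * b / 2) x)" for x
  define h where "h x = f (cl x)" for x
  have clid: "cl x = x" if "\<bar>x - b\<bar> < b / 2" for x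
  proof -
    have "b / 2 \<le> x" "x \<le> 3 * b / 2" using that by linarith+
    then show ?thesis by (simp add: cl_def)
  qed
  have lip: "\<bar>h x - h y\<bar> \<le> K * \<bar>x - y\<bar>" for x y
  proof -
    have "\<bar>h x - h y\<bar> \<le> K * \<bar>cl x - cl y\<bar>"
      unfolding h_def using b by (intro K(2)) (auto simp: cl_def)
    also have "\<dots> \<le> K * \<bar>x - y\<bar>" using K(1) b by (intro mult_left_mono) (auto simp: cl_def)
    finally show ?thesis .
  qed
  have hb: "h b = 0" using clid[of b] b by (simp add: h_def)
  obtain C where C: "C > 0" "\<And>h w v z \<eta> s. \<lbrakk>\<And>x y. \<bar>h x - h y\<bar> \<le> K * \<bar>x - y\<bar>; h b = 0; ext_sol h {0<..} w v z;
      continuous_on {0..} w; continuous_on {0..} v; h (w 0) = (1 - be) * v 0;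
      \<bar>w 0 - b\<bar> < \<eta>; \<bar>v 0\<bar> < \<eta>; s \<ge> 0\<rbrakk> \<Longrightarrow> \<bar>w s - b\<bar> < C * \<eta> \<and> \<bar>v s\<bar> < C * \<eta>"
    using exterior_bound[OF K(1)] by blast
  define \<eta> where "\<eta> = min (b / 2) (b / 2 / C)"
  have \<eta>: "\<eta> > 0" "\<eta> \<le> b / 2" "C * \<eta> \<le> b / 2"
  proof -
    show "\<eta> > 0" "\<eta> \<le> b / 2" using b C(1) by (auto simp: \<eta>_def)
    have "\<eta> \<le> b / 2 / C" by (simp add: \<eta>_def)
    then show "C * \<eta> \<le> b / 2" using C(1) by (simp add: field_simps)
  qed
  have "\<exists>W V Z. sol UNIV W V Z \<and> (\<forall>s<\<tau>. W s = w s) \<and> (\<forall>s\<ge>0. \<bar>W s - b\<bar> < b / 2 \<and> \<bar>V s\<bar> < b / 2)"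
    if \<tau>: "\<tau> > 0" and S: "sol {..<\<tau>} w v z" and init: "\<bar>w 0 - b\<bar> < \<eta>" "\<bar>v 0\<bar> < \<eta>" for \<tau> w v z
  proof -
    have dw: "(w has_real_derivative v s) (at s)" and dv: "(v has_real_derivative z s) (at s)"
      and ode: "(1 - exp (2 * s)) * z s + (be - exp (2 * s)) * v s + f (w s) = 0" if "s < \<tau>" for s
      using S that by (auto simp: sol_def)
    have "isCont (\<lambda>s. \<bar>w s - b\<bar>) 0" using DERIV_isCont[OF dw] \<tau> by (intro continuous_intros) auto
    moreover have "\<bar>w 0 - b\<bar> < b / 2" using init(1) \<eta> by linarith
    ultimately have "\<forall>\<^sub>F s in at 0. \<bar>w s - b\<bar> < b / 2"
      unfolding isCont_def by (rule order_tendstoD(2))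
    then obtain d where d: "d > 0" "\<And>s. s \<noteq> 0 \<Longrightarrow> \<bar>s\<bar> < d \<Longrightarrow> \<bar>w s - b\<bar> < b / 2"
      unfolding eventually_at by (auto simp: dist_real_def)
    \<comment> \<open>Up to \<open>s1\<close> the given solution stays in the unclamped range and
      solves the truncated equation; starting the new solution at half of it leaves an overlap for
      gluing.\<close>
    define s1 where "s1 = min d \<tau>"
    define s0 where "s0 = s1 / 2"
    have s1: "0 < s0" "s0 < s1" "s1 \<le> \<tau>" using d \<tau> by (auto simp: s1_def s0_def)
    have near: "\<bar>w s - b\<bar> < b / 2" if "0 < s" "s < s1" for s using d(2)[of s] that by (auto simp: s1_def)
    obtain w' v' z' where E: "w' s0 = w s0" "v' s0 = v s0" "continuous_on {s0..} w'" "continuous_on {s0..} v'"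
      "ext_sol h {s0<..} w' v' z'"
      by (rule exterior_exists[OF s1(1) lip K(1)])
    have dw': "(w' has_real_derivative v' s) (at s)" and dv': "(v' has_real_derivative z' s) (at s)"
      and ode': "(1 - exp (2 * s)) * z' s + (be - exp (2 * s)) * v' s + h (w' s) = 0" if "s0 < s" for s
      using E(5) that by (auto simp: ext_sol_def)
    have cw: "continuous_on {s..t} w" and cv: "continuous_on {s..t} v" if "t < \<tau>" for s t
      by (intro continuous_at_imp_continuous_on ballI DERIV_isCont[OF dw] DERIV_isCont[OF dv]; use that in simp)+
    have agree: "w s = w' s \<and> v s = v' s" if s: "s0 \<le> s" "s < s1" for s
    proof -
      have "ext_sol h {s0<..<s} w v z"
        unfolding ext_sol_def
      proof (intro ballI conjI)
        fix x assume x: "x \<in> {s0<..<s}"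
        then have "h (w x) = f (w x)" using clid[OF near[of x]] s s1 by (simp add: h_def)
        then show "(1 - exp (2 * x)) * z x + (be - exp (2 * x)) * v x + h (w x) = 0"
          using ode[of x] x s s1 by simp
      qed (use dw dv s s1 in auto)
      moreover have "ext_sol h {s0<..<s} w' v' z'" using E(5) by (auto simp: ext_sol_def)
      moreover have "continuous_on {s0..s} w" "continuous_on {s0..s} v" using cw cv s s1 by auto
      moreover have "continuous_on {s0..s} w'" "continuous_on {s0..s} v'"
        using E(3,4) by (auto intro: continuous_on_subset)
      ultimately show ?thesis
        using ext_sol_unique[OF s1(1) s(1), of h w v z w' v' z' K] lip K(1) E(1,2) by simp
    qed
    define W V Z where "W s = (if s < s1 then w s else w' s)" and "V s = (if s < s1 then v s else v' s)"
      and "Z s = (if s < s1 then z s else z' s)" for s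
    have W': "W s = w' s" "V s = v' s" if "s0 < s" for s
      using agree[of s] that by (auto simp: W_def V_def)
    have dW: "(W has_real_derivative V s) (at s)" and dV: "(V has_real_derivative Z s) (at s)" for s
    proof -
      show "(W has_real_derivative V s) (at s)"
      proof (cases "s < s1")
        case True
        then have "(w has_real_derivative V s) (at s)" using dw[of s] s1 by (simp add: V_def)
        then show ?thesis
          by (rule has_field_derivative_transform_within_open[of _ _ _ "{..<s1}"]) (use True in \<open>auto simp: W_def\<close>)
      next
        case False
        then have "(w' has_real_derivative V s) (at s)" using dw'[of s] s1 by (simp add: V_def)
        then show ?thesis
          by (rule has_field_derivative_transform_within_open[of _ _ _ "{s0<..}"]) (use False s1 W' in auto)
      qed
      show "(V has_real_derivative Z s) (at s)"
      proof (cases "s < s1")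
        case True
        then have "(v has_real_derivative Z s) (at s)" using dv[of s] s1 by (simp add: Z_def)
        then show ?thesis
          by (rule has_field_derivative_transform_within_open[of _ _ _ "{..<s1}"]) (use True in \<open>auto simp: V_def\<close>)
      next
        case False
        then have "(v' has_real_derivative Z s) (at s)" using dv'[of s] s1 by (simp add: Z_def)
        then show ?thesis
          by (rule has_field_derivative_transform_within_open[of _ _ _ "{s0<..}"]) (use False s1 W' in auto)
      qed
    qed
    have extW: "ext_sol h {0<..} W V Z"
      unfolding ext_sol_def
    proof (intro ballI conjI dW dV)
      fix s :: real assume s: "s \<in> {0<..}"
      show "(1 - exp (2 * s)) * Z s + (be - exp (2 * s)) * V s + h (W s) = 0"
      proof (cases "s < s1")
        case True
        then have "h (w s) = f (w s)" using clid[OF near[of s]] s by (simp add: h_def)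
        then show ?thesis using ode[of s] True s1 by (simp add: W_def V_def Z_def)
      next
        case False
        then show ?thesis using ode'[of s] s1 by (simp add: W_def V_def Z_def)
      qed
    qed
    have cW: "continuous_on A W" "continuous_on A V" for A
      by (intro continuous_at_imp_continuous_on ballI DERIV_isCont[OF dW] DERIV_isCont[OF dV])+
    have W0: "W 0 = w 0" "V 0 = v 0" using s1 by (auto simp: W_def V_def)
    \<comment> \<open>The compatibility condition for the truncated equation is inherited from the
      original one.\<close>
    have "h (w 0) = f (w 0)" using clid[of "w 0"] init(1) \<eta>(2) by (simp add: h_def)
    then have compat: "h (W 0) = (1 - be) * V 0" using ode[of 0] \<tau> unfolding W0 by (simp add: algebra_simps)
    have bd: "\<bar>W s - b\<bar> < b / 2" "\<bar>V s\<bar> < b / 2" if "s \<ge> 0" for s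
      using C(2)[OF lip hb extW cW compat _ _ that, of \<eta>] init \<eta>(3) unfolding W0 by auto
    have solW: "sol UNIV W V Z"
      unfolding sol_def
    proof (intro ballI conjI dW dV)
      fix s :: real
      show "(1 - exp (2 * s)) * Z s + (be - exp (2 * s)) * V s + f (W s) = 0"
      proof (cases "s < s1")
        case True
        then show ?thesis using ode[of s] s1 by (simp add: W_def V_def Z_def)
      next
        case False
        then have s: "s > 0" using s1 by simp
        then have "(1 - exp (2 * s)) * Z s + (be - exp (2 * s)) * V s + h (W s) = 0"
          using extW unfolding ext_sol_def by simp
        moreover have "h (W s) = f (W s)" using clid[OF bd(1)[of s]] s by (simp add: h_def)
        ultimately show ?thesis by simp
      qed
    qed
    \<comment> \<open>On the rest of the original interval \<open>w\<close> need not be near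
      \<open>b\<close>; uniqueness is applied to \<open>f\<close> itself, with a Lipschitz constant
      for the range of both curves up to \<open>s\<close>.\<close>
    have "W s = w s" if s: "s < \<tau>" for s
    proof (cases "s < s1")
      case False
      then have s0s: "s0 \<le> s" using s1 by simp
      have "bounded (w ` {s0..s})" by (intro compact_imp_bounded compact_continuous_image cw s) auto
      then obtain M where M: "\<forall>x\<in>{s0..s}. \<bar>w x\<bar> \<le> M" by (auto simp: bounded_iff)
      define M' where "M' = max M (2 * b)"
      obtain K' where K': "K' \<ge> 0" "\<And>x y. \<bar>x\<bar> \<le> M' \<Longrightarrow> \<bar>y\<bar> \<le> M' \<Longrightarrow> \<bar>f x - f y\<bar> \<le> K' * \<bar>x - y\<bar>"
        using f_lipschitz by blast
      have "ext_sol f {s0<..<s} W V Z" "ext_sol f {s0<..<s} w v z"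
        using solW S s by (auto simp: ext_sol_def sol_def)
      moreover have "\<bar>f (W x) - f (w x)\<bar> \<le> K' * \<bar>W x - w x\<bar>" if "x \<in> {s0<..<s}" for x
      proof (rule K'(2))
        have "\<bar>W x - b\<bar> < b / 2" using bd(1)[of x] that s1 by auto
        then have "\<bar>W x\<bar> \<le> 2 * b" using b by linarith
        then show "\<bar>W x\<bar> \<le> M'" by (simp add: M'_def)
        show "\<bar>w x\<bar> \<le> M'" using M[rule_format, of x] that by (auto simp: M'_def)
      qed
      moreover have "W s0 = w s0" "V s0 = v s0" using s1 by (auto simp: W_def V_def)
      ultimately show ?thesis
        using ext_sol_unique(1)[OF s1(1) s0s, of f W V Z w v z K'] K'(1) cW cw[OF s] cv[OF s] by simp
    qed (simp add: W_def)
    then show ?thesis using solW bd by blast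
  qed
  then show ?thesis using that \<eta>(1) by blast
qed

text \<open>The derivative of exp(s) V is exp(s)(V + Z), of size exp(-s), so exp(s) V is bounded.
  Then V is integrable and W converges, to a limit of at least b / 2.\<close>

lemma asymptotics_at_infinity:
  assumes S: "sol UNIV W V Z" and bd: "\<And>s. s \<ge> 0 \<Longrightarrow> \<bar>W s - b\<bar> < b / 2 \<and> \<bar>V s\<bar> < b / 2"
  obtains L where "L > 0" "(W \<longlongrightarrow> L) at_top" "(V \<longlongrightarrow> 0) at_top"
proof -
  have dW: "(W has_real_derivative V s) (at s)" and dV: "(V has_real_derivative Z s) (at s)" for s
    using S by (auto simp: sol_def)
  have zeq: "Z s = - V s + (f (W s) - (1 - be) * V s) / (exp (2 * s) - 1)" if "s > 0" for s
    using ext_sol_z[of f UNIV W V Z s] S that by (simp add: ext_sol_f)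
  obtain K where K: "K \<ge> 0" "\<And>x y. \<bar>x\<bar> \<le> 2 * b \<Longrightarrow> \<bar>y\<bar> \<le> 2 * b \<Longrightarrow> \<bar>f x - f y\<bar> \<le> K * \<bar>x - y\<bar>"
    using f_lipschitz by blast
  have Wb: "\<bar>W s\<bar> \<le> 2 * b" "\<bar>W s - b\<bar> \<le> b" "\<bar>V s\<bar> \<le> b" if "s \<ge> 0" for s
  proof -
    have "\<bar>W s - b\<bar> < b / 2" "\<bar>V s\<bar> < b / 2" using bd[OF that] by auto
    then show "\<bar>W s\<bar> \<le> 2 * b" "\<bar>W s - b\<bar> \<le> b" "\<bar>V s\<bar> \<le> b" using b by linarith+
  qed
  define D where "D = 2 * ((K + 1) * b)"
  have D: "D \<ge> 0" using K b by (simp add: D_def)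
  have e1: "exp (2 * s) \<le> 2 * (exp (2 * s) - 1)" if "s \<ge> 1" for s :: real
  proof -
    have "2 \<le> exp (2 * s)" using exp_ge_add_one_self[of "2 * s"] that by linarith
    then show ?thesis by simp
  qed
  have h: "\<bar>V s + Z s\<bar> * exp s \<le> D * exp (- s)" if s: "s \<ge> 1" for s
  proof -
    define q where "q = 1 / (exp (2 * s) - 1)"
    have q0: "exp (2 * s) - 1 > 0" using s by simp
    have q: "q > 0" "q \<le> 2 * exp (- 2 * s)"
      using e1[OF s] q0 by (auto simp: q_def exp_minus field_simps)
    have "\<bar>f (W s) - f b\<bar> \<le> K * \<bar>W s - b\<bar>"
      using Wb(1)[of s] s b by (intro K(2)) auto
    also have "\<dots> \<le> K * b" using Wb(2)[of s] s K by (intro mult_left_mono) auto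
    finally have "\<bar>f (W s)\<bar> \<le> K * b" by simp
    moreover have "\<bar>(1 - be) * V s\<bar> \<le> 1 * b" unfolding abs_mult using be Wb(3)[of s] s b by (intro mult_mono) auto
    ultimately have n: "\<bar>f (W s) - (1 - be) * V s\<bar> \<le> (K + 1) * b"
      using abs_triangle_ineq4[of "f (W s)" "(1 - be) * V s"] by (simp add: algebra_simps)
    have "V s + Z s = q * (f (W s) - (1 - be) * V s)" using zeq[of s] s by (simp add: q_def)
    then have "\<bar>V s + Z s\<bar> = q * \<bar>f (W s) - (1 - be) * V s\<bar>" using q by (simp add: abs_mult)
    also have "\<dots> \<le> 2 * exp (- 2 * s) * ((K + 1) * b)" using q n by (intro mult_mono) auto
    finally have "\<bar>V s + Z s\<bar> * exp s \<le> 2 * exp (- 2 * s) * ((K + 1) * b) * exp s"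
      by (rule mult_right_mono) simp
    also have "\<dots> = D * (exp (- 2 * s) * exp s)" by (simp add: D_def)
    also have "exp (- 2 * s) * exp s = exp (- s)" by (simp flip: exp_add)
    finally show ?thesis .
  qed
  \<comment> \<open>Bounds the value at s = 1 of the decreasing function used below, with |V(1)|
    \<le> b.\<close>
  define G where "G = exp 1 * b + D"
  have Vdecay: "\<bar>V s\<bar> \<le> G * exp (- s)" if s: "s \<ge> 1" for s
  proof -
    have bound: "\<epsilon> * (exp s * V s) \<le> G" if \<epsilon>: "\<epsilon> = 1 \<or> \<epsilon> = -1" for \<epsilon>
    proof -
      have "\<epsilon> * (exp s * V s) + D * exp (- s) \<le> \<epsilon> * (exp 1 * V 1) + D * exp (- 1)"
      proof (rule antimono_by_deriv[OF s, of "\<lambda>s. \<epsilon> * (exp s * V s) + D * exp (- s)"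
            "\<lambda>s. \<epsilon> * (exp s * (V s + Z s)) - D * exp (- s)"])
        show d: "((\<lambda>s. \<epsilon> * (exp s * V s) + D * exp (- s)) has_real_derivative
            \<epsilon> * (exp s * (V s + Z s)) - D * exp (- s)) (at s)" for s
          by (rule derivative_eq_intros dV refl | simp)+ (simp add: algebra_simps)
        show "continuous_on {1..s} (\<lambda>s. \<epsilon> * (exp s * V s) + D * exp (- s))"
          by (intro continuous_at_imp_continuous_on ballI DERIV_isCont[OF d])
        fix x assume x: "1 < x" "x < s"
        have "\<epsilon> * (exp x * (V x + Z x)) \<le> \<bar>V x + Z x\<bar> * exp x"
          using \<epsilon> by (auto simp: mult.commute[of "exp x"] intro!: mult_right_mono)
        then show "\<epsilon> * (exp x * (V x + Z x)) - D * exp (- x) \<le> 0" using h[of x] x by linarith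
      qed
      moreover have "0 \<le> D * exp (- s)" using D by simp
      moreover have "D * exp (- 1) \<le> D * 1" using D by (intro mult_left_mono) auto
      moreover have "\<epsilon> * (exp 1 * V 1) \<le> exp 1 * b"
      proof -
        have "\<epsilon> * V 1 \<le> b" using \<epsilon> Wb(3)[of 1] by auto
        then have "exp 1 * (\<epsilon> * V 1) \<le> exp 1 * b" by (intro mult_left_mono) auto
        then show ?thesis by (simp add: mult_ac)
      qed
      ultimately show ?thesis unfolding G_def by linarith
    qed
    have "exp s * \<bar>V s\<bar> \<le> G" using bound[of 1] bound[of "-1"] by (auto simp: abs_if)
    then show ?thesis by (simp add: exp_minus field_simps)
  qed
  have em: "((\<lambda>s::real. exp (- s)) \<longlongrightarrow> 0) at_top"
    by (rule filterlim_compose[OF exp_at_bot filterlim_uminus_at_bot_at_top])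
  have V0: "(V \<longlongrightarrow> 0) at_top"
  proof (rule Lim_null_comparison)
    have "\<forall>\<^sub>F s in at_top. s \<ge> (1::real)" by (rule eventually_ge_at_top)
    then show "\<forall>\<^sub>F s in at_top. norm (V s) \<le> G * exp (- s)" by eventually_elim (use Vdecay in auto)
    show "((\<lambda>s. G * exp (- s)) \<longlongrightarrow> 0) at_top" using tendsto_mult[OF tendsto_const[of G] em] by simp
  qed
  have G0: "G \<ge> 0" using b D by (simp add: G_def)
  \<comment> \<open>The correction makes \<open>W\<close> nondecreasing: its derivative is V + G
    exp(-s) \<ge> 0.\<close>
  obtain L where L: "((\<lambda>s. W s - G * exp (- s)) \<longlongrightarrow> L) at_top"
  proof (rule tendsto_mono_bounded_at_top[of 1 "\<lambda>s. W s - G * exp (- s)" "2 * b"])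
    fix s t :: real assume st: "1 \<le> s" "s \<le> t"
    have d: "((\<lambda>s. - (W s - G * exp (- s))) has_real_derivative - (V x + G * exp (- x))) (at x)" for x
      by (rule derivative_eq_intros dW refl | simp)+
    have "- (W t - G * exp (- t)) \<le> - (W s - G * exp (- s))"
    proof (rule antimono_by_deriv[OF st(2) _ d])
      show "continuous_on {s..t} (\<lambda>s. - (W s - G * exp (- s)))"
        by (intro continuous_at_imp_continuous_on ballI DERIV_isCont[OF d])
      fix x assume "s < x" "x < t"
      then have "\<bar>V x\<bar> \<le> G * exp (- x)" using st by (intro Vdecay) auto
      then show "- (V x + G * exp (- x)) \<le> 0" by linarith
    qed
    then show "W s - G * exp (- s) \<le> W t - G * exp (- t)" by simp
  next
    fix s :: real assume "1 \<le> s"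
    then have "W s \<le> 2 * b" using Wb(1)[of s] by auto
    moreover have "0 \<le> G * exp (- s)" using G0 by simp
    ultimately show "W s - G * exp (- s) \<le> 2 * b" by linarith
  qed
  have WL: "(W \<longlongrightarrow> L) at_top"
    using tendsto_add[OF L tendsto_mult[OF tendsto_const[of G] em]] by simp
  have "b / 2 \<le> L"
  proof (rule tendsto_lowerbound[OF WL])
    have "\<forall>\<^sub>F s in at_top. s \<ge> (0::real)" by (rule eventually_ge_at_top)
    then show "\<forall>\<^sub>F s in at_top. b / 2 \<le> W s"
      by eventually_elim (use bd in \<open>fastforce simp: abs_if split: if_splits\<close>)
  qed simp
  then have "L > 0" using b by linarith
  then show ?thesis using that WL V0 by blast
qed

end

section \<open>Regularity and conclusion\<close>

lemma holomorphic_real_derivative: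
  assumes U: "U holomorphic_on ball 0 r" "\<And>y. \<bar>y\<bar> < r \<Longrightarrow> U (of_real y) = of_real (u y)" and y: "\<bar>y\<bar> < r"
    and d: "(u has_real_derivative d) (at y)"
  shows "deriv U (of_real y) = of_real d"
proof -
  have "(U has_field_derivative deriv U (of_real y)) (at (of_real y))"
    by (rule holomorphic_derivI[OF U(1) open_ball]) (use y in auto)
  then have "((\<lambda>y. U (of_real y)) has_vector_derivative deriv U (of_real y)) (at y)"
    by (rule has_vector_derivative_real_field)
  then have "((\<lambda>y. complex_of_real (u y)) has_vector_derivative deriv U (of_real y)) (at y)"
    by (rule has_vector_derivative_transform_within_open[of _ _ _ "{-r<..<r}"]) (use U(2) y in auto)
  moreover have "((\<lambda>y. complex_of_real (u y)) has_vector_derivative of_real d) (at y)"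
    by (rule has_vector_derivative_of_real[OF d])
  ultimately show ?thesis by (rule vector_derivative_unique_at)
qed

lemma C2_on_openD:
  assumes "C2_on S u" "open S"
  obtains u1 u2 where "\<And>x. x \<in> S \<Longrightarrow> (u has_real_derivative u1 x) (at x)"
    "\<And>x. x \<in> S \<Longrightarrow> (u1 has_real_derivative u2 x) (at x)" "continuous_on S u2"
proof -
  obtain u1 u2 where "\<forall>x\<in>S. (u has_real_derivative u1 x) (at x within S)"
     "\<forall>x\<in>S. (u1 has_real_derivative u2 x) (at x within S)" "continuous_on S u2"
    using assms(1) by (auto simp: C2_on_def)
  then show ?thesis using that[of u1 u2] assms(2) by (simp add: at_within_open[OF _ assms(2)])
qed

lemma deriv_deriv_on_open:
  assumes "open S" "\<And>x. x \<in> S \<Longrightarrow> (u has_real_derivative u1 x) (at x)"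
    "\<And>x. x \<in> S \<Longrightarrow> (u1 has_real_derivative u2 x) (at x)" "x \<in> S"
  shows "deriv u x = u1 x" "deriv (deriv u) x = u2 x"
proof -
  have 1: "deriv u y = u1 y" if "y \<in> S" for y using assms(2)[OF that] by (rule DERIV_imp_deriv)
  then show "deriv u x = u1 x" using assms(4) .
  have "(deriv u has_real_derivative u2 x) (at x)"
    using assms(3)[OF assms(4)] assms(1,4)
    by (rule has_field_derivative_transform_within_open) (simp add: 1)
  then show "deriv (deriv u) x = u2 x" by (rule DERIV_imp_deriv)
qed

text \<open>Only the centre needs an argument. The one-sided expansion at 0 defines a function on a
  full neighbourhood that can be differentiated term by term, and its derivatives continue those of
  \<open>u\<close> to the endpoint.\<close>

lemma real_analytic_imp_C2_on:
  assumes an: "real_analytic_on {0..<r} u" and C2: "C2_on {0<..<r} u" and r: "r > 0"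
  shows "C2_on {0..<r} u"
proof -
  obtain u1 u2 where u: "\<And>x. x \<in> {0<..<r} \<Longrightarrow> (u has_real_derivative u1 x) (at x)"
    "\<And>x. x \<in> {0<..<r} \<Longrightarrow> (u1 has_real_derivative u2 x) (at x)" and cu2: "continuous_on {0<..<r} u2"
    using C2_on_openD[OF C2] by auto
  obtain e' a where e': "e' > 0" "\<And>y. y \<in> {0..<r} \<Longrightarrow> \<bar>y - 0\<bar> < e' \<Longrightarrow> (\<lambda>n. a n * (y - 0) ^ n) sums u y"
    using an r unfolding real_analytic_on_def by (metis atLeastLessThan_iff order_refl)
  define e where "e = min e' r"
  have e: "e > 0" "e \<le> r" using e' r by (auto simp: e_def)
  have su: "(\<lambda>n. a n * y ^ n) sums u y" if "0 \<le> y" "y < e" for y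
    using e'(2)[of y] that by (auto simp: e_def)
  define P where "P c x = (\<Sum>n. c n * x ^ n)" for c :: "nat \<Rightarrow> real" and x
  \<comment> \<open>The expansion is known only at nonnegative points; convergence at a larger
    positive point gives it for both signs.\<close>
  have sa: "summable (\<lambda>n. a n * x ^ n)" if "norm x < e" for x
  proof -
    have "summable (\<lambda>n. a n * ((norm x + e) / 2) ^ n)"
      using su[of "(norm x + e) / 2"] that norm_ge_zero[of x] by (auto simp: sums_iff simp del: norm_ge_zero real_norm_def)
    then show ?thesis by (rule powser_inside) (use that in auto)
  qed
  have sd: "summable (\<lambda>n. diffs c n * x ^ n)" if "\<And>x. norm x < e \<Longrightarrow> summable (\<lambda>n. c n * x ^ n)" "norm x < e"
    for c :: "nat \<Rightarrow> real" and x
    using termdiff_converges[OF that(2,1)] .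
  have dP: "(P c has_real_derivative P (diffs c) x) (at x)"
    if c: "\<And>x. norm x < e \<Longrightarrow> summable (\<lambda>n. c n * x ^ n)" and x: "\<bar>x\<bar> < e" for c x
    unfolding P_def[abs_def]
    by (rule termdiffs_strong[of c "(\<bar>x\<bar> + e) / 2"]) (use x in \<open>auto intro!: c\<close>)
  note s1 = sd[OF sa] and s2 = sd[OF sd[OF sa]]
  have uP: "u x = P a x" if "0 \<le> x" "x < e" for x using su[OF that] by (simp add: P_def sums_iff)
  have u1P: "u1 x = P (diffs a) x" if "0 < x" "x < e" for x
  proof (rule DERIV_unique)
    show "(u has_real_derivative u1 x) (at x)" using u(1) that e by auto
    have "(P a has_real_derivative P (diffs a) x) (at x)" by (rule dP[OF sa]) (use that in auto)
    then show "(u has_real_derivative P (diffs a) x) (at x)"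
      by (rule has_field_derivative_transform_within_open[of _ _ _ "{0<..<e}"]) (use that uP in auto)
  qed
  have u2P: "u2 x = P (diffs (diffs a)) x" if "0 < x" "x < e" for x
  proof (rule DERIV_unique)
    show "(u1 has_real_derivative u2 x) (at x)" using u(2) that e by auto
    have "(P (diffs a) has_real_derivative P (diffs (diffs a)) x) (at x)" by (rule dP[OF s1]) (use that in auto)
    then show "(u1 has_real_derivative P (diffs (diffs a)) x) (at x)"
      by (rule has_field_derivative_transform_within_open[of _ _ _ "{0<..<e}"]) (use that u1P in auto)
  qed
  \<comment> \<open>The derivatives obtained on the open interval are arbitrary at 0 and receive
    there the values from the series.\<close>
  define w1 w2 where "w1 x = (if x = 0 then P (diffs a) 0 else u1 x)"
    and "w2 x = (if x = 0 then P (diffs (diffs a)) 0 else u2 x)" for x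
  have near0: "(g has_real_derivative P (diffs c) 0) (at 0 within {0..<r})"
    if "\<And>x. norm x < e \<Longrightarrow> summable (\<lambda>n. c n * x ^ n)" "\<And>x. 0 \<le> x \<Longrightarrow> x < e \<Longrightarrow> g x = P c x" for c g
    by (rule has_field_derivative_transform_within[OF has_field_derivative_at_within[OF dP[OF that(1)]] e(1)])
      (use that e in \<open>auto simp: dist_real_def\<close>)
  have w1P: "w1 x = P (diffs a) x" and w2P: "w2 x = P (diffs (diffs a)) x" if "0 \<le> x" "x < e" for x
    using u1P[of x] u2P[of x] that by (auto simp: w1_def w2_def)
  have "(u has_real_derivative w1 x) (at x within {0..<r})" if x: "x \<in> {0..<r}" for x
  proof (cases "x = 0")
    case True then show ?thesis using near0[OF sa uP] by (simp add: w1_def)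
  next
    case False
    then show ?thesis using u(1)[of x] x by (auto simp: w1_def intro: has_field_derivative_at_within)
  qed
  moreover have "(w1 has_real_derivative w2 x) (at x within {0..<r})" if x: "x \<in> {0..<r}" for x
  proof (cases "x = 0")
    case True then show ?thesis using near0[OF s1 w1P] by (simp add: w2_def)
  next
    case False
    then have "(u1 has_real_derivative w2 x) (at x)" using u(2)[of x] x by (simp add: w2_def)
    then have "(w1 has_real_derivative w2 x) (at x)"
      by (rule has_field_derivative_transform_within_open[of _ _ _ "{0<..}"]) (use False x in \<open>auto simp: w1_def\<close>)
    then show ?thesis by (rule has_field_derivative_at_within)
  qed
  moreover have "continuous_on {0..<r} w2"
    unfolding continuous_on_eq_continuous_within
  proof
    fix x assume x: "x \<in> {0..<r}"
    show "continuous (at x within {0..<r}) w2"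
    proof (cases "x = 0")
      case True
      then show ?thesis using near0[OF s2 w2P] by (auto intro: DERIV_continuous)
    next
      case False
      then have "isCont u2 x" using cu2 x by (simp add: continuous_on_eq_continuous_at)
      moreover have "\<forall>\<^sub>F y in nhds x. w2 y = u2 y"
        using t1_space_nhds[OF False] by (rule eventually_mono) (simp add: w2_def)
      ultimately have "isCont w2 x" by (metis isCont_cong)
      then show ?thesis by (rule continuous_at_imp_continuous_within)
    qed
  qed
  ultimately show ?thesis unfolding C2_on_def by blast
qed

section \<open>Return to the radial variable; analyticity of positive solutions\<close>

context profile_ode
begin

definition ode_at :: "(real \<Rightarrow> real) \<Rightarrow> (real \<Rightarrow> real) \<Rightarrow> (real \<Rightarrow> real) \<Rightarrow> real \<Rightarrow> bool" where
  "ode_at u u1 u2 r \<longleftrightarrow> (u has_real_derivative u1 r) (at r) \<and> (u1 has_real_derivative u2 r) (at r) \<and>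
     (1 - r\<^sup>2) * u2 r + ((1 + 2 * al + be) / r - 2 * (al + 1) * r) * u1 r
       - al * (al + 1) * u r + \<bar>u r\<bar> powr (p - 1) * u r = 0"

lemma power_form_deriv:
  assumes "r > 0" "(G has_real_derivative G' (ln r)) (at (ln r))"
  shows "((\<lambda>r. r powr c * G (ln r)) has_real_derivative r powr (c - 1) * (c * G (ln r) + G' (ln r))) (at r)"
proof -
  have "((\<lambda>r. G (ln r)) has_real_derivative G' (ln r) * (1 / r)) (at r)"
    by (rule DERIV_chain2[where f = G and g = ln, OF assms(2)])
      (use assms(1) in \<open>auto intro!: derivative_eq_intros\<close>)
  from DERIV_mult[OF has_real_derivative_powr[OF assms(1), of c] this]
  have "((\<lambda>r. r powr c * G (ln r)) has_real_derivative
      c * r powr (c - 1) * G (ln r) + G' (ln r) * (1 / r) * r powr c) (at r)" .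
  moreover have "r powr c = r powr (c - 1) * r" using assms(1) by (simp add: powr_diff)
  then have "c * r powr (c - 1) * G (ln r) + G' (ln r) * (1 / r) * r powr c
      = r powr (c - 1) * (c * G (ln r) + G' (ln r))"
    using assms(1) by (simp add: algebra_simps)
  ultimately show ?thesis by simp
qed

text \<open>The inverse change of variables. The explicit first derivative shows that \<rho>^(al+1)
  u' is V - al W, which yields the second limit of the asymptotics.\<close>

lemma sol_imp_ode_at:
  assumes S: "sol UNIV W V Z" and r: "r > 0"
  shows "ode_at (\<lambda>r. r powr (- al) * W (ln r)) (\<lambda>r. r powr (- al - 1) * (V (ln r) - al * W (ln r)))
     (\<lambda>r. r powr (- al - 2) * (Z (ln r) - (2 * al + 1) * V (ln r) + al * (al + 1) * W (ln r))) r"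
  unfolding ode_at_def
proof (intro conjI)
  define s where "s = ln r"
  have d: "(W has_real_derivative V s) (at s)" "(V has_real_derivative Z s) (at s)"
    and ode: "(1 - exp (2 * s)) * Z s + (be - exp (2 * s)) * V s + f (W s) = 0"
    using S by (auto simp: sol_def)
  show "((\<lambda>r. r powr (- al) * W (ln r)) has_real_derivative r powr (- al - 1) * (V (ln r) - al * W (ln r))) (at r)"
    using power_form_deriv[of r W V "- al"] r d(1)[unfolded s_def] by simp
  have "((\<lambda>s. V s - al * W s) has_real_derivative Z s - al * V s) (at s)"
    by (intro DERIV_diff DERIV_cmult d)
  then have D: "((\<lambda>r. r powr (- al - 1) * (V (ln r) - al * W (ln r))) has_real_derivative
      r powr (- al - 1 - 1) * ((- al - 1) * (V (ln r) - al * W (ln r)) + (Z (ln r) - al * V (ln r)))) (at r)"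
    unfolding s_def
    by (rule power_form_deriv[OF r, of "\<lambda>s. V s - al * W s" "\<lambda>s. Z s - al * V s" "- al - 1"])
  have "- al - 1 - 1 = - al - 2" by simp
  moreover have "(- al - 1) * (V (ln r) - al * W (ln r)) + (Z (ln r) - al * V (ln r))
      = Z (ln r) - (2 * al + 1) * V (ln r) + al * (al + 1) * W (ln r)"
    by (simp add: algebra_simps)
  ultimately show "((\<lambda>r. r powr (- al - 1) * (V (ln r) - al * W (ln r))) has_real_derivative
      r powr (- al - 2) * (Z (ln r) - (2 * al + 1) * V (ln r) + al * (al + 1) * W (ln r))) (at r)"
    using D by (simp only:)
  define a where "a = r powr (- al - 2)"
  have a1: "r powr (- al - 1) = a * r"
  proof -
    have "r powr (- al - 2 + 1) = a * r" unfolding powr_add a_def using r by simp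
    moreover have "- al - 2 + 1 = - al - 1" by simp
    ultimately show ?thesis by (simp only:)
  qed
  have a0: "r powr (- al) = a * r\<^sup>2"
  proof -
    have "r powr (- al - 2 + 2) = a * r\<^sup>2" unfolding powr_add a_def using r by simp
    moreover have "- al - 2 + 2 = - al" by simp
    ultimately show ?thesis by (simp only:)
  qed
  have e: "exp (2 * s) = r\<^sup>2" using r by (simp add: s_def exp_double)
  have "\<bar>r powr (- al) * W s\<bar> powr (p - 1) = (r powr (- al)) powr (p - 1) * \<bar>W s\<bar> powr (p - 1)"
    by (simp add: abs_mult powr_mult)
  also have "(r powr (- al)) powr (p - 1) = r powr (- 2)" using al(2) by (simp add: powr_powr)
  also have "r powr (- 2) = 1 / r\<^sup>2" using r by (simp add: powr_minus divide_simps)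
  finally have n: "\<bar>r powr (- al) * W s\<bar> powr (p - 1) = \<bar>W s\<bar> powr (p - 1) / r\<^sup>2" by simp
  have nl: "\<bar>W s\<bar> powr (p - 1) * W s = ka * W s - (1 - r\<^sup>2) * Z s - (be - r\<^sup>2) * V s"
    using ode unfolding e f_def by (simp add: algebra_simps)
  have "\<bar>r powr (- al) * W s\<bar> powr (p - 1) * (r powr (- al) * W s) = a * (\<bar>W s\<bar> powr (p - 1) * W s)"
    unfolding n unfolding a0 using r by (simp add: field_simps)
  then have nn: "\<bar>r powr (- al) * W s\<bar> powr (p - 1) * (r powr (- al) * W s)
      = a * (ka * W s - (1 - r\<^sup>2) * Z s - (be - r\<^sup>2) * V s)" unfolding nl .
  show "(1 - r\<^sup>2) * (r powr (- al - 2) * (Z (ln r) - (2 * al + 1) * V (ln r) + al * (al + 1) * W (ln r))) +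
      ((1 + 2 * al + be) / r - 2 * (al + 1) * r) * (r powr (- al - 1) * (V (ln r) - al * W (ln r))) -
      al * (al + 1) * (r powr (- al) * W (ln r)) +
      \<bar>r powr (- al) * W (ln r)\<bar> powr (p - 1) * (r powr (- al) * W (ln r)) = 0"
    unfolding s_def[symmetric] nn unfolding a_def[symmetric] a1 a0 ka_def
    using r by (simp add: field_simps power2_eq_square)
qed

text \<open>At \<open>x \<noteq> 1\<close> the equation is divided by \<open>(1 - \<rho>\<^sup>2) / (\<rho> - x)\<close>, at \<open>x = 1\<close> by \<open>- (1 + \<rho>)\<close>; the
  latter gives the exponent \<open>(1 - be) / 2\<close>.\<close>

lemma positive_solution_holomorphic:
  assumes S: "\<And>r. r > 0 \<Longrightarrow> ode_at u u1 u2 r" and pos: "\<And>r. r > 0 \<Longrightarrow> u r > 0" and x: "x > 0"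
  obtains r U where "r > 0" "r \<le> x" "U holomorphic_on ball 0 r" "\<And>y. \<bar>y\<bar> < r \<Longrightarrow> U (of_real y) = of_real (u (x + y))"
proof -
  define q where "q z = (1 + 2 * of_real al + of_real be) / (of_real x + z) - 2 * (of_real al + 1) * (of_real x + z)" for z :: complex
  \<comment> \<open>The principal branch of \<zeta>^p extends the nonlinearity from positive reals;
    the disc of radius \<open>u x\<close> about \<open>u x\<close> lies in the right
    half-plane.\<close>
  define g where "g \<zeta> = exp (of_real p * Ln \<zeta>) - of_real (al * (al + 1)) * \<zeta>" for \<zeta>
  have g: "g (of_real y) = of_real (\<bar>y\<bar> powr (p - 1) * y - al * (al + 1) * y)" if "y > 0" for y
  proof -
    have "\<bar>y\<bar> powr (p - 1) * y = exp (p * ln y)"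
    proof -
      have "\<bar>y\<bar> powr (p - 1) * y = y powr p" using that powr_add[of y "p - 1" 1] by simp
      then show ?thesis using that by (simp add: powr_def)
    qed
    then show ?thesis using that by (simp add: g_def Ln_of_real exp_of_real flip: of_real_mult)
  qed
  have gh: "g holomorphic_on ball (of_real (u (x + 0))) (u x)"
  proof -
    have "Re \<zeta> > 0" if "\<zeta> \<in> ball (complex_of_real (u x)) (u x)" for \<zeta>
    proof -
      have "\<bar>Re (of_real (u x) - \<zeta>)\<bar> < u x" using that abs_Re_le_cmod[of "of_real (u x) - \<zeta>"] by (simp add: dist_norm)
      then show ?thesis by auto
    qed
    then have "\<zeta> \<notin> \<real>\<^sub>\<le>\<^sub>0" if "\<zeta> \<in> ball (complex_of_real (u x)) (u x)" for \<zeta>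
      using that by (force simp: complex_nonpos_Reals_iff)
    then show ?thesis unfolding g_def by (auto intro!: holomorphic_intros)
  qed
  have du: "((\<lambda>y. u (x + y)) has_real_derivative u1 (x + y)) (at y)"
      "((\<lambda>y. u1 (x + y)) has_real_derivative u2 (x + y)) (at y)"
    and ode: "(1 - (x + y)\<^sup>2) * u2 (x + y) + ((1 + 2 * al + be) / (x + y) - 2 * (al + 1) * (x + y)) * u1 (x + y)
       + (\<bar>u (x + y)\<bar> powr (p - 1) * u (x + y) - al * (al + 1) * u (x + y)) = 0" if "\<bar>y\<bar> < x" for y
  proof -
    have *: "ode_at u u1 u2 (x + y)" by (rule S) (use that in auto)
    have "((\<lambda>y. x + y) has_real_derivative 1) (at y)" by (auto intro!: derivative_eq_intros)
    then show "((\<lambda>y. u (x + y)) has_real_derivative u1 (x + y)) (at y)"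
      "((\<lambda>y. u1 (x + y)) has_real_derivative u2 (x + y)) (at y)"
      using * DERIV_chain2[where g = "\<lambda>y. x + y" and f = u] DERIV_chain2[where g = "\<lambda>y. x + y" and f = u1]
      unfolding ode_at_def by fastforce+
    show "(1 - (x + y)\<^sup>2) * u2 (x + y) + ((1 + 2 * al + be) / (x + y) - 2 * (al + 1) * (x + y)) * u1 (x + y)
       + (\<bar>u (x + y)\<bar> powr (p - 1) * u (x + y) - al * (al + 1) * u (x + y)) = 0"
      using * unfolding ode_at_def by linarith
  qed
  have odec: "(1 - (of_real x + of_real y)\<^sup>2) * of_real (u2 (x + y)) + q (of_real y) * of_real (u1 (x + y))
      + g (of_real (u (x + y))) = 0" if y: "\<bar>y\<bar> < x" for y
  proof -
    have "u (x + y) > 0" by (rule pos) (use y in auto)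
    then have "(1 - (of_real x + of_real y)\<^sup>2) * of_real (u2 (x + y)) + q (of_real y) * of_real (u1 (x + y))
      + g (of_real (u (x + y))) = complex_of_real ((1 - (x + y)\<^sup>2) * u2 (x + y) + ((1 + 2 * al + be) / (x + y) - 2 * (al + 1) * (x + y)) * u1 (x + y)
       + (\<bar>u (x + y)\<bar> powr (p - 1) * u (x + y) - al * (al + 1) * u (x + y)))"
      by (simp add: g q_def)
    then show ?thesis unfolding ode[OF y] by simp
  qed
  have xz: "of_real x + z \<noteq> 0" if "norm z < x" for z :: complex
  proof
    assume "of_real x + z = 0"
    then have "z = - of_real x" by (simp add: eq_neg_iff_add_eq_0 add.commute)
    then show False using that x by simp
  qed
  have qh: "q holomorphic_on ball 0 x" unfolding q_def using xz by (auto intro!: holomorphic_intros)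
  show ?thesis
  proof (cases "x = 1")
    case True
    define c where "c z = - q z / (2 + z)" for z
    define h where "h z = - 1 / (2 + z)" for z :: complex
    have z2: "2 + z \<noteq> 0" if "norm z < 1" for z :: complex
    proof
      assume "2 + z = 0"
      then have "z = - 2" by (simp add: eq_neg_iff_add_eq_0 add.commute)
      then show False using that by simp
    qed
    obtain r U where "r > 0" "r \<le> x" "U holomorphic_on ball 0 r" "\<And>y. \<bar>y\<bar> < r \<Longrightarrow> U (of_real y) = of_real (u (x + y))"
    proof (rule singular_ode_holomorphic[of x "u x" "(1 - be) / 2" "\<lambda>y. u (x + y)" "\<lambda>y. u1 (x + y)" "\<lambda>y. u2 (x + y)" c h g])
      show "0 < x" "0 < u x" "0 \<le> (1 - be) / 2" using x pos be by auto
      show "c holomorphic_on ball 0 x" "h holomorphic_on ball 0 x"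
        unfolding c_def h_def using qh z2 True by (auto intro!: holomorphic_intros)
      show "c 0 = of_real ((1 - be) / 2)" by (simp add: c_def q_def True field_simps)
      show "g holomorphic_on ball (of_real (u (x + 0))) (u x)" by (rule gh)
    next
      fix y :: real assume y: "\<bar>y\<bar> < x"
      let ?z = "complex_of_real y"
      have n: "2 + ?z \<noteq> 0" using z2[of ?z] y True by simp
      have "(2 + ?z) * (?z * of_real (u2 (x + y)) + c ?z * of_real (u1 (x + y)) + h ?z * g (of_real (u (x + y))))
        = (2 + ?z) * ?z * of_real (u2 (x + y)) - q ?z * of_real (u1 (x + y)) - g (of_real (u (x + y)))"
      proof -
        have "N * (Z * a + - Q / N * d + - 1 / N * e) = N * Z * a - Q * d - e" if "N \<noteq> 0" for N Z a Q d e :: complex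
          using that by (simp add: field_simps)
        then show ?thesis unfolding c_def h_def using n by blast
      qed
      also have "\<dots> = - ((1 - (of_real x + ?z)\<^sup>2) * of_real (u2 (x + y)) + q ?z * of_real (u1 (x + y)) + g (of_real (u (x + y))))"
        by (simp add: True power2_eq_square algebra_simps)
      also have "\<dots> = 0" using odec[OF y] by simp
      finally show "?z * of_real (u2 (x + y)) + c ?z * of_real (u1 (x + y)) + h ?z * g (of_real (u (x + y))) = 0"
        using n by simp
    qed (use du in auto)
    then show ?thesis using that by blast
  next
    case False
    \<comment> \<open>Keeps the disc away from both singular points \<rho> = 0 and \<rho> =
      1.\<close>
    define r0 where "r0 = min x \<bar>1 - x\<bar>"
    have r0: "r0 > 0" "r0 \<le> x" using x False by (auto simp: r0_def)
    define c where "c z = z * q z / (1 - (of_real x + z)\<^sup>2)" for z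
    define h where "h z = z / (1 - (of_real x + z)\<^sup>2)" for z :: complex
    have z2: "1 - (of_real x + z)\<^sup>2 \<noteq> 0" if "norm z < r0" for z :: complex
    proof
      assume "1 - (of_real x + z)\<^sup>2 = 0"
      then have "(1 - of_real x - z) * (1 + of_real x + z) = 0" by (simp add: power2_eq_square algebra_simps)
      then have "1 - of_real x - z = 0 \<or> 1 + of_real x + z = 0" by (simp only: mult_eq_0_iff)
      then have "z = of_real (1 - x) \<or> z = of_real (- 1 - x)"
      proof
        assume *: "1 - of_real x - z = 0"
        have "z = of_real (1 - x) - (1 - of_real x - z)" by simp
        then show ?thesis unfolding * by simp
      next
        assume *: "1 + of_real x + z = 0"
        have "z = (1 + of_real x + z) + of_real (- 1 - x)" by simp
        then show ?thesis unfolding * by simp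
      qed
      then have "norm z = \<bar>1 - x\<bar> \<or> norm z = \<bar>- 1 - x\<bar>" by (metis norm_of_real)
      then show False using that x by (auto simp: r0_def)
    qed
    obtain r U where "r > 0" "r \<le> r0" "U holomorphic_on ball 0 r" "\<And>y. \<bar>y\<bar> < r \<Longrightarrow> U (of_real y) = of_real (u (x + y))"
    proof (rule singular_ode_holomorphic[of r0 "u x" 0 "\<lambda>y. u (x + y)" "\<lambda>y. u1 (x + y)" "\<lambda>y. u2 (x + y)" c h g])
      show "0 < r0" "0 < u x" using r0 x pos by auto
      have "q holomorphic_on ball 0 r0" by (rule holomorphic_on_subset[OF qh]) (use r0 in auto)
      then show "c holomorphic_on ball 0 r0" "h holomorphic_on ball 0 r0"
        unfolding c_def h_def using z2 by (auto intro!: holomorphic_intros)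
      show "c 0 = of_real 0" by (simp add: c_def)
      show "g holomorphic_on ball (of_real (u (x + 0))) (u x)" by (rule gh)
    next
      fix y :: real assume y: "\<bar>y\<bar> < r0"
      let ?z = "complex_of_real y"
      have n: "1 - (of_real x + ?z)\<^sup>2 \<noteq> 0" using z2[of ?z] y by simp
      have "(1 - (of_real x + ?z)\<^sup>2) * (?z * of_real (u2 (x + y)) + c ?z * of_real (u1 (x + y)) + h ?z * g (of_real (u (x + y))))
        = ?z * ((1 - (of_real x + ?z)\<^sup>2) * of_real (u2 (x + y)) + q ?z * of_real (u1 (x + y)) + g (of_real (u (x + y))))"
      proof -
        have "N * (Z * a + Z * Q / N * d + Z / N * e) = Z * (N * a + Q * d + e)" if "N \<noteq> 0" for N Z a Q d e :: complex
          using that by (simp add: field_simps)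
        then show ?thesis unfolding c_def h_def using n by blast
      qed
      also have "\<dots> = 0" using odec[of y] y r0 by simp
      finally show "?z * of_real (u2 (x + y)) + c ?z * of_real (u1 (x + y)) + h ?z * g (of_real (u (x + y))) = 0"
        using n by simp
    qed (use du r0 in auto)
    then show ?thesis using that r0 by (meson order_trans)
  qed
qed

text \<open>The equation cannot be solved for \<open>u2\<close> at \<rho> = 1, so its continuity
  there is taken from the second complex derivative of the holomorphic extension.\<close>

lemma positive_solution_regularity:
  assumes S: "\<And>r. r > 0 \<Longrightarrow> ode_at u u1 u2 r" and pos: "\<And>r. r > 0 \<Longrightarrow> u r > 0"
  shows "real_analytic_on {0<..} u" "continuous_on {0<..} u2"
proof -
  show "real_analytic_on {0<..} u"
    unfolding real_analytic_on_def
  proof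
    fix x :: real assume "x \<in> {0<..}"
    then have x: "x > 0" by simp
    obtain r U where U: "r > 0" "r \<le> x" "U holomorphic_on ball 0 r" "\<And>y. \<bar>y\<bar> < r \<Longrightarrow> U (of_real y) = of_real (u (x + y))"
      using positive_solution_holomorphic[OF S pos x] by blast
    obtain a where a: "\<And>y. \<bar>y\<bar> < r \<Longrightarrow> (\<lambda>n. a n * y ^ n) sums u (x + y)"
      using holomorphic_real_power_series[OF U(3), of "\<lambda>y. u (x + y)"] U(4) by blast
    then have "\<forall>y\<in>{0<..}. \<bar>y - x\<bar> < r \<longrightarrow> (\<lambda>n. a n * (y - x) ^ n) sums u y"
      by (metis add.commute diff_add_cancel)
    then show "\<exists>r>0. \<exists>a. \<forall>y\<in>{0<..}. \<bar>y - x\<bar> < r \<longrightarrow> (\<lambda>n. a n * (y - x) ^ n) sums u y"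
      using U(1) by blast
  qed
  have "isCont u2 x" if x: "x > 0" for x
  proof -
    obtain r U where U: "r > 0" "r \<le> x" "U holomorphic_on ball 0 r" "\<And>y. \<bar>y\<bar> < r \<Longrightarrow> U (of_real y) = of_real (u (x + y))"
      using positive_solution_holomorphic[OF S pos x] by blast
    have d: "((\<lambda>y. u (x + y)) has_real_derivative u1 (x + y)) (at y)"
        "((\<lambda>y. u1 (x + y)) has_real_derivative u2 (x + y)) (at y)" if y: "\<bar>y\<bar> < r" for y
    proof -
      have *: "ode_at u u1 u2 (x + y)" by (rule S) (use y U in auto)
      have "((\<lambda>y. x + y) has_real_derivative 1) (at y)" by (auto intro!: derivative_eq_intros)
      then show "((\<lambda>y. u (x + y)) has_real_derivative u1 (x + y)) (at y)"
        "((\<lambda>y. u1 (x + y)) has_real_derivative u2 (x + y)) (at y)"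
        using * DERIV_chain2[where g = "\<lambda>y. x + y" and f = u] DERIV_chain2[where g = "\<lambda>y. x + y" and f = u1]
        unfolding ode_at_def by fastforce+
    qed
    have h1: "deriv U holomorphic_on ball 0 r" "deriv (deriv U) holomorphic_on ball 0 r"
      using U(3) by (auto intro!: holomorphic_deriv)
    have e1: "deriv U (of_real y) = of_real (u1 (x + y))" if "\<bar>y\<bar> < r" for y
      using holomorphic_real_derivative[OF U(3,4) that d(1)[OF that]] .
    have e2: "deriv (deriv U) (of_real y) = of_real (u2 (x + y))" if "\<bar>y\<bar> < r" for y
      using holomorphic_real_derivative[OF h1(1) e1 that d(2)[OF that]] .
    have "continuous_on {x - r<..<x + r} (\<lambda>y. Re (deriv (deriv U) (of_real (y - x))))"
      by (intro continuous_intros continuous_on_compose2[OF holomorphic_on_imp_continuous_on[OF h1(2)]])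
        (auto simp: dist_norm simp flip: of_real_diff)
    moreover have "Re (deriv (deriv U) (of_real (y - x))) = u2 y" if "y \<in> {x - r<..<x + r}" for y
    proof -
      have "\<bar>y - x\<bar> < r" using that by auto
      from e2[OF this] show ?thesis by simp
    qed
    ultimately have "continuous_on {x - r<..<x + r} u2" by (rule continuous_on_eq)
    then show ?thesis using U(1) by (simp add: continuous_on_eq_continuous_at)
  qed
  then show "continuous_on {0<..} u2" by (auto intro: continuous_at_imp_continuous_on)
qed

text \<open>The logarithm sends the centre to minus infinity, so the extension is built on \<rho> >
  0 only and matched to \<open>u\<close> on the open interval.\<close>

lemma large_solutions_extend:
  obtains C where "C > 0" "\<And>\<sigma> u u1 u2. \<sigma> > 1 \<Longrightarrow> regular_sol \<sigma> u u1 u2 \<Longrightarrow> u 0 \<ge> C \<Longrightarrow>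
    (\<forall>\<rho>\<in>{0..<\<sigma>}. u \<rho> > 0) \<and> (\<exists>U U1 U2 L. (\<forall>\<rho>\<in>{0<..<\<sigma>}. U \<rho> = u \<rho>) \<and> (\<forall>\<rho>>0. U \<rho> > 0 \<and> ode_at U U1 U2 \<rho>)
      \<and> L > 0 \<and> ((\<lambda>\<rho>. \<rho> powr al * U \<rho>) \<longlongrightarrow> L) at_top \<and> ((\<lambda>\<rho>. \<rho> powr (al + 1) * U1 \<rho>) \<longlongrightarrow> - al * L) at_top)"
proof -
  obtain \<eta> where \<eta>: "\<eta> > 0" "\<And>\<tau> w v z. \<tau> > 0 \<Longrightarrow> sol {..<\<tau>} w v z \<Longrightarrow> \<bar>w 0 - b\<bar> < \<eta> \<Longrightarrow> \<bar>v 0\<bar> < \<eta> \<Longrightarrow>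
    \<exists>W V Z. sol UNIV W V Z \<and> (\<forall>s<\<tau>. W s = w s) \<and> (\<forall>s\<ge>0. \<bar>W s - b\<bar> < b / 2 \<and> \<bar>V s\<bar> < b / 2)"
    using global_extension by blast
  obtain C where C: "C > 0" "\<And>\<sigma> u u1 u2. \<sigma> > 1 \<Longrightarrow> regular_sol \<sigma> u u1 u2 \<Longrightarrow> u 0 \<ge> C \<Longrightarrow>
     (\<forall>\<rho>\<in>{0..1}. u \<rho> > 0) \<and> \<bar>lw u 0 - b\<bar> < \<eta> \<and> \<bar>lv u u1 0\<bar> < \<eta>"
    using close_to_singular_at_light_cone[OF \<eta>(1)] by blast
  show ?thesis
  proof (rule that[OF C(1)])
    fix \<sigma> u u1 u2 assume \<sigma>: "\<sigma> > (1::real)" and reg: "regular_sol \<sigma> u u1 u2" and u0: "u 0 \<ge> C"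
    note c = C(2)[OF \<sigma> reg u0]
    have ls: "exp s < \<sigma> \<longleftrightarrow> s < ln \<sigma>" for s
    proof -
      have "exp s < exp (ln \<sigma>) \<longleftrightarrow> s < ln \<sigma>" by (rule exp_less_cancel_iff)
      then show ?thesis using \<sigma> by simp
    qed
    have S: "sol {..<ln \<sigma>} (lw u) (lv u u1) (lz u u1 u2)"
      using emden_fowler[OF reg] unfolding ls lessThan_def .
    have "\<exists>W V Z. sol UNIV W V Z \<and> (\<forall>s<ln \<sigma>. W s = lw u s) \<and> (\<forall>s\<ge>0. \<bar>W s - b\<bar> < b / 2 \<and> \<bar>V s\<bar> < b / 2)"
      by (rule \<eta>(2)[OF _ S]) (use c \<sigma> in auto)
    then obtain W V Z where W: "sol UNIV W V Z" "\<And>s. s < ln \<sigma> \<Longrightarrow> W s = lw u s"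
      "\<And>s. s \<ge> 0 \<Longrightarrow> \<bar>W s - b\<bar> < b / 2 \<and> \<bar>V s\<bar> < b / 2"
      by blast
    obtain L where L: "L > 0" "(W \<longlongrightarrow> L) at_top" "(V \<longlongrightarrow> 0) at_top"
      using asymptotics_at_infinity[OF W(1,3)] by blast
    define U where "U r = r powr (- al) * W (ln r)" for r
    define U1 where "U1 r = r powr (- al - 1) * (V (ln r) - al * W (ln r))" for r
    define U2 where "U2 r = r powr (- al - 2) * (Z (ln r) - (2 * al + 1) * V (ln r) + al * (al + 1) * W (ln r))" for r
    have ode: "ode_at U U1 U2 r" if "r > 0" for r
      using sol_imp_ode_at[OF W(1) that] unfolding U_def[abs_def] U1_def[abs_def] U2_def[abs_def] .
    have Uu: "U r = u r" if r: "0 < r" "r < \<sigma>" for r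
    proof -
      have "ln r < ln \<sigma>" using r by simp
      from W(2)[OF this] show ?thesis using r
        by (simp add: U_def lw_def powr_def mult.assoc[symmetric] flip: exp_add)
    qed
    \<comment> \<open>Below the cone positivity comes from \<open>u\<close> itself, from the cone on
      from |W - b| < b / 2.\<close>
    have Up: "U r > 0" if r: "r > 0" for r
    proof (cases "r < 1")
      case True
      then show ?thesis using Uu[of r] c \<sigma> r by auto
    next
      case False
      then have "\<bar>W (ln r) - b\<bar> < b / 2" using W(3)[of "ln r"] by simp
      then have "W (ln r) > 0" by linarith
      then show ?thesis using r by (simp add: U_def)
    qed
    have up: "u r > 0" if r: "r \<in> {0..<\<sigma>}" for r
    proof (cases "r = 0")
      case True then show ?thesis using c by auto
    next
      case False then show ?thesis using Up[of r] Uu[of r] r by auto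
    qed
    have gt0: "\<forall>\<^sub>F r in at_top. r > (0::real)" by (rule eventually_gt_at_top)
    have "((\<lambda>r. W (ln r)) \<longlongrightarrow> L) at_top" by (rule filterlim_compose[OF L(2) ln_at_top])
    then have l1: "((\<lambda>r. r powr al * U r) \<longlongrightarrow> L) at_top"
      by (rule Lim_transform_eventually)
        (use gt0 in eventually_elim, simp add: U_def mult.assoc[symmetric] powr_add[symmetric])
    have "((\<lambda>r. V (ln r) - al * W (ln r)) \<longlongrightarrow> 0 - al * L) at_top"
      by (intro tendsto_intros filterlim_compose[OF L(2) ln_at_top] filterlim_compose[OF L(3) ln_at_top])
    then have "((\<lambda>r. r powr (al + 1) * U1 r) \<longlongrightarrow> 0 - al * L) at_top"
      by (rule Lim_transform_eventually)
        (use gt0 in eventually_elim, simp add: U1_def mult.assoc[symmetric] powr_add[symmetric])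
    then have l2: "((\<lambda>r. r powr (al + 1) * U1 r) \<longlongrightarrow> - al * L) at_top" by simp
    show "(\<forall>\<rho>\<in>{0..<\<sigma>}. u \<rho> > 0) \<and> (\<exists>U U1 U2 L. (\<forall>\<rho>\<in>{0<..<\<sigma>}. U \<rho> = u \<rho>) \<and> (\<forall>\<rho>>0. U \<rho> > 0 \<and> ode_at U U1 U2 \<rho>)
      \<and> L > 0 \<and> ((\<lambda>\<rho>. \<rho> powr al * U \<rho>) \<longlongrightarrow> L) at_top \<and> ((\<lambda>\<rho>. \<rho> powr (al + 1) * U1 \<rho>) \<longlongrightarrow> - al * L) at_top)"
      using up Uu Up ode L(1) l1 l2
      by (intro conjI exI[of _ U] exI[of _ U1] exI[of _ U2] exI[of _ L]) auto
  qed
qed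

end

section \<open>Translation of the hypotheses on N and p, and assembly of the theorem\<close>

lemma profile_ode_alpha:
  fixes N :: nat and p :: real
  assumes "N \<ge> 3" "p > 1 + 4 / (real N - 2)" "N \<ge> 4 \<Longrightarrow> p \<le> 1 + 4 / (real N - 3)"
  shows "profile_ode p (alpha p) (real N - 2 - 2 * alpha p)"
proof -
  have n: "real N \<ge> 3" using assms(1) by simp
  have "0 < 4 / (real N - 2)" using n by simp
  then have p: "p > 1" using assms(2) by linarith
  have "(p - 1) * (real N - 2) > 4" using assms(2) n by (simp add: field_simps)
  then have a: "2 * alpha p < real N - 2" using p by (simp add: alpha_def field_simps)
  have b: "real N - 3 \<le> 2 * alpha p"
  \<comment> \<open>For N = 3 the quotient \<open>4 / (real N - 3)\<close> is 0 by convention and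
    would carry no meaning as a bound; the claim there is just that \<open>alpha p\<close> is
    nonnegative.\<close>
  proof (cases "N = 3")
    case True then show ?thesis using p by (simp add: alpha_def)
  next
    case False
    then have N4: "N \<ge> 4" using assms(1) by simp
    then have "(p - 1) * (real N - 3) \<le> 4" using assms(3) by (simp add: field_simps)
    then show ?thesis using p by (simp add: alpha_def field_simps)
  qed
  have "alpha p > 0" using p by (simp add: alpha_def)
  moreover have "alpha p * (p - 1) = 2"
  proof -
    have "p - 1 \<noteq> 0" using p by simp
    from iffD1[OF nonzero_eq_divide_eq[OF this] alpha_def] show ?thesis .
  qed
  ultimately show ?thesis by unfold_locales (use p a b in linarith)+
qed

lemma (in profile_ode) regular_sol_of_solves_E:
  assumes "C2_on {0..<\<sigma>} u" "solves_E N p {0<..<\<sigma>} u" "al = alpha p" "be = real N - 2 - 2 * alpha p"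
  obtains u1 u2 where "regular_sol \<sigma> u u1 u2"
proof -
  obtain u1 u2 where u: "\<And>x. x \<in> {0..<\<sigma>} \<Longrightarrow> (u has_real_derivative u1 x) (at x within {0..<\<sigma>})"
     "\<And>x. x \<in> {0..<\<sigma>} \<Longrightarrow> (u1 has_real_derivative u2 x) (at x within {0..<\<sigma>})"
    using assms(1) unfolding C2_on_def by blast
  have "at x within {0..<\<sigma>} = at x" if "x \<in> {0<..<\<sigma>}" for x
    by (rule at_within_open_subset[OF that]) auto
  then have d: "(u has_real_derivative u1 x) (at x)" "(u1 has_real_derivative u2 x) (at x)" if "x \<in> {0<..<\<sigma>}" for x
    using u[of x] that by auto
  have "regular_sol \<sigma> u u1 u2"
    unfolding regular_sol_def
  proof (intro conjI ballI d)
    show "continuous_on {0..<\<sigma>} u" "continuous_on {0..<\<sigma>} u1" by (rule DERIV_continuous_on, erule u)+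
    fix x assume x: "x \<in> {0<..<\<sigma>}"
    have "1 + 2 * al + be = real N - 1" using assms(3,4) by simp
    moreover have "(1 - x\<^sup>2) * deriv (deriv u) x + ((real N - 1) / x - 2 * (alpha p + 1) * x) * deriv u x
          - alpha p * (alpha p + 1) * u x + \<bar>u x\<bar> powr (p - 1) * u x = 0"
      using assms(2) x unfolding solves_E_def by blast
    ultimately show "(1 - x\<^sup>2) * u2 x + ((1 + 2 * al + be) / x - 2 * (al + 1) * x) * u1 x
          - al * (al + 1) * u x + \<bar>u x\<bar> powr (p - 1) * u x = 0"
      using deriv_deriv_on_open[OF open_greaterThanLessThan d x] assms(3) by (simp only:)
  qed
  then show ?thesis using that by blast
qed

theorem theorem1p3:
  fixes N :: nat and p :: real
  assumes "N \<ge> 3"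
    and "p > 1 + 4 / (real N - 2)"
    and "N \<ge> 4 \<Longrightarrow> p \<le> 1 + 4 / (real N - 3)"
  shows
    "(\<exists>C>0. \<forall>(\<sigma>::real) (u :: real \<Rightarrow> real).
        \<sigma> > 1 \<longrightarrow> C2_on {0..<\<sigma>} u \<longrightarrow> solves_E N p {0<..<\<sigma>} u \<longrightarrow> u 0 \<ge> C \<longrightarrow>
          (\<forall>\<rho>\<in>{0..<\<sigma>}. u \<rho> > 0) \<and>
          (\<exists>v. extends_globally N p \<sigma> u v \<and>
               real_analytic_on {0<..} v \<and>
               (\<forall>\<rho>>0. v \<rho> > 0) \<and>
               (\<exists>L>0. asymptotics_A p L v)))
     \<and>
     (N = 3 \<or> (N \<ge> 4 \<and> p < 1 + 4 / (real N - 3)) \<longrightarrow>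
        (\<forall>(u :: nat \<Rightarrow> real \<Rightarrow> real) (r :: nat \<Rightarrow> real).
           (\<forall>n. r n > 1 \<and> real_analytic_on {0..<r n} (u n) \<and>
                (\<forall>\<rho>\<in>{0..<r n}. u n \<rho> > 0) \<and>
                solves_E N p {0<..<r n} (u n) \<and>
                finite (zeros_diff N p (u n)) \<and> card (zeros_diff N p (u n)) = n + 1) \<longrightarrow>
           filterlim (\<lambda>n. u n 0) at_top sequentially \<longrightarrow>
           (\<forall>\<^sub>F n in sequentially.
              \<exists>v. extends_globally N p (r n) (u n) v \<and> (\<exists>L>0. asymptotics_A p L v))))
     \<and>
     (N \<ge> 4 \<and> p = 1 + 4 / (real N - 3) \<longrightarrow>
        (\<forall>\<^sub>F C0 in at_top. \<forall>n0::nat. n0 \<ge> 1 \<longrightarrow>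
           (\<forall>(r::real) (u :: real \<Rightarrow> real).
              r > 1 \<longrightarrow> real_analytic_on {0..<r} u \<longrightarrow>
              (\<forall>\<rho>\<in>{0..<r}. u \<rho> > 0) \<longrightarrow>
              solves_E N p {0<..<r} u \<longrightarrow>
              u 0 > C0 \<longrightarrow> u 1 = b_zero p \<longrightarrow>
              (infinite (zeros_diff N p u) \<or> card (zeros_diff N p u) \<ge> n0) \<longrightarrow>
              (\<exists>v. extends_globally N p r u v \<and> (\<exists>L>0. asymptotics_A p L v)))))"
proof -
  interpret profile_ode p "alpha p" "real N - 2 - 2 * alpha p"
    by (rule profile_ode_alpha[OF assms])
  obtain C where C: "C > 0" "\<And>\<sigma> u u1 u2. \<sigma> > 1 \<Longrightarrow> regular_sol \<sigma> u u1 u2 \<Longrightarrow> u 0 \<ge> C \<Longrightarrow>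
    (\<forall>\<rho>\<in>{0..<\<sigma>}. u \<rho> > 0) \<and> (\<exists>U U1 U2 L. (\<forall>\<rho>\<in>{0<..<\<sigma>}. U \<rho> = u \<rho>) \<and> (\<forall>\<rho>>0. U \<rho> > 0 \<and> ode_at U U1 U2 \<rho>)
      \<and> L > 0 \<and> ((\<lambda>\<rho>. \<rho> powr alpha p * U \<rho>) \<longlongrightarrow> L) at_top
      \<and> ((\<lambda>\<rho>. \<rho> powr (alpha p + 1) * U1 \<rho>) \<longlongrightarrow> - alpha p * L) at_top)"
    using large_solutions_extend by blast
  have main: "(\<forall>\<rho>\<in>{0..<\<sigma>}. u \<rho> > 0) \<and>
          (\<exists>v. extends_globally N p \<sigma> u v \<and> real_analytic_on {0<..} v \<and>
               (\<forall>\<rho>>0. v \<rho> > 0) \<and> (\<exists>L>0. asymptotics_A p L v))"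
    if \<sigma>: "\<sigma> > 1" and C2: "C2_on {0..<\<sigma>} u" and E: "solves_E N p {0<..<\<sigma>} u" and u0: "u 0 \<ge> C" for \<sigma> u
  proof -
    obtain u1 u2 where reg: "regular_sol \<sigma> u u1 u2"
      using regular_sol_of_solves_E[OF C2 E refl refl] by blast
    obtain U U1 U2 L where pos: "\<And>\<rho>. \<rho> \<in> {0..<\<sigma>} \<Longrightarrow> u \<rho> > 0"
      and U: "\<And>\<rho>. \<rho> \<in> {0<..<\<sigma>} \<Longrightarrow> U \<rho> = u \<rho>" "\<And>\<rho>. \<rho> > 0 \<Longrightarrow> U \<rho> > 0" "\<And>\<rho>. \<rho> > 0 \<Longrightarrow> ode_at U U1 U2 \<rho>"
      and L: "L > 0" "((\<lambda>\<rho>. \<rho> powr alpha p * U \<rho>) \<longlongrightarrow> L) at_top"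
        "((\<lambda>\<rho>. \<rho> powr (alpha p + 1) * U1 \<rho>) \<longlongrightarrow> - alpha p * L) at_top"
      using C(2)[OF \<sigma> reg u0] by blast
    \<comment> \<open>Keeping \<open>u\<close> below \<sigma> preserves the value at the centre,
      about which \<open>U\<close> carries no information.\<close>
    define v where "v \<rho> = (if \<rho> < \<sigma> then u \<rho> else U \<rho>)" for \<rho>
    have vU: "v \<rho> = U \<rho>" if "\<rho> > 0" for \<rho> using U(1)[of \<rho>] that by (simp add: v_def)
    have dU: "(U has_real_derivative U1 r) (at r)" "(U1 has_real_derivative U2 r) (at r)" if "r > 0" for r
      using U(3)[OF that] by (auto simp: ode_at_def)
    have dv: "(v has_real_derivative U1 r) (at r)" if "r > 0" for r
      using dU(1)[OF that]
      by (rule has_field_derivative_transform_within_open[of _ _ _ "{0<..}"]) (use that vU in auto)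
    have D: "deriv v r = U1 r" "deriv (deriv v) r = U2 r" if "r > 0" for r
      using deriv_deriv_on_open[of "{0<..}" v U1 U2 r] dv dU(2) that by auto
    have reg: "real_analytic_on {0<..} U" "continuous_on {0<..} U2"
      using positive_solution_regularity[OF U(3,2)] by auto
    have "real_analytic_on {0<..} v" using reg(1) vU unfolding real_analytic_on_def by fastforce
    moreover have "C2_on {0<..} v"
      unfolding C2_on_def
      using dv dU(2) reg(2) by (intro exI[of _ U1] exI[of _ U2]) (auto intro: has_field_derivative_at_within)
    moreover have "(1 - r\<^sup>2) * deriv (deriv v) r + ((real N - 1) / r - 2 * (alpha p + 1) * r) * deriv v r
        - alpha p * (alpha p + 1) * v r + \<bar>v r\<bar> powr (p - 1) * v r = 0" if r: "r > 0" for r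
    proof -
      have "1 + 2 * alpha p + (real N - 2 - 2 * alpha p) = real N - 1" by simp
      then show ?thesis using U(3)[OF r] D[OF r] vU[OF r] unfolding ode_at_def by simp
    qed
    moreover have "asymptotics_A p L v"
      unfolding asymptotics_A_def
    proof
      have gt0: "\<forall>\<^sub>F r in at_top. r > (0::real)" by (rule eventually_gt_at_top)
      show "((\<lambda>\<rho>. \<rho> powr alpha p * v \<rho>) \<longlongrightarrow> L) at_top"
        using L(2) by (rule Lim_transform_eventually) (use gt0 in eventually_elim, simp add: vU)
      show "((\<lambda>\<rho>. \<rho> powr (alpha p + 1) * deriv v \<rho>) \<longlongrightarrow> - alpha p * L) at_top"
        using L(3) by (rule Lim_transform_eventually) (use gt0 in eventually_elim, simp add: D)
    qed
    ultimately show ?thesis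
      using pos L(1) vU U(2)
      by (intro conjI ballI exI[of _ v])
        (auto simp: extends_globally_def solves_E_def v_def[abs_def] intro: exI[of _ L])
  qed
  \<comment> \<open>Analyticity up to the centre supplies the C^2 regularity there; both particular
    cases then follow once u(0) is at least \<open>C\<close>.\<close>
  have analytic: "\<exists>v. extends_globally N p r u v \<and> (\<exists>L>0. asymptotics_A p L v)"
    if "r > 1" "real_analytic_on {0..<r} u" "solves_E N p {0<..<r} u" "u 0 \<ge> C" for r u
  proof -
    have "C2_on {0..<r} u"
      using that by (intro real_analytic_imp_C2_on) (auto simp: solves_E_def)
    then show ?thesis using main[of r u] that by blast
  qed
  show ?thesis
  proof (intro conjI impI)
    show "\<exists>C>0. \<forall>(\<sigma>::real) (u :: real \<Rightarrow> real).
        \<sigma> > 1 \<longrightarrow> C2_on {0..<\<sigma>} u \<longrightarrow> solves_E N p {0<..<\<sigma>} u \<longrightarrow> u 0 \<ge> C \<longrightarrow>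
          (\<forall>\<rho>\<in>{0..<\<sigma>}. u \<rho> > 0) \<and>
          (\<exists>v. extends_globally N p \<sigma> u v \<and> real_analytic_on {0<..} v \<and>
               (\<forall>\<rho>>0. v \<rho> > 0) \<and> (\<exists>L>0. asymptotics_A p L v))"
      using C(1) main by blast
  next
    show "\<forall>(u :: nat \<Rightarrow> real \<Rightarrow> real) (r :: nat \<Rightarrow> real).
           (\<forall>n. r n > 1 \<and> real_analytic_on {0..<r n} (u n) \<and>
                (\<forall>\<rho>\<in>{0..<r n}. u n \<rho> > 0) \<and>
                solves_E N p {0<..<r n} (u n) \<and>
                finite (zeros_diff N p (u n)) \<and> card (zeros_diff N p (u n)) = n + 1) \<longrightarrow>
           filterlim (\<lambda>n. u n 0) at_top sequentially \<longrightarrow>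
           (\<forall>\<^sub>F n in sequentially.
              \<exists>v. extends_globally N p (r n) (u n) v \<and> (\<exists>L>0. asymptotics_A p L v))"
    proof (intro allI impI)
      fix u :: "nat \<Rightarrow> real \<Rightarrow> real" and r :: "nat \<Rightarrow> real"
      assume u: "\<forall>n. r n > 1 \<and> real_analytic_on {0..<r n} (u n) \<and>
                (\<forall>\<rho>\<in>{0..<r n}. u n \<rho> > 0) \<and> solves_E N p {0<..<r n} (u n) \<and>
                finite (zeros_diff N p (u n)) \<and> card (zeros_diff N p (u n)) = n + 1"
        and lim: "filterlim (\<lambda>n. u n 0) at_top sequentially"
      have "\<forall>\<^sub>F n in sequentially. C \<le> u n 0" using lim by (simp add: filterlim_at_top)
      then show "\<forall>\<^sub>F n in sequentially. \<exists>v. extends_globally N p (r n) (u n) v \<and> (\<exists>L>0. asymptotics_A p L v)"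
        by eventually_elim (use u analytic in blast)
    qed
  next
    have "\<forall>\<^sub>F C0 in at_top. C \<le> C0" by (rule eventually_ge_at_top)
    then show "\<forall>\<^sub>F C0 in at_top. \<forall>n0::nat. n0 \<ge> 1 \<longrightarrow>
           (\<forall>(r::real) (u :: real \<Rightarrow> real).
              r > 1 \<longrightarrow> real_analytic_on {0..<r} u \<longrightarrow>
              (\<forall>\<rho>\<in>{0..<r}. u \<rho> > 0) \<longrightarrow>
              solves_E N p {0<..<r} u \<longrightarrow>
              u 0 > C0 \<longrightarrow> u 1 = b_zero p \<longrightarrow>
              (infinite (zeros_diff N p u) \<or> card (zeros_diff N p u) \<ge> n0) \<longrightarrow>
              (\<exists>v. extends_globally N p r u v \<and> (\<exists>L>0. asymptotics_A p L v)))"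
      by eventually_elim (use analytic in \<open>auto intro: less_imp_le\<close>)
  qed
qed

end
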